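(* Let $f\in\mathbb{C}[x_0,\dots,x_n]$ be a homogeneous polynomial of degree $k\ge1$. The degree of the toric polar map $T_f$ depends only on the reduced polynomial associated with $f$, that is, $$\deg T_f=\deg T_{f_{\mathrm{red}}}.$$
   Context: The toric polar map of a homogeneous polynomial $f$ is the rational map $T_f\colon\mathbb{P}^n\dashrightarrow\mathbb{P}^n$ (over $\mathbb{C}$), $x\mapsto(x_0f_{x_0}(x):\cdots:x_nf_{x_n}(x))$, where $f_{x_i}=\partial f/\partial x_i$. If $f=f_1^{n_1}\cdots f_l^{n_l}$ is a factorization into pairwise non-associate irreducible factors with $n_j\geq 1$, then $f_{\mathrm{red}}=f_1\cdots f_l$. The degree of a rational map $\mathbb{P}^n\dashrightarrow\mathbb{P}^n$ is the degree of the corresponding function field extension when it is dominant (the number of points of a general fiber) and $0$ otherwise. *)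

theory Defs
  imports
    Complex_Main
    "HOL-Library.Poly_Mapping"
    "HOL-Computational_Algebra.Fraction_Field"
    "HOL-Algebra.Embedded_Algebras"
    "HOL-Algebra.Algebraic_Closure_Type"
begin

section \<open>Polynomials in the variables indexed by a finite type\<close>

text \<open>
  The variables \<open>x\<^sub>0, \<dots>, x\<^sub>n\<close> are indexed by a finite, linearly ordered type \<open>'n\<close> with
  \<open>n + 1\<close> elements. A monomial is its exponent vector \<open>'n \<Rightarrow>\<^sub>0 nat\<close>, and a polynomial is a finitely
  supported family of coefficients, with the convolution product of \<^theory>\<open>HOL-Library.Poly_Mapping\<close>.
  The order on \<open>'n\<close> serves only to obtain the \<^class>\<open>idom\<close> instance.
\<close>

type_synonym 'n cpoly = "('n \<Rightarrow>\<^sub>0 nat) \<Rightarrow>\<^sub>0 complex"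

definition pconst :: "complex \<Rightarrow> 'n cpoly"
  where "pconst c = Poly_Mapping.single 0 c"

definition pvar :: "'n \<Rightarrow> 'n cpoly"
  where "pvar i = Poly_Mapping.single (Poly_Mapping.single i 1) 1"

text \<open>The zero polynomial is homogeneous of every degree.\<close>

definition homogeneous :: "nat \<Rightarrow> 'n::finite cpoly \<Rightarrow> bool"
  where "homogeneous d p \<longleftrightarrow>
    (\<forall>m \<in> Poly_Mapping.keys p. (\<Sum>i\<in>UNIV. Poly_Mapping.lookup m i) = d)"

text \<open>
  Where the truncated subtraction of exponents matters (\<open>x\<^sub>i\<close> does not occur in the monomial), the
  coefficient is 0.
\<close>

definition partial_deriv :: "'n \<Rightarrow> 'n cpoly \<Rightarrow> 'n cpoly"
  where "partial_deriv i p =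
    (\<Sum>m \<in> Poly_Mapping.keys p.
       Poly_Mapping.single (m - Poly_Mapping.single i 1)
         (of_nat (Poly_Mapping.lookup m i) * Poly_Mapping.lookup p m))"

definition peval :: "'n::finite cpoly \<Rightarrow> ('n \<Rightarrow> complex) \<Rightarrow> complex"
  where "peval p x =
    (\<Sum>m \<in> Poly_Mapping.keys p.
       Poly_Mapping.lookup p m * (\<Prod>i\<in>UNIV. x i ^ Poly_Mapping.lookup m i))"

text \<open>The polynomial \<open>p (F\<^sub>0, \<dots>, F\<^sub>n)\<close>.\<close>

definition psubst :: "'n::finite cpoly \<Rightarrow> ('n \<Rightarrow> 'n cpoly) \<Rightarrow> 'n cpoly"
  where "psubst p F =
    (\<Sum>m \<in> Poly_Mapping.keys p.
       pconst (Poly_Mapping.lookup p m) * (\<Prod>i\<in>UNIV. F i ^ Poly_Mapping.lookup m i))"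

text \<open>
  \<open>f = f\<^sub>1\<^bsup>n\<^sub>1\<^esup> \<cdots> f\<^sub>l\<^bsup>n\<^sub>l\<^esup>\<close> (indices shifted to \<open>0, \<dots>, l - 1\<close>); as every complex number has roots of all
  orders, no separate unit is needed.
\<close>

definition irreducible_factorization ::
    "'n::{finite,linorder} cpoly \<Rightarrow> nat \<Rightarrow> (nat \<Rightarrow> 'n cpoly) \<Rightarrow> (nat \<Rightarrow> nat) \<Rightarrow> bool"
  where "irreducible_factorization f l fs ns \<longleftrightarrow>
    f = (\<Prod>j<l. fs j ^ ns j) \<and>
    (\<forall>j<l. Factorial_Ring.irreducible (fs j) \<and> ns j \<ge> 1) \<and>
    (\<forall>i<l. \<forall>j<l. i \<noteq> j \<longrightarrow> \<not> (fs i dvd fs j \<and> fs j dvd fs i))"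


section \<open>Rational self-maps of projective space and their degree\<close>

text \<open>
  A rational map \<open>\<P>\<^sup>n \<dashrightarrow> \<P>\<^sup>n\<close> is represented by a tuple \<open>F\<close> of homogeneous polynomials of one common
  degree that are not all zero; points of \<open>\<P>\<^sup>n\<close> are represented by nonzero coordinate vectors. The
  map sends the class of \<open>x\<close> to that of \<open>F x\<close> wherever \<open>F x\<close> is nonzero.
\<close>

definition rat_map_image :: "('n::finite \<Rightarrow> 'n cpoly) \<Rightarrow> ('n \<Rightarrow> complex) set"
  where "rat_map_image F =
    {y. y \<noteq> (\<lambda>_. 0) \<and> (\<exists>x. x \<noteq> (\<lambda>_. 0) \<and> y = (\<lambda>i. peval (F i) x))}"

text \<open>Zariski density of the image: only the zero form vanishes on it.\<close>

definition dominant :: "('n::finite \<Rightarrow> 'n cpoly) \<Rightarrow> bool"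
  where "dominant F \<longleftrightarrow>
    (\<forall>d G. homogeneous d G \<and> (\<forall>y \<in> rat_map_image F. peval G y = 0) \<longrightarrow> G = 0)"

text \<open>The function field of \<open>\<P>\<^sup>n\<close>: quotients of forms of equal degree.\<close>

definition proj_function_field :: "'n::{finite,linorder} cpoly fract set"
  where "proj_function_field =
    {Fract P Q | P Q d. homogeneous d P \<and> homogeneous d Q \<and> Q \<noteq> 0}"

text \<open>
  The image of the pullback \<open>P / Q \<mapsto> P(F) / Q(F)\<close> on the function field. If \<open>F\<close> is dominant, then
  \<open>Q(F) \<noteq> 0\<close> for every form \<open>Q \<noteq> 0\<close>, so that the pullback is defined everywhere.
\<close>

definition pullback_field :: "('n::{finite,linorder} \<Rightarrow> 'n cpoly) \<Rightarrow> 'n cpoly fract set"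
  where "pullback_field F =
    {Fract (psubst P F) (psubst Q F) | P Q d.
       homogeneous d P \<and> homogeneous d Q \<and> psubst Q F \<noteq> 0}"

text \<open>
  \<open>ring.dim R K E\<close> is the dimension of \<open>E\<close> as a vector space over the subfield \<open>K\<close> of \<open>R\<close>; here \<open>R\<close> is
  the field of all fractions of polynomials.
\<close>

definition rat_map_degree :: "('n::{finite,linorder} \<Rightarrow> 'n cpoly) \<Rightarrow> nat"
  where "rat_map_degree F =
    (if dominant F
     then ring.dim (ring_of_type_algebra :: 'n cpoly fract ring)
            (pullback_field F) proj_function_field
     else 0)"

definition toric_polar_map :: "'n cpoly \<Rightarrow> 'n \<Rightarrow> 'n cpoly"
  where "toric_polar_map f = (\<lambda>i. pvar i * partial_deriv i f)"

end

theory Submission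
  imports Defs "HOL-Computational_Algebra.Computational_Algebra"
begin

unbundle fps_syntax

text \<open>
  For \<open>f = \<Prod> f\<^sub>j\<^bsup>n\<^sub>j\<^esup>\<close>, Euler's formula identifies a general fibre of the toric polar map with the set of
  points of the projective torus minus the zero set of \<open>f\<close> where
  \<open>\<Sum>\<^sub>j a\<^sub>j x\<^sub>i (\<partial>f\<^sub>j/\<partial>x\<^sub>i) / f\<^sub>j = u\<^sub>i\<close> for all \<open>i\<close>, with \<open>a = n\<close> and \<open>u\<close> general such that
  \<open>\<Sum> u\<^sub>i = \<Sum> a\<^sub>j deg f\<^sub>j\<close>. So the degree has to be shown independent of the positive weights \<open>a\<close>. Two weight
  vectors of the same total degree are joined by a line with parameter \<open>s\<close>. The degree does not
  decrease from the member \<open>s = 0\<close> to the generic one, because linear relations can be divided by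
  powers of \<open>s\<close>. A point of the generic fibre is a Puiseux series \<open>x\<close> in \<open>1 - s\<close>. The logarithmic
  derivative of \<open>\<Prod> f\<^sub>j(x)\<^bsup>a\<^sub>j\<^esup> / \<Prod> x\<^sub>i\<^bsup>u\<^sub>i\<^esup>\<close> along \<open>x\<close> has no residue, that is,
  \<open>\<Sum> u\<^sub>i ord x\<^sub>i = \<Sum> a\<^sub>j ord f\<^sub>j(x)\<close>. As \<open>u\<close> is general, all \<open>ord x\<^sub>i\<close> vanish after normalization; then
  \<open>ord f\<^sub>j(x) \<ge> 0\<close>, and the positivity of \<open>a\<close> forces these orders to vanish too. So \<open>x\<close> has a limit in the
  fibre of the member \<open>s = 1\<close>, and distinct series have distinct limits since that fibre is reduced.
  Hence the degree at \<open>s = 0\<close> is at most that at \<open>s = 1\<close>, and exchanging the ends gives equality.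
\<close>

section \<open>Puiseux series\<close>

text \<open>Degrees are compared, not computed: \<open>rat_map_degree\<close> is governed by the
  sizes m of families of m forms of equal degree that are independent over the pullback field
  (\<open>indep_forms\<close>). A family independent at s = 0 stays independent for generic s, so m
  is at most the number of embeddings of the coordinates of the generic member into Puiseux series;
  these give as many points of the fibre at s = 1, and m points of a fibre give back an independent
  family by a Vandermonde argument. The word general is taken literally: u is \<kappa> times the
  vector of the x_i divided by their sum, in an algebraic closure of the fraction field of the
  polynomials, so that no nonzero complex form vanishes at it and no exceptional sets have to be
  tracked. This closure is also the coefficient field of the series, as Puiseux's theorem asks for
  an algebraically closed one. The weights are complex numbers because the weights 1 of the reduced
  polynomial have to be scaled by k / deg f_red to reach the total k of the multiplicities; scaling
  does not change the rational map.\<close>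

definition hom_on :: "'a::ring_1 set \<Rightarrow> ('a \<Rightarrow> 'b::ring_1) \<Rightarrow> bool" where
  "hom_on K h \<longleftrightarrow> h 1 = 1 \<and> (\<forall>x\<in>K. \<forall>y\<in>K. h (x + y) = h x + h y \<and> h (x * y) = h x * h y)"

abbreviation rhom :: "('a::ring_1 \<Rightarrow> 'b::ring_1) \<Rightarrow> bool" where
  "rhom \<equiv> hom_on UNIV"

text \<open>Tschirnhaus shift: replacing X by X + c keeps the top coefficient and adds a multiple of
  c times it to the one below, so in characteristic 0 a suitable c removes the latter. Degree bounds
  instead of exact degrees let both claims be proved in one induction.\<close>

lemma coeff_pcompose_shift:
  fixes p :: "'a::comm_ring_1 poly"
  shows "degree p \<le> n \<Longrightarrow> coeff (p \<circ>\<^sub>p [:c, 1:]) n = coeff p n"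
    and "degree p \<le> Suc n \<Longrightarrow>
      coeff (p \<circ>\<^sub>p [:c, 1:]) n = coeff p n + of_nat (Suc n) * c * coeff p (Suc n)"
proof (induction p arbitrary: n)
  case 0
  { case 1 show ?case by simp }
  { case 2 show ?case by simp }
next
  case (pCons a p)
  {
    case 1
    have "degree p \<le> n" using 1 by (cases "p = 0") auto
    moreover have "degree p \<le> n - 1 \<or> p = 0 \<or> n = 0" using 1 by (cases "p = 0") auto
    moreover have "n = 0 \<Longrightarrow> p = 0" using 1 by (auto split: if_splits)
    ultimately show ?case
      using pCons.IH(1)[of n] pCons.IH(1)[of "n - 1"] 1
      by (cases n) (auto simp: pcompose_pCons coeff_pCons coeff_eq_0 split: if_splits)
  }
  {
    case 2
    have 3: "degree p \<le> n" using 2 by (cases "p = 0") auto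
    show ?case
    proof (cases n)
      case 0
      then have "degree p = 0" using 3 by simp
      then obtain b where "p = [:b:]" by (elim degree_eq_zeroE)
      then show ?thesis using 0 by (simp add: pcompose_pCons)
    next
      case (Suc m)
      then show ?thesis
        using pCons.IH(1)[of n] pCons.IH(2)[of m] 3
        by (simp add: pcompose_pCons coeff_pCons algebra_simps)
    qed
  }
qed

section \<open>Hensel lifting over formal power series\<close>

text \<open>In the solution (r c, s c) the cofactor of b is reduced modulo a. Its degree is then
  small, and the degree of the other cofactor is read off from a y = c - b x.\<close>

lemma bezout_degree:
  fixes a b :: "'a::field poly"
  assumes bez: "r * a + s * b = 1" and deg: "0 < degree a" "0 < degree b"
    and c: "degree c < degree a + degree b"
  shows "\<exists>x y. a * y + b * x = c \<and> degree x < degree a \<and> degree y < degree b"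
proof -
  define x where "x = (s * c) mod a"
  have "a dvd c - b * x"
  proof -
    have "c - b * x = a * (r * c) + b * (s * c - x)"
      using arg_cong[OF bez, of "\<lambda>z. z * c"] by (simp add: algebra_simps)
    moreover have "a dvd s * c - x"
      unfolding x_def by (simp add: minus_mod_eq_mult_div)
    ultimately show ?thesis by simp
  qed
  then obtain y where y: "c - b * x = a * y" by blast
  have dx: "degree x < degree a"
    using deg degree_mod_less'[of a "s * c"] unfolding x_def
    by (cases "a = 0"; cases "s * c mod a = 0") auto
  have "degree (a * y) < degree a + degree b"
    unfolding y[symmetric]
  proof (rule degree_diff_less[OF c])
    show "degree (b * x) < degree a + degree b"
      using dx degree_mult_le[of b x] by linarith
  qed
  then have "degree y < degree b"
    using deg by (cases "a = 0"; cases "y = 0") (auto simp: degree_mult_eq)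
  with dx y show ?thesis by (intro exI[of _ x] exI[of _ y]) (simp add: algebra_simps)
qed

text \<open>The index of the power series is the lifting variable; its coefficients are polynomials
  in X. Comparing coefficients at index n leaves an equation a B_n + b A_n = (known terms) for the
  new pair, which \<open>bezout_degree\<close> solves. All corrections have smaller degree than a
  and b, so the factors have bounded degree in X and can be read as polynomials over power
  series.\<close>

lemma hensel_lift:
  fixes a b :: "'a::field poly" and q :: "'a poly fps"
  assumes bez: "r * a + s * b = 1" and deg: "0 < degree a" "0 < degree b"
    and q0: "q $ 0 = a * b"
    and qn: "\<And>n. 0 < n \<Longrightarrow> degree (q $ n) < degree a + degree b"
  shows "\<exists>A B. A * B = q \<and> A $ 0 = a \<and> B $ 0 = b \<and>
    (\<forall>n>0. degree (A $ n) < degree a \<and> degree (B $ n) < degree b)"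
proof -
  \<comment> \<open>\<open>P h n z\<close> says that z is an admissible n-th pair of coefficients
    after the earlier pairs in h. It consults h only below n, which is what well-founded choice
    needs.\<close>
  define P where "P = (\<lambda>(h :: nat \<Rightarrow> 'a poly \<times> 'a poly) n (z :: 'a poly \<times> 'a poly).
    if n = 0 then z = (a, b) else
      a * snd z + b * fst z = q $ n - (\<Sum>i\<in>{1..<n}. fst (h i) * snd (h (n - i))) \<and>
      degree (fst z) < degree a \<and> degree (snd z) < degree b)"
  have "\<exists>h. \<forall>n. P h n (h n)"
  proof (rule dependent_wf_choice[OF wf_less_than])
    fix f g :: "nat \<Rightarrow> 'a poly \<times> 'a poly" and n z
    assume "\<And>m. (m, n) \<in> less_than \<Longrightarrow> f m = g m"
    then have "(\<Sum>i\<in>{1..<n}. fst (f i) * snd (f (n - i))) = (\<Sum>i\<in>{1..<n}. fst (g i) * snd (g (n - i)))"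
      by (intro sum.cong) auto
    then show "P f n z = P g n z" unfolding P_def by simp
  next
    fix n :: nat and f :: "nat \<Rightarrow> 'a poly \<times> 'a poly"
    assume IH: "\<And>m. (m, n) \<in> less_than \<Longrightarrow> P f m (f m)"
    show "\<exists>z. P f n z"
    proof (cases "n = 0")
      case True
      then show ?thesis unfolding P_def by auto
    next
      case False
      have "degree (\<Sum>i\<in>{1..<n}. fst (f i) * snd (f (n - i))) < degree a + degree b"
      proof (rule degree_sum_less)
        fix i assume i: "i \<in> {1..<n}"
        then have "degree (fst (f i)) < degree a" "degree (snd (f (n - i))) < degree b"
          using IH[of i] IH[of "n - i"] unfolding P_def by auto
        then show "degree (fst (f i) * snd (f (n - i))) < degree a + degree b"
          using degree_mult_le[of "fst (f i)" "snd (f (n - i))"] by linarith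
      qed (use deg in simp)
      then have "degree (q $ n - (\<Sum>i\<in>{1..<n}. fst (f i) * snd (f (n - i)))) < degree a + degree b"
        using qn[of n] False by (intro degree_diff_less) auto
      from bezout_degree[OF bez deg this] show ?thesis
        using False unfolding P_def by auto
    qed
  qed
  then obtain h where h: "\<And>n. P h n (h n)" by blast
  define A where "A = Abs_fps (\<lambda>n. fst (h n))"
  define B where "B = Abs_fps (\<lambda>n. snd (h n))"
  have h0: "h 0 = (a, b)" using h[of 0] by (simp add: P_def)
  have "A * B = q"
  proof (rule fps_ext)
    fix n show "(A * B) $ n = q $ n"
    proof (cases "n = 0")
      case True
      then show ?thesis by (simp add: A_def B_def h0 q0)
    next
      case False
      then have *: "{0..n} = insert 0 (insert n {1..<n})" by auto
      have "(A * B) $ n = (\<Sum>i=0..n. fst (h i) * snd (h (n - i)))"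
        by (simp add: fps_mult_nth A_def B_def)
      also have "\<dots> = a * snd (h n) + (fst (h n) * b + (\<Sum>i\<in>{1..<n}. fst (h i) * snd (h (n - i))))"
        using False unfolding * by (subst sum.insert, simp, simp, subst sum.insert) (auto simp: h0)
      also have "\<dots> = q $ n"
        using h[of n] False unfolding P_def by (simp add: algebra_simps)
      finally show ?thesis .
    qed
  qed
  moreover have "\<forall>n>0. degree (A $ n) < degree a \<and> degree (B $ n) < degree b"
  proof (intro allI impI)
    fix n :: nat assume "n > 0"
    with h[of n] show "degree (A $ n) < degree a \<and> degree (B $ n) < degree b"
      by (simp add: A_def B_def P_def)
  qed
  ultimately show ?thesis
    by (intro exI[of _ A] exI[of _ B]) (simp add: A_def B_def h0)
qed

text \<open>Up to the unit b(c), b is 1 - w with w divisible by X - c. The geometric sum inverts 1 -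
  w modulo w^e, hence modulo (X - c)^e.\<close>

lemma bezout_linear_power:
  fixes b :: "'a::field poly"
  assumes "poly b c \<noteq> 0"
  shows "\<exists>r s. r * [:-c, 1:] ^ e + s * b = 1"
proof -
  define \<beta> where "\<beta> = poly b c"
  have "[:-c, 1:] dvd b - [:\<beta>:]"
    by (simp add: poly_eq_0_iff_dvd[symmetric] \<beta>_def)
  then obtain z where z: "b - [:\<beta>:] = [:-c, 1:] * z" by blast
  define w where "w = smult (- inverse \<beta>) ([:-c, 1:] * z)"
  have b: "smult (inverse \<beta>) b = 1 - w"
  proof -
    have "b = [:\<beta>:] + [:-c, 1:] * z"
      using z by (metis add_diff_cancel_left' diff_add_cancel add.commute)
    then have "smult (inverse \<beta>) b = smult (inverse \<beta>) ([:\<beta>:] + [:-c, 1:] * z)" by (rule arg_cong)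
    also have "\<dots> = 1 - w"
      using assms by (simp add: \<beta>_def w_def smult_add_right one_pCons)
    finally show ?thesis .
  qed
  have "1 - w ^ e = (1 - w) * (\<Sum>i<e. w ^ i)"
    by (rule one_diff_power_eq)
  also have "\<dots> = smult (inverse \<beta>) (\<Sum>i<e. w ^ i) * b"
    by (simp add: b[symmetric] mult.commute)
  finally have "w ^ e + smult (inverse \<beta>) (\<Sum>i<e. w ^ i) * b = 1"
    by (simp add: algebra_simps)
  moreover have "w = smult (- inverse \<beta>) z * [:-c, 1:]"
    unfolding w_def by (simp only: mult_smult_left mult.commute)
  then have "w ^ e = smult (- inverse \<beta>) z ^ e * [:-c, 1:] ^ e"
    by (simp only: power_mult_distrib)
  ultimately show ?thesis by metis
qed

text \<open>Modulo the series variable, p is monic with vanishing second coefficient and, because of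
  i0, different from X^d. A power (X - c)^d of one linear factor has second coefficient -d c, so it
  could only be X^d. Hence the reduction has coprime factors (X - c)^e and b of positive degree, and
  these lift.\<close>

lemma fls_poly_reducible:
  fixes p :: "'a::{alg_closed_field,field_char_0} fls poly"
  assumes deg: "degree p = d" "d > 1" and lc: "coeff p d = 1"
    and c1: "coeff p (d - 1) = 0"
    and int: "\<And>i. fls_subdegree (coeff p i) \<ge> 0"
    and i0: "i0 < d" "coeff p i0 $$ 0 \<noteq> 0"
  shows "\<exists>u v. p = u * v \<and> degree u > 0 \<and> degree v > 0"
proof -
  \<comment> \<open>Transposition: \<open>Q n\<close> collects the coefficients at the n-th power of
    the series variable, turning a polynomial over series into a series of polynomials.
    \<open>F\<close> below goes back.\<close>
  define Q where "Q = (\<lambda>n :: nat. map_poly (\<lambda>c. c $$ int n) p)"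
  have coeff_Q: "coeff (Q n) i = coeff p i $$ int n" for n i
    by (simp add: Q_def coeff_map_poly)
  have deg_Q0: "degree (Q 0) = d"
    by (rule antisym) (auto intro!: degree_le le_degree simp: coeff_Q lc coeff_eq_0 deg)
  have lc_Q0: "coeff (Q 0) d = 1" by (simp add: coeff_Q lc)
  have deg_Qn: "degree (Q n) < d" if "n > 0" for n
  proof -
    have "coeff (Q n) i = 0" if "i > d - 1" for i
      using that \<open>n > 0\<close> by (cases "i = d") (auto simp: coeff_Q lc coeff_eq_0 deg)
    then have "degree (Q n) \<le> d - 1" by (intro degree_le) auto
    with deg(2) show ?thesis by linarith
  qed
  obtain c where c: "poly (Q 0) c = 0"
    using alg_closed_imp_poly_has_root[of "Q 0"] deg_Q0 deg by auto
  define e where "e = Polynomial.order c (Q 0)"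
  have Q0: "Q 0 \<noteq> 0" using deg_Q0 deg by auto
  have "[:-c, 1:] ^ e dvd Q 0" unfolding e_def by (rule order_1)
  then obtain b where b: "Q 0 = [:-c, 1:] ^ e * b" by blast
  have e: "e > 0" using c Q0 by (simp add: e_def order_gt_0_iff)
  have bc: "poly b c \<noteq> 0"
  proof
    assume "poly b c = 0"
    then have "[:-c, 1:] dvd b" by (simp only: poly_eq_0_iff_dvd)
    then have "[:-c, 1:] ^ e * [:-c, 1:] dvd [:-c, 1:] ^ e * b" by (rule mult_dvd_mono[OF dvd_refl])
    then have "[:-c, 1:] ^ Suc e dvd Q 0"
      unfolding b power_Suc by (simp only: mult.commute)
    then show False using order_2[OF Q0, of c] by (simp add: e_def)
  qed
  have b0: "b \<noteq> 0" using Q0 b by auto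
  have degs: "degree ([:-c, 1:] ^ e) = e" by (simp add: degree_power_eq)
  have deg_sum: "e + degree b = d"
    using deg_Q0 b b0 degs by (metis degree_mult_eq pCons_eq_0_iff power_eq_0_iff zero_neq_one)
  have degb: "degree b > 0"
  proof (rule ccontr)
    assume "\<not> degree b > 0"
    then have e': "e = d" and "degree b = 0" using deg_sum by auto
    then obtain \<beta> where \<beta>: "b = [:\<beta>:]" by (elim degree_eq_zeroE)
    have lcp: "lead_coeff ([:-c, 1:] ^ e) = 1" by (simp add: lead_coeff_power)
    have "lead_coeff (Q 0) = 1" using lc_Q0 deg_Q0 by simp
    then have "\<beta> = 1" using lcp unfolding b \<beta> lead_coeff_mult by simp
    then have Qe: "Q 0 = [:-c, 1:] ^ d" using b \<beta> e' by simp
    have "coeff (Q 0) (d - 1) = - of_nat d * c"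
    proof -
      have "[:-c, 1:] ^ d = monom 1 d \<circ>\<^sub>p [:-c, 1:]"
        by (induction d) (simp_all add: monom_0 monom_Suc pcompose_pCons one_pCons)
      then show ?thesis
        using coeff_pcompose_shift(2)[of "monom (1::'a) d" "d - 1" "-c"] deg Qe
        by (simp add: degree_monom_eq)
    qed
    then have "c = 0" using c1 deg by (simp add: coeff_Q)
    then have "coeff (Q 0) i0 = 0"
      unfolding Qe using i0 by (simp add: monom_altdef[of 1, simplified, symmetric])
    then show False using i0 by (simp add: coeff_Q)
  qed
  obtain r s where bez: "r * [:-c, 1:] ^ e + s * b = 1"
    using bezout_linear_power[OF bc] by blast
  obtain A B where AB: "A * B = Abs_fps Q" "A $ 0 = [:-c, 1:] ^ e" "B $ 0 = b"
    and AB': "\<And>n. n > 0 \<Longrightarrow> degree (A $ n) < e \<and> degree (B $ n) < degree b"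
    using hensel_lift[OF bez, of "Abs_fps Q"] e degb degs deg_Qn deg_sum b by auto
  define F where "F = (\<lambda>C :: 'a poly fps. \<lambda>i. fps_to_fls (Abs_fps (\<lambda>n. coeff (C $ n) i)))"
  have dA: "degree (A $ n) \<le> e" and dB: "degree (B $ n) \<le> degree b" for n
    using AB' AB(2,3) degs by (metis less_or_eq_imp_le gr0I)+
  have F0: "F C i = 0" if "\<And>n. degree (C $ n) \<le> m" "i > m" for C i m
  proof -
    have "coeff (C $ n) i = 0" for n
      using that le_less_trans[of "degree (C $ n)" m i] by (auto intro!: coeff_eq_0)
    then show ?thesis by (simp add: F_def fps_zero_def[symmetric])
  qed
  define u where "u = Abs_poly (F A)"
  define v where "v = Abs_poly (F B)"
  have cu: "coeff u i = F A i" for i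
    unfolding u_def by (rule coeff_Abs_poly[of e, THEN fun_cong]) (use F0[OF dA] in auto)
  have cv: "coeff v i = F B i" for i
    unfolding v_def by (rule coeff_Abs_poly[of "degree b", THEN fun_cong]) (use F0[OF dB] in auto)
  have "p = u * v"
  proof (rule poly_eqI)
    fix i
    have fps: "(\<Sum>j\<le>i. Abs_fps (\<lambda>n. coeff (A $ n) j) * Abs_fps (\<lambda>n. coeff (B $ n) (i - j))) =
      Abs_fps (\<lambda>n. coeff (Q n) i)"
    proof (rule fps_ext)
      fix n
      have "coeff (Q n) i = coeff ((A * B) $ n) i" by (simp add: AB)
      also have "\<dots> = (\<Sum>m=0..n. \<Sum>j\<le>i. coeff (A $ m) j * coeff (B $ (n - m)) (i - j))"
        by (simp add: fps_mult_nth coeff_sum coeff_mult)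
      also have "\<dots> = (\<Sum>j\<le>i. Abs_fps (\<lambda>n. coeff (A $ n) j) * Abs_fps (\<lambda>n. coeff (B $ n) (i - j))) $ n"
        by (subst sum.swap) (simp add: fps_sum_nth fps_mult_nth)
      finally show "(\<Sum>j\<le>i. Abs_fps (\<lambda>n. coeff (A $ n) j) * Abs_fps (\<lambda>n. coeff (B $ n) (i - j))) $ n =
        Abs_fps (\<lambda>n. coeff (Q n) i) $ n" by simp
    qed
    have "coeff (u * v) i = fps_to_fls (\<Sum>j\<le>i. Abs_fps (\<lambda>n. coeff (A $ n) j) * Abs_fps (\<lambda>n. coeff (B $ n) (i - j)))"
    proof -
      have fs: "fps_to_fls (sum g S) = (\<Sum>x\<in>S. fps_to_fls (g x))" if "finite S" for g :: "nat \<Rightarrow> 'a fps" and S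
        using that by (induction S rule: finite_induct) auto
      show ?thesis by (simp add: coeff_mult cu cv F_def fs fls_times_fps_to_fls)
    qed
    also have "\<dots> = coeff p i"
      unfolding fps using int[of i] by (intro fls_eqI) (auto simp: coeff_Q)
    finally show "coeff p i = coeff (u * v) i" by simp
  qed
  moreover have "degree u \<ge> e"
  proof (rule le_degree)
    have "coeff u e $$ 0 = lead_coeff ([:-c, 1:] ^ e)"
      using degs by (simp add: cu F_def AB)
    then show "coeff u e \<noteq> 0" by (auto simp: lead_coeff_power)
  qed
  moreover have "degree v \<ge> degree b"
  proof (rule le_degree)
    have "coeff v (degree b) $$ 0 = lead_coeff b" by (simp add: cv F_def AB)
    then show "coeff v (degree b) \<noteq> 0" using b0 by auto
  qed
  ultimately show ?thesis using e degb by force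
qed

section \<open>Substituting a power of the series variable; Puiseux's theorem\<close>

text \<open>Adjoining a k-th root of the series variable is expressed by substituting the k-th power
  for it. Puiseux series thus never become a type of their own; an embedding into them is refined by
  composing it with this homomorphism.\<close>

lemma rhom_compose_power: "k > 0 \<Longrightarrow> rhom (\<lambda>x :: 'a::idom fls. fls_compose_power x k)"
  by (simp add: hom_on_def)

lemma fls_compose_power_eq_0_iff: "k > 0 \<Longrightarrow> fls_compose_power f k = 0 \<longleftrightarrow> f = 0"
proof
  assume k: "k > 0" and "fls_compose_power f k = 0"
  then have "fls_compose_power f k $$ (int k * n) = 0" for n by simp
  with k have "f $$ n = 0" for n by (simp add: fls_nth_compose_power)
  then show "f = 0" by (intro fls_eqI) simp
qed simp

lemma fls_subdegree_compose_power: "k > 0 \<Longrightarrow> fls_subdegree (fls_compose_power f k) = int k * fls_subdegree f"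
proof (cases "f = 0")
  case False
  assume k: "k > 0"
  show ?thesis
  proof (rule fls_subdegree_eqI)
    show "fls_compose_power f k $$ (int k * fls_subdegree f) \<noteq> 0"
      using k False by (simp add: fls_nth_compose_power)
    fix n assume n: "n < int k * fls_subdegree f"
    show "fls_compose_power f k $$ n = 0"
    proof (cases "int k dvd n")
      case True
      then obtain m where m: "n = int k * m" by blast
      with n k have "m < fls_subdegree f" by simp
      with m k show ?thesis by (simp add: fls_nth_compose_power)
    qed (use k in \<open>simp add: fls_nth_compose_power\<close>)
  qed
qed simp

lemma fls_compose_power_compose_power:
  "k > 0 \<Longrightarrow> l > 0 \<Longrightarrow> fls_compose_power (fls_compose_power f k) l = fls_compose_power f (k * l)"
  by (intro fls_eqI)
    (auto simp: fls_nth_compose_power dvd_mult_div_cancel elim!: dvdE intro: dvd_trans)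

lemma map_poly_hom_mult:
  fixes p q :: "'a::comm_ring_1 poly"
  assumes "rhom h" shows "map_poly h (p * q) = map_poly h p * (map_poly h q :: 'b::comm_ring_1 poly)"
proof -
  have h: "h (a + b) = h a + h b" "h (a * b) = h a * h b" for a b using assms by (auto simp: hom_on_def)
  have h0: "h 0 = 0" using h(1)[of 0 0] by simp
  have hs: "h (sum g S) = (\<Sum>x\<in>S. h (g x))" for g :: "nat \<Rightarrow> 'a" and S
    by (induction S rule: infinite_finite_induct) (auto simp: h0 h)
  show ?thesis by (intro poly_eqI) (simp add: coeff_map_poly h0 coeff_mult hs h)
qed

text \<open>Newton polygon method by induction on the degree: once the second coefficient is
  removed, rescaling X along the minimal slope makes all coefficients integral and one lower
  coefficient a unit. Then \<open>fls_poly_reducible\<close> yields a factor of smaller degree,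
  whose root is carried back.\<close>

lemma puiseux_root:
  fixes p :: "'a::{alg_closed_field,field_char_0} fls poly"
  assumes "degree p > 0"
  shows "\<exists>k x. k > 0 \<and> poly (map_poly (\<lambda>c. fls_compose_power c k) p) x = 0"
  using assms
proof (induction "degree p" arbitrary: p rule: less_induct)
  case less
  define d where "d = degree p"
  show ?case
  proof (cases "d = 1")
    case True
    then have "p = [:coeff p 0, coeff p 1:]"
      unfolding d_def by (intro poly_eqI) (auto simp: coeff_pCons coeff_eq_0 split: nat.split)
    moreover have "coeff p 1 \<noteq> 0" using True unfolding d_def by (metis leading_coeff_0_iff degree_0 zero_neq_one)
    ultimately have "poly p (- coeff p 0 / coeff p 1) = 0"
      by (metis (no_types, lifting) add.right_inverse mult.commute mult_zero_right nonzero_eq_divide_eq poly_0 poly_pCons add.commute add.right_neutral)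
    moreover have "map_poly (\<lambda>c. fls_compose_power c 1) p = p"
      by (intro map_poly_idI fls_eqI) (simp add: fls_nth_compose_power)
    ultimately show ?thesis
      by (intro exI[of _ 1] exI[of _ "- coeff p 0 / coeff p 1"]) simp
  next
    case False
    with less.prems have d: "d > 1" by (simp add: d_def)
    \<comment> \<open>This shift moves the mean of the roots to 0.\<close>
    define c where "c = - (coeff p (d - 1) / (of_nat d * coeff p d))"
    define q where "q = smult (inverse (coeff p d)) (p \<circ>\<^sub>p [:c, 1:])"
    have lp: "coeff p d \<noteq> 0" using d by (auto simp: d_def)
    have dq: "degree q = d" using lp by (simp add: q_def degree_pcompose d_def)
    have qd: "coeff q d = 1"
      using coeff_pcompose_shift(1)[of p d c] lp by (simp add: q_def d_def)
    have qd1: "coeff q (d - 1) = 0"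
      using coeff_pcompose_shift(2)[of p "d - 1" c] lp d
      by (simp add: q_def d_def[symmetric] c_def field_simps)
    have root_q: "\<exists>k x. k > 0 \<and> poly (map_poly (\<lambda>c. fls_compose_power c k) q) x = 0"
    proof (cases "\<forall>i<d. coeff q i = 0")
      case True
      then have "coeff q 0 = 0" using d by simp
      then have "poly (map_poly (\<lambda>c. fls_compose_power c 1) q) 0 = 0"
        by (simp add: poly_0_coeff_0 coeff_map_poly)
      then show ?thesis by (intro exI[of _ 1] exI[of _ 0]) simp
    next
      case False
      define I where "I = {i. i < d \<and> coeff q i \<noteq> 0}"
      have I: "finite I" "I \<noteq> {}" using False by (auto simp: I_def)
      define v where "v = (\<lambda>i. fls_subdegree (coeff q i))"
      define s where "s = (\<lambda>i. of_int (v i) / of_nat (d - i) :: rat)"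
      obtain i0 where i0: "i0 \<in> I" and min: "\<And>i. i \<in> I \<Longrightarrow> s i0 \<le> s i"
        using I by (metis arg_min_if_finite(1) arg_min_least)
      have i0d: "i0 < d" "coeff q i0 \<noteq> 0" using i0 by (auto simp: I_def)
      \<comment> \<open>The minimal slope is r / N. Replacing the series variable by its N-th power
        makes it integral; X is then scaled by the r-th power, and coefficient i, if nonzero, gets
        order N v(i) - (d - i) r. This is nonnegative by minimality and zero for i0.\<close>
      define N where "N = d - i0"
      define r where "r = v i0"
      have N: "N > 0" using i0d by (simp add: N_def)
      have slope: "r * int (d - i) \<le> int N * v i" if "i \<in> I" for i
      proof -
        have "i < d" using that by (simp add: I_def)
        then have "of_int r * of_nat (d - i) \<le> (of_nat N * of_int (v i) :: rat)"
          using min[OF that] N unfolding s_def r_def N_def by (simp add: field_simps)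
        then have "of_int (r * int (d - i)) \<le> (of_int (int N * v i) :: rat)" by simp
        then show ?thesis by (simp only: of_int_le_iff)
      qed
      define \<tau> where "\<tau> = (fls_X_intpow r :: 'a fls)"
      have tau0: "\<tau> \<noteq> 0" and sub_tau: "fls_subdegree \<tau> = r" by (simp_all add: \<tau>_def)
      define q' where "q' = map_poly (\<lambda>c. fls_compose_power c N) q"
      define q2 where "q2 = smult (inverse (\<tau> ^ d)) (q' \<circ>\<^sub>p monom \<tau> 1)"
      have cq2: "coeff q2 i = inverse (\<tau> ^ d) * (fls_compose_power (coeff q i) N * \<tau> ^ i)" for i
        by (simp add: q2_def q'_def coeff_map_poly)
      have sub2: "fls_subdegree (coeff q2 i) = int N * v i + int i * r - int d * r" if "coeff q i \<noteq> 0" for i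
        using that N tau0 unfolding cq2 v_def
        by (simp add: fls_subdegree_compose_power fls_compose_power_eq_0_iff sub_tau fls_subdegree_pow)
      have z2: "coeff q2 i = 0 \<longleftrightarrow> coeff q i = 0" for i
        using tau0 N by (simp add: cq2 fls_compose_power_eq_0_iff)
      have dq2: "degree q2 = d"
        using z2 by (intro antisym degree_le le_degree) (auto simp: coeff_eq_0 dq qd)
      have q2d: "coeff q2 d = 1" using tau0 N by (simp add: cq2 qd)
      have "\<exists>u w. q2 = u * w \<and> degree u > 0 \<and> degree w > 0"
      proof (rule fls_poly_reducible[OF dq2 d q2d])
        show "coeff q2 (d - 1) = 0" using qd1 z2 by blast
        show "fls_subdegree (coeff q2 i) \<ge> 0" for i
        proof (cases "coeff q2 i = 0")
          case False
          then have nz: "coeff q i \<noteq> 0" using z2 by blast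
          show ?thesis
          proof (cases "i < d")
            case True
            then have "r * int (d - i) \<le> int N * v i" using slope[of i] nz by (simp add: I_def)
            then show ?thesis using sub2[OF nz] True by (simp add: of_nat_diff algebra_simps)
          next
            case False
            then have "i = d" using nz dq by (metis coeff_eq_0 linorder_neqE_nat)
            then show ?thesis using q2d by simp
          qed
        qed simp
        show "i0 < d" by fact
        have "fls_subdegree (coeff q2 i0) = 0"
          using sub2[OF i0d(2)] i0d by (simp add: r_def[symmetric] N_def of_nat_diff algebra_simps)
        then show "coeff q2 i0 $$ 0 \<noteq> 0"
          using z2[of i0] i0d nth_fls_subdegree_nonzero[of "coeff q2 i0"] by auto
      qed
      then obtain u w where uw: "q2 = u * w" "degree u > 0" "degree w > 0" by blast
      have "q2 \<noteq> 0" using dq2 d by auto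
      then have "degree u < degree p" using uw dq2 by (auto simp: degree_mult_eq d_def)
      from less.hyps[OF this uw(2)] obtain k x where k: "k > 0"
        and x: "poly (map_poly (\<lambda>c. fls_compose_power c k) u) x = 0" by blast
      let ?h = "\<lambda>c :: 'a fls. fls_compose_power c k"
      have "poly (map_poly ?h q2) x = 0"
        unfolding uw(1) map_poly_hom_mult[OF rhom_compose_power[OF k]] by (simp add: x)
      moreover have "map_poly ?h q2 = smult (?h (inverse (\<tau> ^ d))) (map_poly ?h q' \<circ>\<^sub>p monom (?h \<tau>) 1)"
        using k by (intro poly_eqI) (simp add: coeff_map_poly q2_def)
      moreover have "?h (inverse (\<tau> ^ d)) \<noteq> 0" using tau0 k by (simp add: fls_compose_power_eq_0_iff)
      ultimately have "poly (map_poly ?h q') (?h \<tau> * x) = 0"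
        by (simp add: poly_pcompose poly_monom)
      moreover have "map_poly ?h q' = map_poly (\<lambda>c. fls_compose_power c (N * k)) q"
        using k N by (intro poly_eqI) (simp add: q'_def coeff_map_poly fls_compose_power_compose_power)
      ultimately show ?thesis using N k by (intro exI[of _ "N * k"] exI[of _ "?h \<tau> * x"]) simp
    qed
    then obtain k x where k: "k > 0" and x: "poly (map_poly (\<lambda>c. fls_compose_power c k) q) x = 0" by blast
    let ?h = "\<lambda>c :: 'a fls. fls_compose_power c k"
    have "map_poly ?h q = smult (?h (inverse (coeff p d))) (map_poly ?h (p \<circ>\<^sub>p [:c, 1:]))"
      by (intro poly_eqI) (simp add: coeff_map_poly q_def)
    moreover have "?h (inverse (coeff p d)) \<noteq> 0" using lp k by (simp add: fls_compose_power_eq_0_iff)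
    ultimately have "poly (map_poly ?h (p \<circ>\<^sub>p [:c, 1:])) x = 0" using x by simp
    moreover have "map_poly ?h (p \<circ>\<^sub>p [:c, 1:]) = map_poly ?h p \<circ>\<^sub>p [:?h c, 1:]"
    proof -
      have "map_poly ?h (p \<circ>\<^sub>p [:c, 1:]) = map_poly ?h p \<circ>\<^sub>p [:?h c, 1:]" for p
      proof (induction p)
        case (pCons a p)
        have "map_poly ?h ([:a:] + r) = [:?h a:] + map_poly ?h r" for a r
          by (intro poly_eqI) (simp add: coeff_map_poly coeff_pCons split: nat.split)
        moreover have "map_poly ?h [:c, 1:] = [:?h c, 1:]" using k by (simp add: map_poly_pCons)
        ultimately show ?case
          using pCons map_poly_hom_mult[OF rhom_compose_power[OF k], of "[:c, 1:]" "p \<circ>\<^sub>p [:c, 1:]"]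
          by (simp only: pcompose_pCons map_poly_pCons fls_compose_power_0_left)
      qed simp
      then show ?thesis .
    qed
    ultimately have "poly (map_poly ?h p) (?h c + x) = 0" by (simp add: poly_pcompose)
    then show ?thesis using k by blast
  qed
qed

lemma puiseux_splits:
  fixes p :: "'a::{alg_closed_field,field_char_0} fls poly"
  assumes "p \<noteq> 0"
  shows "\<exists>k A. k > 0 \<and> size A = degree p \<and>
    map_poly (\<lambda>c. fls_compose_power c k) p = smult (fls_compose_power (lead_coeff p) k) (\<Prod>x\<in>#A. [:-x, 1:])"
  using assms
proof (induction "degree p" arbitrary: p)
  case 0
  then obtain c where "p = [:c:]" by (metis degree_eq_zeroE)
  then show ?case by (intro exI[of _ 1] exI[of _ "{#}"]) (simp add: map_poly_pCons)
next
  case (Suc n)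
  let ?h = "\<lambda>k c :: 'a fls. fls_compose_power c k"
  from puiseux_root[of p] Suc obtain k x where k: "k > 0" and x: "poly (map_poly (?h k) p) x = 0" by auto
  then obtain q where q: "map_poly (?h k) p = [:-x, 1:] * q" by (auto simp: poly_eq_0_iff_dvd)
  have lp: "?h k (lead_coeff p) \<noteq> 0" using k Suc.prems by (simp add: fls_compose_power_eq_0_iff)
  have dp: "degree (map_poly (?h k) p) = Suc n"
    using map_poly_degree_eq[of "?h k" p] lp Suc.hyps(2) by simp
  have q0: "q \<noteq> 0" using dp q by auto
  then have dq: "degree q = n" using dp unfolding q by (simp add: degree_mult_eq del: mult_pCons_left)
  have lq: "lead_coeff q = ?h k (lead_coeff p)"
  proof -
    have "lead_coeff (map_poly (?h k) p) = lead_coeff q" unfolding q lead_coeff_mult by simp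
    then show ?thesis using lead_coeff_map_poly_nz[of "?h k" p] lp by simp
  qed
  from Suc.hyps(1)[OF dq[symmetric] q0] obtain l A where l: "l > 0" "size A = n"
    and A: "map_poly (?h l) q = smult (?h l (lead_coeff q)) (\<Prod>x\<in>#A. [:-x, 1:])" using dq by auto
  have "map_poly (?h (k * l)) p = map_poly (?h l) (map_poly (?h k) p)"
    using k l by (intro poly_eqI) (simp add: coeff_map_poly fls_compose_power_compose_power)
  also have "\<dots> = map_poly (?h l) [:-x, 1:] * map_poly (?h l) q"
    unfolding q by (rule map_poly_hom_mult[OF rhom_compose_power[OF l(1)]])
  also have "map_poly (?h l) [:-x, 1:] = [:- ?h l x, 1:]" using l by (simp add: map_poly_pCons)
  also have "[:- ?h l x, 1:] * map_poly (?h l) q =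
      smult (?h (k * l) (lead_coeff p)) (\<Prod>x\<in>#add_mset (?h l x) A. [:-x, 1:])"
    using k l by (simp add: A lq fls_compose_power_compose_power del: mult_pCons_left)
  finally show ?case using k l Suc.hyps(2) by (intro exI[of _ "k * l"] exI[of _ "add_mset (?h l x) A"]) simp
qed

section \<open>Subfields, simple extensions and embeddings\<close>

definition field_subset :: "'a::field set \<Rightarrow> bool" where
  "field_subset K \<longleftrightarrow> 0 \<in> K \<and> 1 \<in> K \<and>
    (\<forall>x\<in>K. \<forall>y\<in>K. x + y \<in> K \<and> x * y \<in> K) \<and> (\<forall>x\<in>K. - x \<in> K \<and> inverse x \<in> K)"

lemma field_subset_UNIV: "field_subset UNIV"
  by (simp add: field_subset_def)

lemma
  assumes "field_subset K"
  shows field_subset_0: "0 \<in> K" and field_subset_1: "1 \<in> K"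
    and field_subset_add: "x \<in> K \<Longrightarrow> y \<in> K \<Longrightarrow> x + y \<in> K"
    and field_subset_mult: "x \<in> K \<Longrightarrow> y \<in> K \<Longrightarrow> x * y \<in> K"
    and field_subset_uminus: "x \<in> K \<Longrightarrow> - x \<in> K"
    and field_subset_inverse: "x \<in> K \<Longrightarrow> inverse x \<in> K"
    and field_subset_diff: "x \<in> K \<Longrightarrow> y \<in> K \<Longrightarrow> x - y \<in> K"
    and field_subset_divide: "x \<in> K \<Longrightarrow> y \<in> K \<Longrightarrow> x / y \<in> K"
    and field_subset_sum: "(\<And>i. i \<in> S \<Longrightarrow> g i \<in> K) \<Longrightarrow> sum g S \<in> K"
    and field_subset_power: "x \<in> K \<Longrightarrow> x ^ n \<in> K"
proof -
  show 0: "0 \<in> K" and 1: "1 \<in> K"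
    and a: "x \<in> K \<Longrightarrow> y \<in> K \<Longrightarrow> x + y \<in> K" and m: "x \<in> K \<Longrightarrow> y \<in> K \<Longrightarrow> x * y \<in> K"
    and u: "x \<in> K \<Longrightarrow> - x \<in> K" and i: "x \<in> K \<Longrightarrow> inverse x \<in> K" for x y
    using assms by (auto simp: field_subset_def)
  show "x \<in> K \<Longrightarrow> y \<in> K \<Longrightarrow> x - y \<in> K" using a[of x "- y"] u[of y] by simp
  show "x \<in> K \<Longrightarrow> y \<in> K \<Longrightarrow> x / y \<in> K" using m[of x "inverse y"] i[of y] by (simp add: divide_inverse)
  show "(\<And>i. i \<in> S \<Longrightarrow> g i \<in> K) \<Longrightarrow> sum g S \<in> K"
    by (induction S rule: infinite_finite_induct) (auto intro: 0 a)
  show "x \<in> K \<Longrightarrow> x ^ n \<in> K" by (induction n) (auto intro: 1 m)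
qed

section \<open>Linear algebra over a subfield\<close>

text \<open>Gaussian elimination: the pivot in equation j0 removes the unknown i0 from the other
  equations, and the value of that unknown is computed last. All operations stay in the
  subfield.\<close>

lemma underdetermined_system:
  assumes K: "field_subset K" and fin: "finite J" "finite I" and card: "card J < card I"
    and A: "\<And>j i. j \<in> J \<Longrightarrow> i \<in> I \<Longrightarrow> A j i \<in> K"
  shows "\<exists>c. (\<forall>i\<in>I. c i \<in> K) \<and> (\<exists>i\<in>I. c i \<noteq> 0) \<and> (\<forall>j\<in>J. (\<Sum>i\<in>I. A j i * c i) = 0)"
  using fin card A
proof (induction J arbitrary: I A rule: finite_induct)
  case empty
  then show ?case
    by (intro exI[of _ "\<lambda>_. 1"]) (auto simp: field_subset_1[OF K] card_gt_0_iff)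
next
  case (insert j0 J)
  show ?case
  proof (cases "\<forall>i\<in>I. A j0 i = 0")
    case True
    have "\<exists>c. (\<forall>i\<in>I. c i \<in> K) \<and> (\<exists>i\<in>I. c i \<noteq> 0) \<and> (\<forall>j\<in>J. (\<Sum>i\<in>I. A j i * c i) = 0)"
      by (rule insert.IH) (use insert in auto)
    then show ?thesis using True by auto
  next
    case False
    then obtain i0 where i0: "i0 \<in> I" "A j0 i0 \<noteq> 0" by blast
    define I' where "I' = I - {i0}"
    define A' where "A' = (\<lambda>j i. A j i - A j i0 / A j0 i0 * A j0 i)"
    have "\<exists>c. (\<forall>i\<in>I'. c i \<in> K) \<and> (\<exists>i\<in>I'. c i \<noteq> 0) \<and> (\<forall>j\<in>J. (\<Sum>i\<in>I'. A' j i * c i) = 0)"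
    proof (rule insert.IH)
      show "finite I'" "card J < card I'"
        using insert i0 by (auto simp: I'_def)
      show "A' j i \<in> K" if "j \<in> J" "i \<in> I'" for j i
        unfolding A'_def using that i0 insert.prems(3) I'_def
        by (intro field_subset_diff[OF K] field_subset_mult[OF K] field_subset_divide[OF K]) auto
    qed
    then obtain c where c: "\<forall>i\<in>I'. c i \<in> K" "\<exists>i\<in>I'. c i \<noteq> 0"
      and eq: "\<And>j. j \<in> J \<Longrightarrow> (\<Sum>i\<in>I'. A' j i * c i) = 0" by blast
    define S where "S = (\<lambda>j. \<Sum>i\<in>I'. A j i * c i)"
    define c' where "c' = c(i0 := - S j0 / A j0 i0)"
    have "S j0 \<in> K" unfolding S_def
      using c insert.prems by (intro field_subset_sum[OF K] field_subset_mult[OF K]) (auto simp: I'_def)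
    then have "- S j0 / A j0 i0 \<in> K"
      using i0 insert.prems by (intro field_subset_divide[OF K] field_subset_uminus[OF K]) auto
    then have "\<forall>i\<in>I. c' i \<in> K" using c by (auto simp: c'_def I'_def)
    moreover have "\<exists>i\<in>I. c' i \<noteq> 0" using c by (auto simp: c'_def I'_def)
    moreover have sum: "(\<Sum>i\<in>I. A j i * c' i) = S j - A j i0 / A j0 i0 * S j0" for j
    proof -
      have "(\<Sum>i\<in>I. A j i * c' i) = A j i0 * c' i0 + (\<Sum>i\<in>I'. A j i * c' i)"
        unfolding I'_def by (rule sum.remove) (use i0 insert in auto)
      also have "(\<Sum>i\<in>I'. A j i * c' i) = S j"
        unfolding S_def by (intro sum.cong) (auto simp: c'_def I'_def)
      finally show ?thesis by (simp add: c'_def)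
    qed
    have "(\<Sum>i\<in>I. A j i * c' i) = 0" if "j \<in> insert j0 J" for j
    proof (cases "j = j0")
      case True
      then show ?thesis using i0 by (simp add: sum)
    next
      case False
      then have "j \<in> J" using that by simp
      have "(\<Sum>i\<in>I'. A' j i * c i) = S j - A j i0 / A j0 i0 * S j0"
        by (simp add: A'_def S_def algebra_simps sum_subtractf sum_distrib_left sum_divide_distrib)
      then show ?thesis using eq[OF \<open>j \<in> J\<close>] sum by simp
    qed
    ultimately show ?thesis by blast
  qed
qed

definition lin_span :: "'a::field set \<Rightarrow> 'a set \<Rightarrow> 'a set" where
  "lin_span E B = {\<Sum>b\<in>B. a b * b | a. \<forall>b\<in>B. a b \<in> E}"

lemma lin_span_base: "field_subset E \<Longrightarrow> finite B \<Longrightarrow> b \<in> B \<Longrightarrow> b \<in> lin_span E B"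
  unfolding lin_span_def
  by (intro CollectI exI[of _ "\<lambda>x. if x = b then 1 else 0"])
    (auto simp: if_distrib[of "\<lambda>x. x * _"] field_subset_0 field_subset_1 cong: if_cong)

lemma lin_span_add:
  assumes E: "field_subset E" and "x \<in> lin_span E B" "y \<in> lin_span E B" shows "x + y \<in> lin_span E B"
proof -
  obtain a a' where "\<forall>b\<in>B. a b \<in> E" "x = (\<Sum>b\<in>B. a b * b)" "\<forall>b\<in>B. a' b \<in> E" "y = (\<Sum>b\<in>B. a' b * b)"
    using assms by (auto simp: lin_span_def)
  then show ?thesis unfolding lin_span_def
    by (intro CollectI exI[of _ "\<lambda>b. a b + a' b"])
      (auto simp: algebra_simps sum.distrib intro: field_subset_add[OF E])
qed

lemma lin_span_scale:
  assumes E: "field_subset E" and c: "c \<in> E" "x \<in> lin_span E B" shows "c * x \<in> lin_span E B"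
proof -
  obtain a where "\<forall>b\<in>B. a b \<in> E" "x = (\<Sum>b\<in>B. a b * b)"
    using assms by (auto simp: lin_span_def)
  then show ?thesis unfolding lin_span_def using c
    by (intro CollectI exI[of _ "\<lambda>b. c * a b"])
      (auto simp: algebra_simps sum_distrib_left intro: field_subset_mult[OF E])
qed

lemma lin_span_sum:
  assumes E: "field_subset E" and "\<And>i. i \<in> S \<Longrightarrow> g i \<in> lin_span E B" shows "sum g S \<in> lin_span E B"
proof -
  have "0 \<in> lin_span E B" unfolding lin_span_def
    by (intro CollectI exI[of _ "\<lambda>_. 0"]) (auto simp: field_subset_0[OF E])
  then show ?thesis using assms(2)
    by (induction S rule: infinite_finite_induct) (auto intro: lin_span_add[OF E])
qed

lemma lin_span_dependent:
  assumes E: "field_subset E" and B: "finite B" and I: "finite I" "card B < card I"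
    and x: "\<And>i. i \<in> I \<Longrightarrow> x i \<in> lin_span E B"
  shows "\<exists>c. (\<forall>i\<in>I. c i \<in> E) \<and> (\<exists>i\<in>I. c i \<noteq> 0) \<and> (\<Sum>i\<in>I. c i * x i) = 0"
proof -
  have "\<forall>i\<in>I. \<exists>a. (\<forall>b\<in>B. a b \<in> E) \<and> x i = (\<Sum>b\<in>B. a b * b)"
    using x by (force simp: lin_span_def)
  then obtain a where a: "\<And>i b. i \<in> I \<Longrightarrow> b \<in> B \<Longrightarrow> a i b \<in> E"
    and xa: "\<And>i. i \<in> I \<Longrightarrow> x i = (\<Sum>b\<in>B. a i b * b)" by metis
  obtain c where c: "\<forall>i\<in>I. c i \<in> E" "\<exists>i\<in>I. c i \<noteq> 0" and eq: "\<And>b. b \<in> B \<Longrightarrow> (\<Sum>i\<in>I. a i b * c i) = 0"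
    using underdetermined_system[OF E B I, of "\<lambda>b i. a i b"] a by blast
  have "(\<Sum>i\<in>I. c i * x i) = (\<Sum>i\<in>I. \<Sum>b\<in>B. a i b * c i * b)"
    by (intro sum.cong) (auto simp: xa sum_distrib_left ac_simps)
  also have "\<dots> = (\<Sum>b\<in>B. (\<Sum>i\<in>I. a i b * c i) * b)"
    by (subst sum.swap) (simp add: sum_distrib_right)
  also have "\<dots> = 0" by (simp add: eq)
  finally show ?thesis using c by blast
qed

section \<open>Minimal polynomials and simple extensions\<close>

definition poly_over :: "'a::zero set \<Rightarrow> 'a poly \<Rightarrow> bool" where
  "poly_over K p \<longleftrightarrow> (\<forall>i. coeff p i \<in> K)"

lemma poly_over_pCons: "poly_over K (pCons a p) \<longleftrightarrow> a \<in> K \<and> poly_over K p"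
  unfolding poly_over_def by (auto simp: coeff_pCons split: nat.splits)

lemma
  assumes K: "field_subset K"
  shows poly_over_0: "poly_over K 0" and poly_over_const: "a \<in> K \<Longrightarrow> poly_over K [:a:]"
    and poly_over_add: "poly_over K p \<Longrightarrow> poly_over K q \<Longrightarrow> poly_over K (p + q)"
    and poly_over_mult: "poly_over K p \<Longrightarrow> poly_over K q \<Longrightarrow> poly_over K (p * q)"
    and poly_over_diff: "poly_over K p \<Longrightarrow> poly_over K q \<Longrightarrow> poly_over K (p - q)"
    and poly_over_uminus: "poly_over K p \<Longrightarrow> poly_over K (- p)"
    and poly_over_smult: "a \<in> K \<Longrightarrow> poly_over K p \<Longrightarrow> poly_over K (smult a p)"
    and poly_over_monom: "a \<in> K \<Longrightarrow> poly_over K (monom a n)"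
    and poly_over_pderiv: "poly_over K p \<Longrightarrow> poly_over K (pderiv p)"
proof -
  note rules = field_subset_0[OF K] field_subset_1[OF K] field_subset_add[OF K] field_subset_mult[OF K]
    field_subset_diff[OF K] field_subset_sum[OF K]
  have n: "of_nat n \<in> K" for n by (induction n) (auto intro: rules)
  show "poly_over K 0" "a \<in> K \<Longrightarrow> poly_over K [:a:]" "poly_over K p \<Longrightarrow> poly_over K q \<Longrightarrow> poly_over K (p + q)"
    "poly_over K p \<Longrightarrow> poly_over K q \<Longrightarrow> poly_over K (p * q)" "poly_over K p \<Longrightarrow> poly_over K q \<Longrightarrow> poly_over K (p - q)"
    "poly_over K p \<Longrightarrow> poly_over K (- p)"
    "a \<in> K \<Longrightarrow> poly_over K p \<Longrightarrow> poly_over K (smult a p)" "a \<in> K \<Longrightarrow> poly_over K (monom a n)"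
    by (auto simp: poly_over_def coeff_pCons coeff_mult split: nat.splits intro: rules field_subset_uminus[OF K])
  show "poly_over K p \<Longrightarrow> poly_over K (pderiv p)"
    using n[of "Suc _"] by (auto simp: poly_over_def coeff_pderiv simp del: of_nat_Suc intro: rules)
qed

lemma poly_over_division:
  assumes K: "field_subset K" and p: "poly_over K p" "lead_coeff p = 1" "degree p > 0" and q: "poly_over K q"
  shows "\<exists>a r. poly_over K a \<and> poly_over K r \<and> q = a * p + r \<and> degree r < degree p"
  using q
proof (induction "degree q" arbitrary: q rule: less_induct)
  case less
  show ?case
  proof (cases "degree q < degree p")
    case True
    then show ?thesis using less.prems poly_over_0[OF K] by (intro exI[of _ 0] exI[of _ q]) simp
  next
    case False
    define m where "m = monom (lead_coeff q) (degree q - degree p)"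
    have m: "poly_over K m" unfolding m_def
      using less.prems by (intro poly_over_monom[OF K]) (simp add: poly_over_def)
    have q0: "q \<noteq> 0" "degree q > 0" using False p(3) by auto
    have dm: "degree m = degree q - degree p" "m \<noteq> 0" using q0 by (auto simp: m_def degree_monom_eq)
    have lm: "lead_coeff m = lead_coeff q" using dm by (simp add: m_def)
    have "p \<noteq> 0" using p by auto
    then have dmp: "degree (m * p) = degree q" "lead_coeff (m * p) = lead_coeff q"
      using dm(1,2) p(2) lm False unfolding lead_coeff_mult by (simp_all add: degree_mult_eq)
    have "degree (q - m * p) < degree q"
    proof (cases "q = m * p")
      case False
      then show ?thesis using dmp q0
        by (metis (no_types, lifting) coeff_diff degree_diff_le degree_eq_zeroE diff_self
            eq_iff_diff_eq_0 le_degree leading_coeff_0_iff le_neq_implies_less order_refl)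
    qed (use q0 in simp)
    from less.hyps[OF this poly_over_diff[OF K less.prems poly_over_mult[OF K m p(1)]]]
    obtain a r where "poly_over K a" "poly_over K r" "q - m * p = a * p + r" "degree r < degree p" by blast
    then show ?thesis using m
      by (intro exI[of _ "a + m"] exI[of _ r]) (auto simp: algebra_simps intro: poly_over_add[OF K])
  qed
qed

definition algebraic_over :: "'a::field set \<Rightarrow> 'a \<Rightarrow> bool" where
  "algebraic_over K y \<longleftrightarrow> (\<exists>p. poly_over K p \<and> p \<noteq> 0 \<and> poly p y = 0)"

definition min_poly :: "'a::field set \<Rightarrow> 'a \<Rightarrow> 'a poly \<Rightarrow> bool" where
  "min_poly K y p \<longleftrightarrow> poly_over K p \<and> lead_coeff p = 1 \<and> degree p > 0 \<and> poly p y = 0 \<and>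
    (\<forall>q. poly_over K q \<and> poly q y = 0 \<and> degree q < degree p \<longrightarrow> q = 0)"

lemma min_poly_exists:
  assumes K: "field_subset K" and y: "algebraic_over K y"
  shows "\<exists>p. min_poly K y p"
proof -
  let ?P = "\<lambda>p. poly_over K p \<and> p \<noteq> 0 \<and> poly p y = 0"
  obtain p where p: "?P p" and min: "\<And>q. ?P q \<Longrightarrow> degree p \<le> degree q"
    using ex_has_least_nat[of ?P] y unfolding algebraic_over_def by blast
  define p' where "p' = smult (inverse (lead_coeff p)) p"
  have "degree p > 0"
  proof (rule ccontr)
    assume "\<not> degree p > 0"
    then obtain c where "p = [:c:]" by (metis degree_eq_zeroE gr0I)
    then show False using p by simp
  qed
  moreover have "poly_over K p'" unfolding p'_def
    using p by (intro poly_over_smult[OF K] field_subset_inverse[OF K]) (auto simp: poly_over_def)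
  ultimately have "min_poly K y p'"
    unfolding min_poly_def using p min by (auto simp: p'_def not_less[symmetric])
  then show ?thesis by blast
qed

definition adjoin :: "'a::field set \<Rightarrow> 'a \<Rightarrow> 'a set" where
  "adjoin K y = {poly q y | q. poly_over K q}"

lemma adjoin_reduced:
  assumes K: "field_subset K" and p: "min_poly K y p" and z: "z \<in> adjoin K y"
  obtains q where "poly_over K q" "degree q < degree p" "z = poly q y"
proof -
  obtain q where q: "poly_over K q" "z = poly q y" using z by (auto simp: adjoin_def)
  have "poly_over K p" "lead_coeff p = 1" "degree p > 0" and py: "poly p y = 0"
    using p by (auto simp: min_poly_def)
  from poly_over_division[OF K this(1-3) q(1)]
  obtain a r where "poly_over K a" "poly_over K r" "q = a * p + r" "degree r < degree p" by blast
  then show ?thesis using that[of r] q py by simp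
qed

lemma min_poly_dvd:
  assumes K: "field_subset K" and p: "min_poly K y p" and q: "poly_over K q" "poly q y = 0"
  obtains a where "poly_over K a" "q = a * p"
proof -
  have "poly_over K p" "lead_coeff p = 1" "degree p > 0" and py: "poly p y = 0"
    using p by (auto simp: min_poly_def)
  from poly_over_division[OF K this(1-3) q(1)]
  obtain a r where ar: "poly_over K a" "poly_over K r" "q = a * p + r" "degree r < degree p" by blast
  then have "poly r y = 0" using q py by simp
  then have "r = 0" using p ar by (auto simp: min_poly_def)
  then show ?thesis using that ar by simp
qed

text \<open>Euclid's algorithm: dividing p by the normalized q gives p = c q1 + r, and p(y) = 0
  makes r(y) equal to -c(y) q1(y). An inverse of r(y), known by induction on the degree, yields one
  of q(y).\<close>

lemma adjoin_inverse:
  assumes K: "field_subset K" and p: "min_poly K y p"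
    and q: "poly_over K q" "degree q < degree p" "poly q y \<noteq> 0"
  shows "\<exists>a. poly_over K a \<and> poly a y * poly q y = 1"
  using q
proof (induction "degree q" arbitrary: q rule: less_induct)
  case less
  have lq: "lead_coeff q \<noteq> 0" using less.prems by auto
  have lqK: "inverse (lead_coeff q) \<in> K"
    using less.prems by (intro field_subset_inverse[OF K]) (simp add: poly_over_def)
  show ?case
  proof (cases "degree q = 0")
    case True
    then obtain c where "q = [:c:]" by (elim degree_eq_zeroE)
    then show ?thesis using lq lqK
      by (intro exI[of _ "[:inverse (lead_coeff q):]"]) (simp add: poly_over_const[OF K])
  next
    case False
    define q1 where "q1 = smult (inverse (lead_coeff q)) q"
    have q1: "poly_over K q1" "lead_coeff q1 = 1" "degree q1 = degree q"
      using lq less.prems lqK by (auto simp: q1_def intro: poly_over_smult[OF K])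
    from poly_over_division[OF K q1(1,2), of p] q1(3) False p obtain c r where
      cr: "poly_over K c" "poly_over K r" "p = c * q1 + r" "degree r < degree q"
      by (auto simp: min_poly_def)
    \<comment> \<open>Otherwise minimality gives r = 0, and c would be a nonzero polynomial of
      smaller degree than p vanishing at y.\<close>
    have "poly r y \<noteq> 0"
    proof
      assume r: "poly r y = 0"
      then have "poly c y * poly q1 y = 0" using cr(3) p by (simp add: min_poly_def)
      then have "poly c y = 0" using less.prems lq by (simp add: q1_def)
      have "r = 0" using r cr less.prems p by (auto simp: min_poly_def)
      then have pc: "p = c * q1" using cr by simp
      then have "c \<noteq> 0" using p by (auto simp: min_poly_def)
      moreover have "q1 \<noteq> 0" using q1 by auto
      ultimately have "degree c < degree p" using pc q1(3) False by (simp add: degree_mult_eq)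
      then show False using \<open>poly c y = 0\<close> \<open>c \<noteq> 0\<close> cr p by (auto simp: min_poly_def)
    qed
    then obtain a where a: "poly_over K a" "poly a y * poly r y = 1"
      using less.hyps[of r] cr less.prems by auto
    have "poly r y = - (poly c y * poly q1 y)"
      using cr(3) p by (simp add: min_poly_def eq_neg_iff_add_eq_0 add.commute)
    then have "poly (smult (- inverse (lead_coeff q)) (a * c)) y * poly q y = 1"
      using a by (simp add: q1_def mult_ac)
    then show ?thesis
      using a cr lqK
      by (intro exI[of _ "smult (- inverse (lead_coeff q)) (a * c)"])
        (auto intro!: poly_over_smult[OF K] poly_over_uminus[OF K] poly_over_mult[OF K])
  qed
qed

lemma field_subset_adjoin:
  assumes K: "field_subset K" and p: "min_poly K y p"
  shows "field_subset (adjoin K y)" "K \<subseteq> adjoin K y" "y \<in> adjoin K y"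
proof -
  have mem: "poly_over K q \<Longrightarrow> poly q y \<in> adjoin K y" for q by (auto simp: adjoin_def)
  show sub: "K \<subseteq> adjoin K y" using mem[OF poly_over_const[OF K]] by auto
  show "y \<in> adjoin K y"
    using mem[of "[:0, 1:]"] by (simp add: poly_over_pCons field_subset_0[OF K] field_subset_1[OF K] poly_over_0[OF K])
  have closed: "x + z \<in> adjoin K y" "x * z \<in> adjoin K y" "- x \<in> adjoin K y"
    if "x \<in> adjoin K y" "z \<in> adjoin K y" for x z
  proof -
    from that obtain a b where ab: "poly_over K a" "poly_over K b" "x = poly a y" "z = poly b y"
      by (auto simp: adjoin_def)
    show "x + z \<in> adjoin K y" using mem[OF poly_over_add[OF K ab(1,2)]] ab by simp
    show "x * z \<in> adjoin K y" using mem[OF poly_over_mult[OF K ab(1,2)]] ab by simp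
    show "- x \<in> adjoin K y" using mem[OF poly_over_uminus[OF K ab(1)]] ab by simp
  qed
  have inv: "inverse x \<in> adjoin K y" if x: "x \<in> adjoin K y" for x
  proof (cases "x = 0")
    case False
    obtain q where q: "poly_over K q" "degree q < degree p" "x = poly q y"
      using adjoin_reduced[OF K p x] by blast
    then obtain a where "poly_over K a" "poly a y * x = 1"
      using adjoin_inverse[OF K p q(1,2)] False by auto
    moreover from this have "inverse x = poly a y" by (intro inverse_unique) (simp add: mult.commute)
    ultimately show ?thesis using mem[of a] by simp
  qed (use sub field_subset_0[OF K] in auto)
  show "field_subset (adjoin K y)"
    unfolding field_subset_def
    using sub[THEN subsetD, OF field_subset_0[OF K]] sub[THEN subsetD, OF field_subset_1[OF K]]
    by (intro conjI ballI) (simp_all add: closed inv)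
qed

lemma
  assumes "hom_on K h" and K: "field_subset K"
  shows hom_on_0: "h 0 = 0" and hom_on_1: "h 1 = 1"
    and hom_on_add: "x \<in> K \<Longrightarrow> y \<in> K \<Longrightarrow> h (x + y) = h x + h y"
    and hom_on_mult: "x \<in> K \<Longrightarrow> y \<in> K \<Longrightarrow> h (x * y) = h x * h y"
    and hom_on_sum: "(\<And>i. i \<in> S \<Longrightarrow> g i \<in> K) \<Longrightarrow> h (sum g S) = (\<Sum>i\<in>S. h (g i))"
    and hom_on_uminus: "x \<in> K \<Longrightarrow> h (- x) = - h x"
    and hom_on_of_nat: "h (of_nat n) = of_nat n"
    and hom_on_nonzero: "x \<in> K \<Longrightarrow> x \<noteq> 0 \<Longrightarrow> h x \<noteq> 0"
proof -
  show 1: "h 1 = 1" and a: "x \<in> K \<Longrightarrow> y \<in> K \<Longrightarrow> h (x + y) = h x + h y"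
    and m: "x \<in> K \<Longrightarrow> y \<in> K \<Longrightarrow> h (x * y) = h x * h y" for x y
    using assms by (auto simp: hom_on_def)
  show 0: "h 0 = 0" using a[of 0 0] field_subset_0[OF K] by simp
  show "(\<And>i. i \<in> S \<Longrightarrow> g i \<in> K) \<Longrightarrow> h (sum g S) = (\<Sum>i\<in>S. h (g i))"
    by (induction S rule: infinite_finite_induct) (auto simp: 0 a field_subset_sum[OF K])
  show "x \<in> K \<Longrightarrow> h (- x) = - h x"
    using a[of x "- x"] field_subset_uminus[OF K] 0 by (simp add: eq_neg_iff_add_eq_0 add.commute)
  have "of_nat n \<in> K" for n by (induction n) (auto intro: field_subset_0[OF K] field_subset_1[OF K] field_subset_add[OF K])
  then show "h (of_nat n) = of_nat n"
    by (induction n) (auto simp: 0 1 a field_subset_1[OF K])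
  show "x \<in> K \<Longrightarrow> x \<noteq> 0 \<Longrightarrow> h x \<noteq> 0"
    using m[of x "inverse x"] field_subset_inverse[OF K] 1 by auto
qed

lemma
  assumes h: "hom_on K h" and K: "field_subset K"
  shows map_poly_hom_on_add: "poly_over K p \<Longrightarrow> poly_over K q \<Longrightarrow> map_poly h (p + q) = map_poly h p + map_poly h q"
    and map_poly_hom_on_mult: "poly_over K p \<Longrightarrow> poly_over K q \<Longrightarrow> map_poly h (p * q) = map_poly h p * map_poly h (q :: 'a::field poly)"
    and map_poly_hom_on_pderiv: "poly_over K p \<Longrightarrow> map_poly h (pderiv p) = pderiv (map_poly h p :: 'b::field poly)"
proof -
  note hs = hom_on_0[OF h K] hom_on_add[OF h K] hom_on_mult[OF h K] hom_on_sum[OF h K] hom_on_of_nat[OF h K]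
  show "poly_over K p \<Longrightarrow> poly_over K q \<Longrightarrow> map_poly h (p + q) = map_poly h p + map_poly h q"
    by (intro poly_eqI) (simp add: coeff_map_poly hs poly_over_def)
  show "poly_over K p \<Longrightarrow> poly_over K q \<Longrightarrow> map_poly h (p * q) = map_poly h p * map_poly h q"
    by (intro poly_eqI) (simp add: coeff_map_poly hs poly_over_def coeff_mult field_subset_mult[OF K])
  have n: "of_nat n \<in> K" for n by (induction n) (auto intro: field_subset_0[OF K] field_subset_1[OF K] field_subset_add[OF K])
  show "poly_over K p \<Longrightarrow> map_poly h (pderiv p) = pderiv (map_poly h p :: 'b::field poly)"
    by (intro poly_eqI)
      (simp add: coeff_map_poly hs poly_over_def coeff_pderiv n[of "Suc _"] del: of_nat_Suc)
qed

text \<open>The element q(y) is sent to (h q)(\<eta>). Two choices of q differ by a multiple of p,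
  whose image vanishes at \<eta>.\<close>

lemma hom_on_adjoin:
  fixes h :: "'a::field \<Rightarrow> 'b::field"
  assumes h: "hom_on K h" and K: "field_subset K" and p: "min_poly K y p"
    and \<eta>: "poly (map_poly h p) \<eta> = 0"
  shows "\<exists>g. hom_on (adjoin K y) g \<and> (\<forall>x\<in>K. g x = h x) \<and> g y = \<eta>"
proof -
  define g where "g = (\<lambda>z. poly (map_poly h (SOME q. poly_over K q \<and> poly q y = z)) \<eta>)"
  have g: "g (poly q y) = poly (map_poly h q) \<eta>" if q: "poly_over K q" for q
  proof -
    define q' where "q' = (SOME q'. poly_over K q' \<and> poly q' y = poly q y)"
    have q': "poly_over K q' \<and> poly q' y = poly q y"
      unfolding q'_def by (rule someI[of _ q]) (use q in simp)
    then have "poly_over K (q' - q)" "poly (q' - q) y = 0"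
      using q by (auto intro: poly_over_diff[OF K])
    from min_poly_dvd[OF K p this] obtain a where a: "poly_over K a" "q' - q = a * p" by blast
    have "q' = q + a * p" using a(2) by (simp add: algebra_simps)
    moreover have "poly_over K p" using p by (simp add: min_poly_def)
    ultimately have "map_poly h q' = map_poly h q + map_poly h a * map_poly h p"
      using a q by (simp add: map_poly_hom_on_add[OF h K] map_poly_hom_on_mult[OF h K] poly_over_mult[OF K])
    then show ?thesis using \<eta> unfolding g_def q'_def[symmetric] by simp
  qed
  have gK: "g x = h x" if "x \<in> K" for x
    using g[OF poly_over_const[OF K that]] by (simp add: map_poly_pCons hom_on_0[OF h K])
  have "g y = \<eta>"
    using g[of "[:0, 1:]"] by (simp add: poly_over_pCons field_subset_0[OF K] field_subset_1[OF K] poly_over_0[OF K]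
      map_poly_pCons hom_on_0[OF h K] hom_on_1[OF h K])
  moreover have "hom_on (adjoin K y) g"
    unfolding hom_on_def
  proof (intro conjI ballI)
    show "g 1 = 1" using gK[OF field_subset_1[OF K]] hom_on_1[OF h K] by simp
    fix x z assume "x \<in> adjoin K y" "z \<in> adjoin K y"
    then obtain a b where ab: "poly_over K a" "poly_over K b" "x = poly a y" "z = poly b y"
      by (auto simp: adjoin_def)
    show "g (x + z) = g x + g z"
      using ab g[OF ab(1)] g[OF ab(2)] g[OF poly_over_add[OF K ab(1,2)]]
      by (simp add: map_poly_hom_on_add[OF h K])
    show "g (x * z) = g x * g z"
      using ab g[OF ab(1)] g[OF ab(2)] g[OF poly_over_mult[OF K ab(1,2)]]
      by (simp add: map_poly_hom_on_mult[OF h K])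
  qed
  ultimately show ?thesis using gK by blast
qed

text \<open>In characteristic 0 the derivative p' does not vanish at y, so it is invertible modulo
  p: a p' - 1 = b p. This identity is carried over by h and evaluated at \<eta>.\<close>

lemma min_poly_image_separable:
  fixes h :: "'a::field_char_0 \<Rightarrow> 'b::field_char_0"
  assumes h: "hom_on K h" and K: "field_subset K" and p: "min_poly K y p"
    and \<eta>: "poly (map_poly h p) \<eta> = 0"
  shows "poly (pderiv (map_poly h p)) \<eta> \<noteq> 0"
proof
  assume *: "poly (pderiv (map_poly h p)) \<eta> = 0"
  have pK: "poly_over K p" and dp: "degree p > 0" using p by (auto simp: min_poly_def)
  have dK: "poly_over K (pderiv p)" by (rule poly_over_pderiv[OF K pK])
  have dd: "degree (pderiv p) < degree p" using dp by (simp add: degree_pderiv)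
  have "pderiv p \<noteq> 0" using dp by (simp add: pderiv_eq_0_iff)
  then have "poly (pderiv p) y \<noteq> 0" using p dK dd by (auto simp: min_poly_def)
  then obtain a where a: "poly_over K a" "poly a y * poly (pderiv p) y = 1"
    using adjoin_inverse[OF K p dK dd] by blast
  have "poly_over K (a * pderiv p - 1)" "poly (a * pderiv p - 1) y = 0"
    using a dK by (auto simp: one_pCons intro!: poly_over_diff[OF K] poly_over_mult[OF K] poly_over_const[OF K] field_subset_1[OF K])
  from min_poly_dvd[OF K p this] obtain b where b: "poly_over K b" "a * pderiv p - 1 = b * p" by blast
  have 1: "poly_over K 1" by (simp add: one_pCons poly_over_const[OF K] field_subset_1[OF K])
  have "a * pderiv p = b * p + 1" using b(2) by (simp add: algebra_simps)
  then have "map_poly h (a * pderiv p) = map_poly h (b * p + 1)" by simp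
  then have "map_poly h a * pderiv (map_poly h p) = map_poly h b * map_poly h p + 1"
    using a b pK dK 1 by (simp add: map_poly_hom_on_add[OF h K] map_poly_hom_on_mult[OF h K]
        map_poly_hom_on_pderiv[OF h K] poly_over_mult[OF K] hom_on_1[OF h K])
  from arg_cong[OF this, of "\<lambda>q. poly q \<eta>"] show False using * \<eta> by simp
qed

text \<open>A polynomial that splits still splits after a further substitution, so the product of
  the individual ramification indices serves all the polynomials.\<close>

lemma common_ramification:
  fixes P :: "'b \<Rightarrow> 'a::{alg_closed_field,field_char_0} fls poly"
  assumes "finite H" and "\<And>h. h \<in> H \<Longrightarrow> P h \<noteq> 0"
  shows "\<exists>k>0. \<forall>h\<in>H. \<exists>A. size A = degree (P h) \<and>
    map_poly (\<lambda>c. fls_compose_power c k) (P h) =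
      smult (fls_compose_power (lead_coeff (P h)) k) (\<Prod>x\<in>#A. [:-x, 1:])"
  using assms
proof (induction H rule: finite_induct)
  case empty
  then show ?case by (intro exI[of _ 1]) simp
next
  case (insert h0 H)
  let ?S = "\<lambda>k h. \<exists>A. size A = degree (P h) \<and> map_poly (\<lambda>c. fls_compose_power c k) (P h) =
      smult (fls_compose_power (lead_coeff (P h)) k) (\<Prod>x\<in>#A. [:-x, 1:])"
  from insert obtain k where k: "k > 0" "\<forall>h\<in>H. ?S k h" by auto
  from puiseux_splits[of "P h0"] insert.prems obtain l where l: "l > 0" "?S l h0" by auto
  have ext: "?S (m * n) h" if mn: "m > 0" "n > 0" and S: "?S m h" for m n h
  proof -
    from S obtain A where A: "size A = degree (P h)" and
      e: "map_poly (\<lambda>c. fls_compose_power c m) (P h) = smult (fls_compose_power (lead_coeff (P h)) m) (\<Prod>x\<in>#A. [:-x, 1:])"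
      by blast
    let ?g = "\<lambda>c :: 'a fls. fls_compose_power c n"
    have prod: "map_poly ?g (\<Prod>x\<in>#A. [:-x, 1:]) = (\<Prod>x\<in>#image_mset ?g A. [:-x, 1:])"
    proof (induction A)
      case (add x A)
      have "map_poly ?g [:-x, 1:] = [:- ?g x, 1:]" using mn by (simp add: map_poly_pCons)
      then show ?case using add
        by (simp only: image_mset_add_mset prod_mset.add_mset map_poly_hom_mult[OF rhom_compose_power[OF mn(2)]])
    qed (use mn in simp)
    have "map_poly (\<lambda>c. fls_compose_power c (m * n)) (P h) = map_poly ?g (map_poly (\<lambda>c. fls_compose_power c m) (P h))"
      using mn by (intro poly_eqI) (simp add: coeff_map_poly fls_compose_power_compose_power)
    also have "\<dots> = smult (fls_compose_power (lead_coeff (P h)) (m * n)) (map_poly ?g (\<Prod>x\<in>#A. [:-x, 1:]))"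
      unfolding e using mn by (intro poly_eqI) (simp add: coeff_map_poly fls_compose_power_compose_power)
    finally show ?thesis unfolding prod using A by (intro exI[of _ "image_mset ?g A"]) simp
  qed
  have "\<forall>h\<in>insert h0 H. ?S (k * l) h"
    using ext[of k l] ext[of l k h0] k l by (auto simp: mult.commute)
  then show ?case using k l by (intro exI[of _ "k * l"]) simp
qed

lemma card_roots_of_split_separable:
  fixes q :: "'a::field poly"
  assumes q: "q = smult c (\<Prod>x\<in>#A. [:-x, 1:])" "c \<noteq> 0"
    and sep: "\<And>x. poly q x = 0 \<Longrightarrow> poly (pderiv q) x \<noteq> 0"
  shows "finite {x. poly q x = 0}" "card {x. poly q x = 0} = size A"
proof -
  have roots: "poly q x = 0 \<longleftrightarrow> x \<in># A" for x
    unfolding q using q(2) by (induction A) auto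
  have "count A x \<le> 1" for x
  proof (rule ccontr)
    assume "\<not> count A x \<le> 1"
    then have "{#x, x#} \<subseteq># A"
      by (auto simp: subseteq_mset_def)
    then obtain B where "A = {#x, x#} + B" by (metis subset_mset.le_iff_add)
    then have "q = [:-x, 1:] * ([:-x, 1:] * smult c (\<Prod>x\<in>#B. [:-x, 1:]))"
      unfolding q by (simp add: mult_smult_right del: mult_pCons_left)
    then have "poly (pderiv q) x = 0" "poly q x = 0"
      by (simp_all only: pderiv_mult poly_add poly_mult) simp_all
    then show False using sep by blast
  qed
  then have "A = mset_set (set_mset A)"
    by (intro multiset_eqI) (metis count_greater_zero_iff count_mset_set(1,3) finite_set_mset gr0I le_neq_implies_less less_one not_in_iff)
  then show "finite {x. poly q x = 0}" "card {x. poly q x = 0} = size A"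
    unfolding roots by (simp_all, metis size_mset_set)
qed

text \<open>The ramification index \<open>k\<close> is needed because \<open>'w fls\<close> is not algebraically closed.\<close>

lemma embeddings_into_puiseux:
  fixes \<iota> :: "'a::field_char_0 \<Rightarrow> 'w::{alg_closed_field,field_char_0} fls"
  assumes E: "field_subset E" and \<iota>: "hom_on E \<iota>" and ys: "\<forall>y\<in>set ys. algebraic_over E y"
  shows "\<exists>K k H B. field_subset K \<and> E \<subseteq> K \<and> set ys \<subseteq> K \<and> k > 0 \<and> finite H \<and>
    (\<forall>h\<in>H. hom_on K h \<and> (\<forall>x\<in>E. h x = fls_compose_power (\<iota> x) k)) \<and>
    inj_on (\<lambda>h. map h ys) H \<and> finite B \<and> card B \<le> card H \<and> K \<subseteq> lin_span E B"
  using ys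
proof (induction ys)
  case Nil
  have "E \<subseteq> lin_span E {1}"
    using lin_span_scale[OF E _ lin_span_base[OF E, of "{1}" 1]] by force
  moreover have "fls_compose_power (\<iota> x) 1 = \<iota> x" for x by (intro fls_eqI) (simp add: fls_nth_compose_power)
  ultimately show ?case using E \<iota>
    by (intro exI[of _ E] exI[of _ 1] exI[of _ "{\<iota>}"] exI[of _ "{1}"]) auto
next
  case (Cons y ys)
  from Cons obtain K k H B where K: "field_subset K" "E \<subseteq> K" "set ys \<subseteq> K" and k: "k > 0"
    and H: "finite H" "\<And>h. h \<in> H \<Longrightarrow> hom_on K h"
      "\<And>h x. h \<in> H \<Longrightarrow> x \<in> E \<Longrightarrow> h x = fls_compose_power (\<iota> x) k" "inj_on (\<lambda>h. map h ys) H"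
    and B: "finite B" "card B \<le> card H" "K \<subseteq> lin_span E B" by auto
  have "algebraic_over K y"
  proof -
    obtain p where "poly_over E p" "p \<noteq> 0" "poly p y = 0" using Cons.prems by (auto simp: algebraic_over_def)
    then show ?thesis using K(2) unfolding algebraic_over_def poly_over_def by blast
  qed
  then obtain p where p: "min_poly K y p" using min_poly_exists[OF K(1)] by blast
  define d where "d = degree p"
  have pK: "poly_over K p" "lead_coeff p = 1" "d > 0" using p by (auto simp: min_poly_def d_def)
  have lch: "h (lead_coeff p) = 1" if "h \<in> H" for h
    using hom_on_1[OF H(2)[OF that] K(1)] pK by simp
  have Ph: "map_poly h p \<noteq> 0" "degree (map_poly h p) = d" if "h \<in> H" for h
  proof -
    show "degree (map_poly h p) = d" using map_poly_degree_eq[of h p] lch[OF that] d_def by simp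
    then show "map_poly h p \<noteq> 0" using pK by auto
  qed
  from common_ramification[OF H(1), of "\<lambda>h. map_poly h p"] Ph obtain l where l: "l > 0"
    and split: "\<And>h. h \<in> H \<Longrightarrow> \<exists>A. size A = d \<and> map_poly (\<lambda>c. fls_compose_power c l) (map_poly h p) =
      smult (fls_compose_power (lead_coeff (map_poly h p)) l) (\<Prod>x\<in>#A. [:-x, 1:])" by auto
  define R where "R = (\<lambda>(h :: 'a \<Rightarrow> 'w fls) x. fls_compose_power (h x) l :: 'w fls)"
  have R: "hom_on K (R h)" if "h \<in> H" for h
    using H(2)[OF that] l by (simp add: R_def hom_on_def)
  define roots where "roots = (\<lambda>h. {\<eta>. poly (map_poly (R h) p) \<eta> = 0})"
  have roots: "finite (roots h) \<and> card (roots h) = d" if h: "h \<in> H" for h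
  proof -
    have h0: "h 0 = 0" by (rule hom_on_0[OF H(2)[OF h] K(1)])
    obtain A where A: "size A = d" "map_poly (\<lambda>c. fls_compose_power c l) (map_poly h p) =
      smult (fls_compose_power (lead_coeff (map_poly h p)) l) (\<Prod>x\<in>#A. [:-x, 1:])" using split[OF h] by blast
    moreover have "map_poly (\<lambda>c. fls_compose_power c l) (map_poly h p) = map_poly (R h) p"
      by (intro poly_eqI) (simp add: coeff_map_poly h0 R_def)
    moreover have "fls_compose_power (lead_coeff (map_poly h p)) l \<noteq> 0"
      using Ph(1)[OF h] l by (simp only: fls_compose_power_eq_0_iff leading_coeff_0_iff not_False_eq_True)
    moreover have "poly (pderiv (map_poly (R h) p)) x \<noteq> 0" if "poly (map_poly (R h) p) x = 0" for x
      by (rule min_poly_image_separable[OF R[OF h] K(1) p that])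
    ultimately show ?thesis unfolding roots_def
      using card_roots_of_split_separable[of "map_poly (R h) p" _ A] by metis
  qed
  \<comment> \<open>An embedding of K(y) is an embedding of K together with a root of the image of
    p. By separability there are d roots, so the number of embeddings is multiplied by d, while
    passing from \<open>B\<close> to \<open>B'\<close> multiplies the spanning set by at most
    d.\<close>
  define W where "W = (SIGMA h:H. roots h)"
  have cW: "finite W" "card W = card H * d"
    using roots H(1) by (auto simp: W_def card_SigmaI)
  have "\<forall>w\<in>W. \<exists>g. hom_on (adjoin K y) g \<and> (\<forall>x\<in>K. g x = R (fst w) x) \<and> g y = snd w"
    using hom_on_adjoin[OF R K(1) p] by (auto simp: W_def roots_def)
  then obtain g where g: "\<And>w. w \<in> W \<Longrightarrow> hom_on (adjoin K y) (g w)"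
    "\<And>w x. w \<in> W \<Longrightarrow> x \<in> K \<Longrightarrow> g w x = R (fst w) x" "\<And>w. w \<in> W \<Longrightarrow> g w y = snd w" by metis
  have inj: "inj_on (\<lambda>w. map (g w) (y # ys)) W"
  proof (rule inj_onI)
    fix w w' assume w: "w \<in> W" "w' \<in> W" and eq: "map (g w) (y # ys) = map (g w') (y # ys)"
    then have "snd w = snd w'" using g(3) by simp
    moreover have "map (fst w) ys = map (fst w') ys"
    proof (rule map_cong[OF refl])
      fix x assume x: "x \<in> set ys"
      then have "g w x = g w' x" "x \<in> K" using eq K(3) by auto
      then have "R (fst w) x = R (fst w') x" using g(2)[OF w(1)] g(2)[OF w(2)] by metis
      then have "fls_compose_power (fst w x - fst w' x) l = 0" by (simp add: R_def)
      then show "fst w x = fst w' x" using l by (simp add: fls_compose_power_eq_0_iff del: fls_compose_power_diff)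
    qed
    then have "fst w = fst w'" using w H(4) by (auto simp: W_def dest: inj_onD)
    ultimately show "w = w'" by (simp add: prod_eq_iff)
  qed
  define H' where "H' = g ` W"
  have "inj_on g W" using inj by (auto simp: inj_on_def)
  then have cH': "card H' = card H * d" by (simp add: H'_def card_image cW)
  define B' where "B' = (\<lambda>(b, i). b * y ^ i) ` (B \<times> {..<d})"
  have cB': "finite B'" "card B' \<le> card H'"
  proof -
    show "finite B'" using B by (simp add: B'_def)
    have "card B' \<le> card B * d" unfolding B'_def
      using card_image_le[of "B \<times> {..<d}" "\<lambda>(b, i). b * y ^ i"] B(1) by (simp add: card_cartesian_product)
    also have "\<dots> \<le> card H * d" using B(2) by (rule mult_le_mono1)
    finally show "card B' \<le> card H'" using cH' by simp
  qed
  have "adjoin K y \<subseteq> lin_span E B'"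
  proof
    fix z assume "z \<in> adjoin K y"
    then obtain q where q: "poly_over K q" "degree q < d" "z = poly q y"
      using adjoin_reduced[OF K(1) p] unfolding d_def by blast
    have "coeff q i * y ^ i \<in> lin_span E B'" if "i < d" for i
    proof -
      have "coeff q i \<in> lin_span E B" using q B(3) by (auto simp: poly_over_def)
      then obtain a where a: "\<forall>b\<in>B. a b \<in> E" "coeff q i = (\<Sum>b\<in>B. a b * b)" by (auto simp: lin_span_def)
      have "(\<Sum>b\<in>B. a b * (b * y ^ i)) \<in> lin_span E B'"
        using a that by (intro lin_span_sum[OF E] lin_span_scale[OF E] lin_span_base[OF E cB'(1)]) (auto simp: B'_def)
      then show ?thesis by (simp add: a sum_distrib_right mult.assoc)
    qed
    then have "(\<Sum>i\<le>degree q. coeff q i * y ^ i) \<in> lin_span E B'"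
      using q(2) by (intro lin_span_sum[OF E]) auto
    then show "z \<in> lin_span E B'" by (simp add: q poly_altdef)
  qed
  moreover have "\<forall>h\<in>H'. hom_on (adjoin K y) h \<and> (\<forall>x\<in>E. h x = fls_compose_power (\<iota> x) (k * l))"
  proof
    fix h assume "h \<in> H'"
    then obtain w where w: "w \<in> W" "h = g w" by (auto simp: H'_def)
    have "h x = fls_compose_power (\<iota> x) (k * l)" if x: "x \<in> E" for x
    proof -
      have "h x = R (fst w) x" using g(2)[OF w(1)] w(2) x K(2) by blast
      also have "\<dots> = fls_compose_power (fls_compose_power (\<iota> x) k) l"
        using H(3)[OF _ x, of "fst w"] w(1) by (auto simp: R_def W_def)
      finally show ?thesis using k l by (simp add: fls_compose_power_compose_power)
    qed
    then show "hom_on (adjoin K y) h \<and> (\<forall>x\<in>E. h x = fls_compose_power (\<iota> x) (k * l))"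
      using g(1)[OF w(1)] w(2) by blast
  qed
  moreover have "inj_on (\<lambda>h. map h (y # ys)) H'"
    using inj unfolding H'_def by (auto simp: inj_on_def)
  moreover have "finite H'" using cW by (simp add: H'_def)
  ultimately show ?case
    using field_subset_adjoin[OF K(1) p] K k l cB'
    by (intro exI[of _ "adjoin K y"] exI[of _ "k * l"] exI[of _ H'] exI[of _ B']) auto
qed

section \<open>Polynomials and their evaluations\<close>

alias lookup = Poly_Mapping.lookup
alias keys = Poly_Mapping.keys
alias single = Poly_Mapping.single

lemma cpoly_induct [case_names single add]:
  fixes p :: "'m \<Rightarrow>\<^sub>0 'c::comm_monoid_add"
  assumes s: "\<And>m c. P (single m c)" and a: "\<And>p q. P p \<Longrightarrow> P q \<Longrightarrow> P (p + q)"
  shows "P p"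
proof -
  have "p = (\<Sum>m\<in>keys p. single m (lookup p m))"
    by (intro poly_mapping_eqI)
      (auto simp: lookup_sum lookup_single when_def in_keys_iff)
  moreover have "P (\<Sum>m\<in>S. single m (lookup p m))" if "finite S" for S
    using that
  proof (induction S rule: finite_induct)
    case empty
    show ?case using s[of undefined 0] by simp
  qed (auto intro: s a)
  ultimately show ?thesis by (metis finite_keys)
qed

lemma rhomD:
  assumes "rhom h"
  shows "h 0 = 0" "h 1 = 1" "h (x + y) = h x + h y" "h (x * y) = h x * h y" "h (- x) = - h x"
    "h (x - y) = h x - h y" "h (sum g S) = (\<Sum>i\<in>S. h (g i))" "h (x ^ n) = h x ^ n"
proof -
  show 1: "h 1 = 1" and a: "h (x + y) = h x + h y" and m: "h (x * y) = h x * h y" for x y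
    using assms by (auto simp: hom_on_def)
  show 0: "h 0 = 0" using a[of 0 0] by simp
  show n: "h (- x) = - h x" for x using a[of x "- x"] 0 by (simp add: eq_neg_iff_add_eq_0 add.commute)
  show "h (x - y) = h x - h y" using a[of x "- y"] n[of y] by simp
  show "h (sum g S) = (\<Sum>i\<in>S. h (g i))"
    by (induction S rule: infinite_finite_induct) (auto simp: 0 a)
  show "h (x ^ n) = h x ^ n" by (induction n) (auto simp: 1 m)
qed

lemma rhom_prod:
  fixes h :: "'a::comm_ring_1 \<Rightarrow> 'b::comm_ring_1"
  assumes "rhom h" shows "h (prod g S) = (\<Prod>i\<in>S. h (g i))"
  by (induction S rule: infinite_finite_induct) (auto simp: rhomD[OF assms])

lemma rhom_of_nat: "rhom h \<Longrightarrow> h (of_nat n) = of_nat n"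
  by (induction n) (auto simp: rhomD)

lemma rhom_comp: "rhom g \<Longrightarrow> rhom h \<Longrightarrow> rhom (\<lambda>x. g (h x))"
  by (simp add: hom_on_def)

section \<open>Evaluation homomorphisms\<close>

definition monom_deg :: "('n::finite \<Rightarrow>\<^sub>0 nat) \<Rightarrow> nat" where
  "monom_deg m = (\<Sum>i\<in>UNIV. lookup m i)"

text \<open>\<open>peval\<close> and \<open>psubst\<close> are the cases where h is the identity and
  \<open>pconst\<close>. Values in series, in fraction fields and in an algebraic closure use the
  same operator with other h.\<close>

definition ev :: "(complex \<Rightarrow> 'b::comm_ring_1) \<Rightarrow> ('n::finite \<Rightarrow> 'b) \<Rightarrow> 'n cpoly \<Rightarrow> 'b" where
  "ev h x p = (\<Sum>m\<in>keys p. h (lookup p m) * (\<Prod>i\<in>UNIV. x i ^ lookup m i))"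

lemma peval_eq_ev: "peval p x = ev (\<lambda>c. c) x p"
  by (simp add: peval_def ev_def)

lemma psubst_eq_ev: "psubst p F = ev pconst F p"
  by (simp add: psubst_def ev_def)

lemma ev_superset:
  assumes "rhom h" "finite S" "keys p \<subseteq> S"
  shows "ev h x p = (\<Sum>m\<in>S. h (lookup p m) * (\<Prod>i\<in>UNIV. x i ^ lookup m i))"
  unfolding ev_def using assms
  by (intro sum.mono_neutral_left) (auto simp: in_keys_iff rhomD)

lemma ev_single: "rhom h \<Longrightarrow> ev h x (single m c) = h c * (\<Prod>i\<in>UNIV. x i ^ lookup m i)"
  by (subst ev_superset[of _ "{m}"]) auto

lemma ev_add:
  assumes "rhom h" shows "ev h x (p + q) = ev h x p + ev h x q"
proof -
  have "keys (p + q) \<subseteq> keys p \<union> keys q" by (rule Poly_Mapping.keys_add)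
  then show ?thesis
    using assms by (simp add: ev_superset[of h "keys p \<union> keys q"] lookup_add rhomD algebra_simps sum.distrib)
qed

lemma ev_mult:
  assumes "rhom h" shows "ev h x (p * q) = ev h x p * ev h x q"
proof (induction p rule: cpoly_induct)
  case (single m c)
  show ?case
    by (induction q rule: cpoly_induct)
      (simp_all add: ev_single assms mult_single rhomD lookup_add power_add prod.distrib ev_add algebra_simps)
qed (simp add: ev_add assms algebra_simps)

lemma rhom_ev:
  assumes h: "rhom h" shows "rhom (ev h x)"
proof -
  have "ev h x (single 0 1) = 1" by (simp only: ev_single[OF h]) (simp add: rhomD[OF h])
  then show ?thesis by (simp add: hom_on_def[of UNIV "ev h x"] ev_add[OF h] ev_mult[OF h])
qed

lemma ev_pconst: "rhom h \<Longrightarrow> ev h x (pconst c) = h c"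
  by (simp add: pconst_def ev_single)

lemma ev_pvar: "rhom h \<Longrightarrow> ev h x (pvar i) = x i"
  by (simp add: pvar_def ev_single rhomD lookup_single when_def if_distrib[of "\<lambda>n. _ ^ n"] cong: if_cong)

lemma rhom_id: "rhom (\<lambda>c. c)"
  by (simp add: hom_on_def)

lemma rhom_pconst: "rhom (pconst :: complex \<Rightarrow> 'n cpoly)"
  by (simp add: hom_on_def pconst_def single_add mult_single)

lemma pvar_nonzero: "pvar i \<noteq> (0 :: 'n::finite cpoly)"
  by (metis ev_pvar[OF rhom_id, of "\<lambda>_. 1"] rhomD(1)[OF rhom_ev[OF rhom_id]] zero_neq_one)

lemma pconst_of_nat: "pconst (of_nat n) = of_nat n"
  by (rule rhom_of_nat[OF rhom_pconst])

lemma pconst_eq_0_iff: "pconst c = 0 \<longleftrightarrow> c = 0"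
  by (metis pconst_def lookup_single_eq lookup_zero single_zero)

lemma ev_hom:
  assumes g: "rhom g" and h: "rhom h"
  shows "g (ev h x p) = ev (\<lambda>c. g (h c)) (\<lambda>i. g (x i)) p"
  by (simp add: ev_def rhomD[OF g] rhom_prod[OF g])

lemma ev_psubst:
  assumes h: "rhom h" shows "ev h x (psubst p F) = ev h (\<lambda>i. ev h x (F i)) p"
  unfolding psubst_eq_ev by (simp add: ev_hom[OF rhom_ev[OF h] rhom_pconst] ev_pconst[OF h])

lemma prod_pvar_power: "(\<Prod>i\<in>S. pvar i ^ lookup m i) = single (\<Sum>i\<in>S. single i (lookup m i)) 1"
proof (induction S rule: infinite_finite_induct)
  case (insert i S)
  have "pvar i ^ n = single (single i n) 1" for n
    by (induction n) (simp_all add: pvar_def mult_single single_add[symmetric])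
  with insert show ?case by (simp add: mult_single)
qed simp_all

lemma sum_single_lookup: "(\<Sum>i\<in>UNIV. single i (lookup m i)) = (m :: 'n::finite \<Rightarrow>\<^sub>0 nat)"
  by (intro poly_mapping_eqI) (simp add: lookup_sum lookup_single when_def)

lemma ev_pvar_id: "ev pconst pvar p = p"
proof (induction p rule: cpoly_induct)
  case (single m c)
  then show ?case
    unfolding ev_single[OF rhom_pconst] prod_pvar_power sum_single_lookup
    by (simp add: pconst_def mult_single)
qed (simp add: ev_add[OF rhom_pconst])

text \<open>Unlike the partial derivative, this operator is diagonal in the monomials.\<close>

definition theta :: "'n \<Rightarrow> 'n cpoly \<Rightarrow> 'n cpoly" where
  "theta i p = pvar i * partial_deriv i p"

lemma toric_polar_map_eq: "toric_polar_map f i = theta i f"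
  by (simp add: toric_polar_map_def theta_def)

lemma lookup_theta: "lookup (theta i p) m = of_nat (lookup m i) * lookup p m"
proof -
  have "pvar i * single (m - single i 1) (of_nat (lookup m i) * c) = single m (of_nat (lookup m i) * c)"
    for m :: "'a \<Rightarrow>\<^sub>0 nat" and c
  proof (cases "lookup m i = 0")
    case False
    then have "single i 1 + (m - single i 1) = m"
      by (intro poly_mapping_eqI) (auto simp: lookup_add lookup_minus lookup_single when_def)
    then show ?thesis by (simp add: pvar_def mult_single)
  qed simp
  then have "theta i p = (\<Sum>m\<in>keys p. single m (of_nat (lookup m i) * lookup p m))"
    by (simp add: theta_def partial_deriv_def sum_distrib_left)
  then show ?thesis
    by (auto simp: lookup_sum lookup_single when_def in_keys_iff)
qed

lemma theta_single: "theta i (single m c) = single m (of_nat (lookup m i) * c)"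
  by (intro poly_mapping_eqI) (auto simp: lookup_theta lookup_single when_def)

lemma theta_add: "theta i (p + q) = theta i p + theta i q"
  by (intro poly_mapping_eqI) (simp add: lookup_theta lookup_add algebra_simps)

lemma theta_1: "theta i 1 = 0"
  by (intro poly_mapping_eqI) (simp add: lookup_theta lookup_one when_def)

lemma theta_mult: "theta i (p * q) = theta i p * q + p * theta i q"
proof (induction p rule: cpoly_induct)
  case (single m c)
  show ?case
    by (induction q rule: cpoly_induct)
      (simp_all add: mult_single theta_single theta_add lookup_add algebra_simps flip: single_add)
qed (simp add: theta_add algebra_simps)

lemma theta_power: "theta i (p ^ n) * p = of_nat n * p ^ n * theta i p"
  by (induction n) (simp_all add: theta_1 theta_mult algebra_simps)

text \<open>Chain rule in logarithmic form: the coefficients are constant, and the logarithmic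
  derivative of a monomial is the sum of those of the x i weighted by the exponents.\<close>

lemma ev_theta_chain:
  fixes x :: "'n::finite \<Rightarrow> 'w::field fls"
  assumes h: "rhom h" and hc: "\<And>c. fls_deriv (h c) = 0" and x: "\<And>i. x i \<noteq> 0"
  shows "fls_deriv (ev h x p) = (\<Sum>i\<in>UNIV. ev h x (theta i p) * (fls_deriv (x i) / x i))"
proof (induction p rule: cpoly_induct)
  case (single m c)
  have pw: "fls_deriv (y ^ n) = of_nat n * y ^ n * (fls_deriv y / y)" if "y \<noteq> 0" for y :: "'w fls" and n
    using that by (induction n) (simp_all add: field_simps)
  have "fls_deriv (\<Prod>i\<in>S. x i ^ lookup m i) =
      (\<Prod>i\<in>S. x i ^ lookup m i) * (\<Sum>i\<in>S. of_nat (lookup m i) * (fls_deriv (x i) / x i))" for S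
    by (induction S rule: infinite_finite_induct) (simp_all add: pw[OF x] algebra_simps)
  then show ?case
    by (simp add: ev_single[OF h] theta_single rhomD[OF h] rhom_of_nat[OF h] hc sum_distrib_left algebra_simps)
qed (simp add: ev_add[OF h] theta_add algebra_simps sum.distrib)

section \<open>Homogeneity\<close>

lemma homogeneous_iff: "homogeneous d p \<longleftrightarrow> (\<forall>m\<in>keys p. monom_deg m = d)"
  by (simp add: homogeneous_def monom_deg_def)

lemma monom_deg_add: "monom_deg (m + n) = monom_deg m + monom_deg n"
  by (simp add: monom_deg_def lookup_add sum.distrib)

lemma homogeneous_single: "monom_deg m = d \<Longrightarrow> homogeneous d (single m c)"
  by (auto simp: homogeneous_iff)

lemma homogeneous_0: "homogeneous d 0"
  by (simp add: homogeneous_iff)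

lemma homogeneous_pconst: "homogeneous 0 (pconst c)"
  unfolding pconst_def by (rule homogeneous_single) (simp add: monom_deg_def)

lemma homogeneous_1: "homogeneous 0 1"
  by (simp add: homogeneous_iff monom_deg_def)

lemma homogeneous_pvar: "homogeneous 1 (pvar i)"
  unfolding pvar_def by (rule homogeneous_single) (simp add: monom_deg_def lookup_single when_def)

lemma homogeneous_add: "homogeneous d p \<Longrightarrow> homogeneous d q \<Longrightarrow> homogeneous d (p + q)"
  using Poly_Mapping.keys_add[of p q] by (auto simp: homogeneous_iff)

lemma homogeneous_uminus: "homogeneous d p \<Longrightarrow> homogeneous d (- p)"
  by (simp add: homogeneous_iff in_keys_iff)

lemma homogeneous_diff: "homogeneous d p \<Longrightarrow> homogeneous d q \<Longrightarrow> homogeneous d (p - q)"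
  using homogeneous_add[of d p "- q"] homogeneous_uminus by fastforce

lemma homogeneous_mult: "homogeneous d p \<Longrightarrow> homogeneous e q \<Longrightarrow> homogeneous (d + e) (p * q)"
  using keys_mult[of p q] by (fastforce simp: homogeneous_iff monom_deg_add)

lemma homogeneous_sum: "(\<And>i. i \<in> S \<Longrightarrow> homogeneous d (g i)) \<Longrightarrow> homogeneous d (sum g S)"
  by (induction S rule: infinite_finite_induct) (auto intro: homogeneous_0 homogeneous_add)

lemma homogeneous_prod:
  "finite S \<Longrightarrow> (\<And>i. i \<in> S \<Longrightarrow> homogeneous (d i) (g i)) \<Longrightarrow> homogeneous (\<Sum>i\<in>S. d i) (prod g S)"
  by (induction S rule: finite_induct) (auto intro: homogeneous_1 homogeneous_mult)

lemma homogeneous_power: "homogeneous d p \<Longrightarrow> homogeneous (n * d) (p ^ n)"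
  by (induction n) (auto intro: homogeneous_1 homogeneous_mult)

lemma homogeneous_theta: "homogeneous d p \<Longrightarrow> homogeneous d (theta i p)"
  by (auto simp: homogeneous_iff in_keys_iff lookup_theta)

lemma homogeneous_psubst:
  assumes P: "homogeneous d P" and F: "\<And>i. homogeneous e (F i)"
  shows "homogeneous (d * e) (psubst P F)"
  unfolding psubst_def
proof (rule homogeneous_sum)
  fix m assume "m \<in> keys P"
  then have d: "d = monom_deg m" using P by (simp add: homogeneous_iff)
  have "homogeneous (\<Sum>i\<in>UNIV. lookup m i * e) (\<Prod>i\<in>UNIV. F i ^ lookup m i)"
    using F by (intro homogeneous_prod homogeneous_power) auto
  then have "homogeneous (d * e) (\<Prod>i\<in>UNIV. F i ^ lookup m i)"
    by (simp add: d monom_deg_def sum_distrib_right)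
  from homogeneous_mult[OF homogeneous_pconst this]
  show "homogeneous (d * e) (pconst (lookup P m) * (\<Prod>i\<in>UNIV. F i ^ lookup m i))" by simp
qed

lemma ev_scale:
  assumes "rhom h" "homogeneous d p"
  shows "ev h (\<lambda>i. c * x i) p = c ^ d * ev h x p"
  unfolding ev_def sum_distrib_left
proof (rule sum.cong[OF refl])
  fix m assume "m \<in> keys p"
  then have "d = (\<Sum>i\<in>UNIV. lookup m i)" using assms by (simp add: homogeneous_def)
  then show "h (lookup p m) * (\<Prod>i\<in>UNIV. (c * x i) ^ lookup m i) =
      c ^ d * (h (lookup p m) * (\<Prod>i\<in>UNIV. x i ^ lookup m i))"
    by (simp add: power_mult_distrib prod.distrib power_sum algebra_simps)
qed

lemma euler_homogeneous: "homogeneous d p \<Longrightarrow> (\<Sum>i\<in>UNIV. theta i p) = of_nat d * p"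
proof -
  assume p: "homogeneous d p"
  have "(\<Sum>i\<in>UNIV. of_nat (lookup m i) * lookup p m) = of_nat d * lookup p m" for m
    using p by (cases "m \<in> keys p") (auto simp: homogeneous_def in_keys_iff simp flip: sum_distrib_right of_nat_sum)
  moreover have "lookup (of_nat d * p) m = of_nat d * lookup p m" for m
    by (induction d) (simp_all add: algebra_simps lookup_add)
  ultimately show ?thesis
    by (intro poly_mapping_eqI) (simp add: lookup_sum lookup_theta)
qed

text \<open>This is p with every variable multiplied by a new indeterminate. The operation is
  multiplicative, and p is homogeneous exactly when the result is p times a power of the
  indeterminate, so that factors of forms can be studied in one indeterminate.\<close>

definition grade :: "'n::finite cpoly \<Rightarrow> 'n cpoly poly" where
  "grade p = ev (\<lambda>c. [:pconst c:]) (\<lambda>i. monom (pvar i) 1) p"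

lemma rhom_const_poly: "rhom h \<Longrightarrow> rhom (\<lambda>c. [:h c:])"
  by (simp add: hom_on_def one_pCons)

lemma grade_mult: "grade (p * q) = grade p * grade q"
  unfolding grade_def by (rule ev_mult[OF rhom_const_poly[OF rhom_pconst]])

lemma grade_single: "grade (single m c) = monom (single m c) (monom_deg m)"
proof -
  have "(\<Prod>i\<in>S. monom (pvar i :: 'a cpoly) 1 ^ lookup m i) = monom (\<Prod>i\<in>S. pvar i ^ lookup m i) (\<Sum>i\<in>S. lookup m i)" for S
    by (induction S rule: infinite_finite_induct) (simp_all add: monom_power mult_monom)
  then show ?thesis
    unfolding grade_def ev_single[OF rhom_const_poly[OF rhom_pconst]]
    by (simp only: prod_pvar_power sum_single_lookup) (simp add: smult_monom pconst_def mult_single monom_deg_def)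
qed

lemma lookup_grade: "lookup (coeff (grade p) d) m = (if monom_deg m = d then lookup p m else 0)"
proof (induction p rule: cpoly_induct)
  case (single m c)
  show ?case by (auto simp: grade_single lookup_single when_def)
next
  case (add p q)
  have "grade (p + q) = grade p + grade q"
    unfolding grade_def by (rule ev_add[OF rhom_const_poly[OF rhom_pconst]])
  then show ?case using add by (simp add: lookup_add)
qed

lemma homogeneous_iff_grade: "homogeneous d p \<longleftrightarrow> grade p = monom p d"
proof
  assume "homogeneous d p"
  then show "grade p = monom p d"
    by (intro poly_eqI poly_mapping_eqI) (auto simp: lookup_grade homogeneous_iff in_keys_iff)
next
  assume "grade p = monom p d"
  then have "lookup p m = lookup (coeff (monom p d) (monom_deg m)) m" for m
    using lookup_grade[of p "monom_deg m" m] by simp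
  then have "lookup p m = 0" if "monom_deg m \<noteq> d" for m
    using that by (metis coeff_monom lookup_zero)
  then show "homogeneous d p" by (auto simp: homogeneous_iff in_keys_iff)
qed

text \<open>In a domain the lowest terms of the factors multiply to the lowest term of the product,
  and likewise the highest ones. Here both are the same term, so each factor has only one.\<close>

lemma factor_of_monom:
  fixes A B :: "'a::idom poly"
  assumes AB: "A * B = monom c D" and c: "c \<noteq> 0"
  shows "\<exists>a e. A = monom a e"
proof -
  have nz: "A \<noteq> 0" "B \<noteq> 0" using AB c by auto
  define i where "i = (LEAST i. coeff A i \<noteq> 0)"
  define j where "j = (LEAST i. coeff B i \<noteq> 0)"
  have "\<exists>i. coeff A i \<noteq> 0" "\<exists>j. coeff B j \<noteq> 0"
    using nz leading_coeff_0_iff by blast+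
  then have i: "coeff A i \<noteq> 0" "\<And>k. k < i \<Longrightarrow> coeff A k = 0"
    and j: "coeff B j \<noteq> 0" "\<And>k. k < j \<Longrightarrow> coeff B k = 0"
    unfolding i_def j_def using LeastI_ex[of "\<lambda>i. coeff A i \<noteq> 0"] LeastI_ex[of "\<lambda>i. coeff B i \<noteq> 0"]
    by (auto dest: not_less_Least)
  have "coeff (A * B) (i + j) = (\<Sum>k\<in>{i}. coeff A k * coeff B (i + j - k))"
    unfolding coeff_mult
  proof (rule sum.mono_neutral_right)
    show "\<forall>k\<in>{..i + j} - {i}. coeff A k * coeff B (i + j - k) = 0"
    proof
      fix k assume "k \<in> {..i + j} - {i}"
      then have "k < i \<or> i + j - k < j" by auto
      then show "coeff A k * coeff B (i + j - k) = 0" using i(2) j(2) by auto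
    qed
  qed auto
  then have "coeff (monom c D) (i + j) \<noteq> 0" using i j AB by simp
  then have "D = i + j" by (auto split: if_splits)
  moreover have "degree A + degree B = D"
    using AB nz c by (metis degree_monom_eq degree_mult_eq)
  moreover have "i \<le> degree A" "j \<le> degree B" using i j by (auto intro: le_degree)
  ultimately have "i = degree A" by linarith
  then have "A = monom (coeff A i) i"
    using i(2) by (intro poly_eqI) (metis coeff_eq_0 coeff_monom linorder_neqE_nat)
  then show ?thesis by blast
qed

lemma homogeneous_factor:
  fixes p q :: "'n::{finite,linorder} cpoly"
  assumes "homogeneous d (p * q)" "p * q \<noteq> 0"
  shows "\<exists>e. homogeneous e p"
proof -
  have "grade p * grade q = monom (p * q) d"
    using assms by (simp add: homogeneous_iff_grade grade_mult)
  from factor_of_monom[OF this assms(2)] obtain a e where a: "grade p = monom a e" by blast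
  have "lookup p m = 0" if "monom_deg m \<noteq> e" for m
    using a that lookup_grade[of p "monom_deg m" m] by (simp split: if_splits)
  then have "homogeneous e p" by (auto simp: homogeneous_iff in_keys_iff)
  then show ?thesis by blast
qed

lemma homogeneous_factor_prod:
  fixes g :: "nat \<Rightarrow> 'n::{finite,linorder} cpoly"
  assumes "homogeneous d (\<Prod>j<l. g j ^ n j)" "(\<Prod>j<l. g j ^ n j) \<noteq> 0" "j < l" "n j \<ge> 1"
  shows "\<exists>e. homogeneous e (g j)"
proof -
  define r where "r = g j ^ (n j - 1) * (\<Prod>i\<in>{..<l} - {j}. g i ^ n i)"
  have "(\<Prod>j<l. g j ^ n j) = g j ^ n j * (\<Prod>i\<in>{..<l} - {j}. g i ^ n i)"
    using assms(3) by (intro prod.remove) auto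
  also have "g j ^ n j = g j * g j ^ (n j - 1)"
    using assms(4) by (cases "n j") auto
  finally have "(\<Prod>j<l. g j ^ n j) = g j * r" by (simp only: r_def mult.assoc)
  then show ?thesis using homogeneous_factor[of d "g j" r] assms(1,2) by simp
qed

section \<open>Algebraic relations between forms\<close>

definition monoms :: "nat \<Rightarrow> ('n::finite \<Rightarrow>\<^sub>0 nat) set" where
  "monoms d = {m. monom_deg m = d}"

lemma finite_monoms: "finite (monoms d :: ('n::finite \<Rightarrow>\<^sub>0 nat) set)"
proof -
  have "lookup m i \<le> d" if "monom_deg m = d" for m :: "'n \<Rightarrow>\<^sub>0 nat" and i
    using that member_le_sum[of i UNIV "lookup m"] by (simp add: monom_deg_def)
  then have "lookup ` monoms d \<subseteq> {f. \<forall>i::'n. f i \<in> {..d}}" by (auto simp: monoms_def)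
  moreover have "finite {f. \<forall>i::'n. f i \<in> {..d}}"
    using finite_set_of_finite_funs[of "UNIV :: 'n set" "{..d}" 0] by simp
  ultimately have "finite (lookup ` (monoms d :: ('n \<Rightarrow>\<^sub>0 nat) set))" by (rule finite_subset)
  then show ?thesis
    by (rule finite_imageD) (auto intro: inj_onI poly_mapping_eqI)
qed

lemma card_monoms_pos: "card (monoms d :: ('n::finite \<Rightarrow>\<^sub>0 nat) set) > 0"
proof -
  have "single undefined d \<in> (monoms d :: ('n \<Rightarrow>\<^sub>0 nat) set)"
    by (simp add: monoms_def monom_deg_def lookup_single when_def)
  then show ?thesis using finite_monoms by (auto simp: card_gt_0_iff)
qed

lemma lookup_Abs_finite: "lookup (Abs_poly_mapping f :: 'n::finite \<Rightarrow>\<^sub>0 nat) = f"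
  by (rule lookup_Abs_poly_mapping) simp

text \<open>
  Dividing all exponents by \<open>c\<close> leaves a deficit in the degree, which is put on the exponent of one
  fixed variable; that exponent is determined by the others and the total degree.
\<close>

lemma card_monoms_mult_le:
  assumes c: "c \<ge> 1"
  shows "card (monoms (c * d) :: ('n::finite \<Rightarrow>\<^sub>0 nat) set) \<le> c ^ card (UNIV :: 'n set) * card (monoms d :: ('n \<Rightarrow>\<^sub>0 nat) set)"
proof -
  define i0 :: 'n where "i0 = undefined"
  define q where "q = (\<lambda>m :: 'n \<Rightarrow>\<^sub>0 nat. \<lambda>i. lookup m i div c)"
  define \<phi> where "\<phi> = (\<lambda>m :: 'n \<Rightarrow>\<^sub>0 nat.
    ((\<lambda>i. lookup m i mod c), (Abs_poly_mapping ((q m)(i0 := q m i0 + (d - (\<Sum>i\<in>UNIV. q m i)))) :: 'n \<Rightarrow>\<^sub>0 nat)))"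
  have sum_le: "(\<Sum>i\<in>UNIV. q m i) \<le> d" if "m \<in> monoms (c * d)" for m
  proof -
    have "c * (\<Sum>i\<in>UNIV. q m i) \<le> (\<Sum>i\<in>UNIV. lookup m i)"
      unfolding sum_distrib_left q_def by (intro sum_mono) simp
    then show ?thesis using that c by (simp add: monoms_def monom_deg_def)
  qed
  have sum_upd: "(\<Sum>i\<in>UNIV. (g(i0 := g i0 + x)) i) = (\<Sum>i\<in>UNIV. g i) + x" for g :: "'n \<Rightarrow> nat" and x
    by (subst (1 2) sum.remove[of UNIV i0]) auto
  have sub: "\<phi> ` monoms (c * d) \<subseteq> {f. \<forall>i. f i \<in> {..<c}} \<times> monoms d"
  proof
    fix z assume "z \<in> \<phi> ` monoms (c * d)"
    then obtain m where m: "m \<in> monoms (c * d)" "z = \<phi> m" by blast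
    have "snd z \<in> monoms d"
      using sum_le[OF m(1)] unfolding m(2) \<phi>_def monoms_def monom_deg_def
      by (simp only: snd_conv mem_Collect_eq lookup_Abs_finite sum_upd)
    then show "z \<in> {f. \<forall>i. f i \<in> {..<c}} \<times> monoms d" using c m by (cases z) (auto simp: \<phi>_def)
  qed
  have inj: "inj_on \<phi> (monoms (c * d))"
  proof (rule inj_onI)
    fix m m' assume m: "m \<in> monoms (c * d)" "m' \<in> monoms (c * d)" and eq: "\<phi> m = \<phi> m'"
    have mods: "lookup m i mod c = lookup m' i mod c" for i
      using eq by (auto simp: \<phi>_def fun_eq_iff)
    have "(q m)(i0 := q m i0 + (d - (\<Sum>i\<in>UNIV. q m i))) = (q m')(i0 := q m' i0 + (d - (\<Sum>i\<in>UNIV. q m' i)))"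
      using eq by (simp only: \<phi>_def prod.inject) (metis lookup_Abs_finite)
    then have "q m i = q m' i" if "i \<noteq> i0" for i using that by (metis fun_upd_other)
    then have other: "lookup m i = lookup m' i" if "i \<noteq> i0" for i
      using that mods[of i] unfolding q_def by (metis mult_div_mod_eq)
    have "lookup m i0 + (\<Sum>i\<in>UNIV - {i0}. lookup m i) = lookup m' i0 + (\<Sum>i\<in>UNIV - {i0}. lookup m' i)"
      using m by (simp add: monoms_def monom_deg_def sum.remove[of UNIV i0])
    moreover have "(\<Sum>i\<in>UNIV - {i0}. lookup m i) = (\<Sum>i\<in>UNIV - {i0}. lookup m' i)"
      using other by (intro sum.cong) auto
    ultimately have "lookup m i = lookup m' i" for i using other by (cases "i = i0") auto
    then show "m = m'" by (rule poly_mapping_eqI)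
  qed
  have fin: "finite {f. \<forall>i::'n. f i \<in> {..<c}}"
    using finite_set_of_finite_funs[of "UNIV :: 'n set" "{..<c}" 0] by simp
  have cf: "card {f. \<forall>i::'n. f i \<in> {..<c}} = c ^ card (UNIV :: 'n set)"
    using card_PiE[of "UNIV :: 'n set" "\<lambda>_. {..<c}"] by (simp add: PiE_UNIV_domain Pi_def)
  have "card (monoms (c * d) :: ('n \<Rightarrow>\<^sub>0 nat) set) = card (\<phi> ` monoms (c * d))"
    using inj by (simp add: card_image)
  also have "\<dots> \<le> card ({f. \<forall>i::'n. f i \<in> {..<c}} \<times> (monoms d :: ('n \<Rightarrow>\<^sub>0 nat) set))"
    by (rule card_mono[OF _ sub]) (simp add: fin[simplified] finite_monoms)
  finally show ?thesis by (simp only: card_cartesian_product cf)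
qed

section \<open>Polynomials with an additional parameter s\<close>

text \<open>The parameter is kept apart from the variables because homogeneity concerns the
  variables only: P is a polynomial in s whose coefficients are evaluated at x.\<close>

definition evp :: "(complex \<Rightarrow> 'b::comm_ring_1) \<Rightarrow> ('n::finite \<Rightarrow> 'b) \<Rightarrow> 'b \<Rightarrow> 'n cpoly poly \<Rightarrow> 'b" where
  "evp h x s P = poly (map_poly (ev h x) P) s"

lemma evp_pCons: "rhom h \<Longrightarrow> evp h x s (pCons p P) = ev h x p + s * evp h x s P"
  by (simp add: evp_def map_poly_pCons rhomD[OF rhom_ev])

lemma evp_0: "evp h x s 0 = 0"
  by (simp add: evp_def)

lemma evp_const: "rhom h \<Longrightarrow> evp h x s [:p:] = ev h x p"
  using evp_pCons[of h x s p 0] by (simp only: evp_0) simp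

lemma rhom_evp:
  assumes h: "rhom h" shows "rhom (evp h x s)"
proof -
  note e = rhom_ev[OF h, of x]
  have "map_poly (ev h x) (P + Q) = map_poly (ev h x) P + map_poly (ev h x) Q" for P Q
    by (intro poly_eqI) (simp add: coeff_map_poly rhomD[OF e])
  then show ?thesis
    by (simp add: hom_on_def[of UNIV "evp h x s"] evp_def map_poly_hom_mult[OF e] rhomD[OF e])
qed

lemma evp_hom:
  assumes g: "rhom g" and h: "rhom h"
  shows "g (evp h x s P) = evp (\<lambda>c. g (h c)) (\<lambda>i. g (x i)) (g s) P"
  by (induction P)
    (simp_all add: evp_0 rhomD[OF g] evp_pCons[OF h] evp_pCons[OF rhom_comp[OF g h]] ev_hom[OF g h])

lemma evp_monom: "rhom h \<Longrightarrow> evp h x s (monom p n) = s ^ n * ev h x p"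
  by (induction n) (simp_all add: monom_0 monom_Suc evp_0 evp_pCons rhomD[OF rhom_ev] mult.assoc)

lemma rhom_poly: "rhom (\<lambda>p. poly p s)"
  by (simp add: hom_on_def)

definition homogeneous_coeffs :: "nat \<Rightarrow> 'n::finite cpoly poly \<Rightarrow> bool" where
  "homogeneous_coeffs d P \<longleftrightarrow> (\<forall>t. homogeneous d (coeff P t))"

lemma homogeneous_coeffs_0: "homogeneous_coeffs d 0"
  by (simp add: homogeneous_coeffs_def homogeneous_0)

lemma homogeneous_coeffs_pCons:
  "homogeneous_coeffs d (pCons p P) \<longleftrightarrow> homogeneous d p \<and> homogeneous_coeffs d P"
  unfolding homogeneous_coeffs_def by (auto simp: coeff_pCons split: nat.splits)

lemma homogeneous_coeffs_const: "homogeneous d p \<Longrightarrow> homogeneous_coeffs d [:p:]"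
  by (simp add: homogeneous_coeffs_pCons homogeneous_coeffs_0)

lemma homogeneous_coeffs_add:
  "homogeneous_coeffs d P \<Longrightarrow> homogeneous_coeffs d Q \<Longrightarrow> homogeneous_coeffs d (P + Q)"
  by (simp add: homogeneous_coeffs_def homogeneous_add)

lemma homogeneous_coeffs_uminus: "homogeneous_coeffs d P \<Longrightarrow> homogeneous_coeffs d (- P)"
  by (simp add: homogeneous_coeffs_def homogeneous_uminus)

lemma homogeneous_coeffs_mult:
  "homogeneous_coeffs d P \<Longrightarrow> homogeneous_coeffs e Q \<Longrightarrow> homogeneous_coeffs (d + e) (P * Q)"
  unfolding homogeneous_coeffs_def coeff_mult by (auto intro: homogeneous_sum homogeneous_mult)

lemma homogeneous_coeffs_power: "homogeneous_coeffs d P \<Longrightarrow> homogeneous_coeffs (n * d) (P ^ n)"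
  by (induction n) (auto simp: one_pCons intro: homogeneous_coeffs_const homogeneous_1 homogeneous_coeffs_mult)

lemma homogeneous_coeffs_prod:
  "finite S \<Longrightarrow> (\<And>i. i \<in> S \<Longrightarrow> homogeneous_coeffs (d i) (g i)) \<Longrightarrow> homogeneous_coeffs (\<Sum>i\<in>S. d i) (prod g S)"
  by (induction S rule: finite_induct)
    (auto simp: one_pCons intro: homogeneous_coeffs_const homogeneous_1 homogeneous_coeffs_mult)

lemma homogeneous_coeffs_monom: "homogeneous d p \<Longrightarrow> homogeneous_coeffs d (monom p n)"
  by (simp add: homogeneous_coeffs_def homogeneous_0)

lemma homogeneous_coeffs_sum:
  "(\<And>i. i \<in> S \<Longrightarrow> homogeneous_coeffs d (g i)) \<Longrightarrow> homogeneous_coeffs d (sum g S)"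
  by (induction S rule: infinite_finite_induct) (auto intro: homogeneous_coeffs_0 homogeneous_coeffs_add)

abbreviation cst :: "complex \<Rightarrow> 'n cpoly poly" where
  "cst \<equiv> \<lambda>c. [:pconst c:]"

abbreviation svar :: "'n::finite cpoly poly" where
  "svar \<equiv> [:0, 1:]"

lemma rhom_cst: "rhom cst"
  by (rule rhom_const_poly[OF rhom_pconst])

text \<open>
  Any quotient \<open>A / B\<close> of forms of equal degree is algebraic over the field generated by \<open>s\<close> and the
  ratios of the \<open>H i\<close>: the monomials in \<open>s\<close>, \<open>H\<close> and \<open>A / B\<close> of degree at most \<open>d\<close> in each group
  outnumber, for large \<open>d\<close>, the monomials occurring in them.
\<close>

lemma algebraic_relation:
  fixes H :: "'n::finite \<Rightarrow> 'n cpoly poly" and A B :: "'n cpoly"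
  assumes H: "\<And>i. degree (H i) \<le> 1" "\<And>i. homogeneous_coeffs r (H i)" "r \<ge> 1"
    and AB: "homogeneous c A" "homogeneous c B"
  shows "\<exists>M d P. (\<forall>k\<le>M. homogeneous_coeffs d (P k)) \<and> (\<exists>k\<le>M. P k \<noteq> 0) \<and>
    (\<Sum>k\<le>M. evp cst H svar (P k) * [:A ^ k * B ^ (M - k):]) = 0"
proof -
  \<comment> \<open>\<open>N\<close> bounds the ratio of the numbers of monomials of degrees (r + c)
    d and d, for every d. The choice d = 2 N makes (2 d + 1) N smaller than (d + 1)^2.\<close>
  define N where "N = (r + c) ^ card (UNIV :: 'n set)"
  define d where "d = 2 * N"
  \<comment> \<open>Unknowns are indexed by an exponent of A / B, an exponent of s and a monomial in
    the H i. Equations are indexed by exponents of s up to 2 d, since each H i is at most linear in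
    s, and by monomials of degree (r + c) d.\<close>
  define I where "I = {..d} \<times> {..d} \<times> (monoms d :: ('n \<Rightarrow>\<^sub>0 nat) set)"
  define J where "J = {..2 * d} \<times> (monoms ((r + c) * d) :: ('n \<Rightarrow>\<^sub>0 nat) set)"
  define v where "v = (\<lambda>(k, t, \<mu>). svar ^ t * (\<Prod>i\<in>UNIV. H i ^ lookup \<mu> i) * [:A ^ k * B ^ (d - k):])"
  have fin: "finite I" "finite J" by (simp_all add: I_def J_def finite_monoms)
  have card: "card J < card I"
  proof -
    let ?h = "card (monoms d :: ('n \<Rightarrow>\<^sub>0 nat) set)"
    have "card J \<le> (2 * d + 1) * (N * ?h)"
      using card_monoms_mult_le[of "r + c" d, where 'n = 'n] H(3)
      by (simp add: J_def card_cartesian_product N_def del: mult_Suc)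
    also have "\<dots> = (2 * d + 1) * N * ?h" by (simp only: mult.assoc)
    also have "\<dots> < (d + 1) * (d + 1) * ?h"
      using card_monoms_pos[of d, where 'n = 'n] by (intro mult_strict_right_mono) (simp_all add: d_def)
    also have "\<dots> = card I"
      by (simp only: I_def card_cartesian_product card_atMost mult.assoc Suc_eq_plus1)
    finally show ?thesis .
  qed
  obtain x where x0: "\<exists>i\<in>I. x i \<noteq> (0::complex)"
    and x: "\<And>j. j \<in> J \<Longrightarrow> (\<Sum>i\<in>I. lookup (coeff (v i) (fst j)) (snd j) * x i) = 0"
    using underdetermined_system[OF field_subset_UNIV fin(2,1) card, of "\<lambda>j i. lookup (coeff (v i) (fst j)) (snd j)"]
    by auto
  have v_hom: "homogeneous_coeffs ((r + c) * d) (v i)" and v_deg: "degree (v i) \<le> 2 * d" if iI: "i \<in> I" for i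
  proof -
    obtain k t \<mu> where i: "i = (k, t, \<mu>)" and k: "k \<le> d" and t: "t \<le> d" and \<mu>: "monom_deg \<mu> = d"
      using iI by (cases i) (auto simp: I_def monoms_def)
    have "homogeneous_coeffs (\<Sum>i\<in>UNIV. lookup \<mu> i * r) (\<Prod>i\<in>UNIV. H i ^ lookup \<mu> i)"
      using H by (intro homogeneous_coeffs_prod homogeneous_coeffs_power) auto
    then have 1: "homogeneous_coeffs (d * r) (\<Prod>i\<in>UNIV. H i ^ lookup \<mu> i)"
      using \<mu> by (simp add: monom_deg_def flip: sum_distrib_right)
    have 2: "homogeneous_coeffs (t * 0) (svar ^ t :: 'n cpoly poly)"
      by (rule homogeneous_coeffs_power) (simp add: homogeneous_coeffs_pCons homogeneous_0 homogeneous_1 homogeneous_coeffs_0)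
    have "homogeneous (k * c + (d - k) * c) (A ^ k * B ^ (d - k))"
      using AB by (intro homogeneous_mult homogeneous_power)
    then have 3: "homogeneous_coeffs (d * c) [:A ^ k * B ^ (d - k):]"
      using k by (intro homogeneous_coeffs_const) (simp flip: add_mult_distrib)
    have "homogeneous_coeffs (t * 0 + d * r + d * c) (v i)"
      unfolding i v_def by (simp only: prod.case) (intro homogeneous_coeffs_mult 1 2 3)
    then show "homogeneous_coeffs ((r + c) * d) (v i)" by (simp add: algebra_simps)
    have "degree (\<Prod>i\<in>UNIV. H i ^ lookup \<mu> i) \<le> (\<Sum>i\<in>UNIV. degree (H i ^ lookup \<mu> i))"
      by (rule degree_prod_sum_le[OF finite, unfolded o_def])
    also have "\<dots> \<le> (\<Sum>i\<in>UNIV. lookup \<mu> i)"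
    proof (rule sum_mono)
      fix i show "degree (H i ^ lookup \<mu> i) \<le> lookup \<mu> i"
        using order.trans[OF degree_power_le mult_le_mono1[OF H(1)]] by (simp only: mult_1)
    qed
    finally have "degree (\<Prod>i\<in>UNIV. H i ^ lookup \<mu> i) \<le> d" using \<mu> by (simp add: monom_deg_def)
    moreover have "degree (svar ^ t :: 'n cpoly poly) \<le> t" using degree_power_le[of "svar :: 'n cpoly poly" t] by simp
    ultimately have "degree (svar ^ t * (\<Prod>i\<in>UNIV. H i ^ lookup \<mu> i)) \<le> t + d"
      using degree_mult_le[of "svar ^ t" "\<Prod>i\<in>UNIV. H i ^ lookup \<mu> i"] by linarith
    then show "degree (v i) \<le> 2 * d"
      using degree_mult_le[of "svar ^ t * (\<Prod>i\<in>UNIV. H i ^ lookup \<mu> i)" "[:A ^ k * B ^ (d - k):]"] t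
      unfolding i v_def by simp
  qed
  have rel: "(\<Sum>i\<in>I. cst (x i) * v i) = 0"
  proof (intro poly_eqI poly_mapping_eqI)
    fix t \<nu>
    have l: "lookup (coeff (cst (x i) * v i) t) \<nu> = lookup (coeff (v i) t) \<nu> * x i" for i
    proof -
      have "lookup (pconst c * p) \<nu> = c * lookup p \<nu>" for c and p :: "'n cpoly"
        by (induction p rule: cpoly_induct)
          (auto simp: pconst_def mult_single lookup_single when_def lookup_add algebra_simps)
      then show ?thesis by simp
    qed
    show "lookup (coeff (\<Sum>i\<in>I. cst (x i) * v i) t) \<nu> = lookup (coeff 0 t) \<nu>"
    proof (cases "(t, \<nu>) \<in> J")
      case True
      then show ?thesis using x[OF True] by (simp only: coeff_sum lookup_sum l fst_conv snd_conv) simp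
    next
      case False
      have "lookup (coeff (v i) t) \<nu> = 0" if "i \<in> I" for i
        using v_hom[OF that] v_deg[OF that] False
        by (cases "t \<le> 2 * d") (auto simp: J_def monoms_def homogeneous_coeffs_def homogeneous_iff coeff_eq_0
            intro: not_in_keys_iff_lookup_eq_zero[THEN iffD1])
      then show ?thesis by (simp only: coeff_sum lookup_sum l) simp
    qed
  qed
  define P where "P = (\<lambda>k. \<Sum>t\<le>d. monom (\<Sum>\<mu>\<in>monoms d. single \<mu> (x (k, t, \<mu>))) t)"
  have cP: "lookup (coeff (P k) t) \<mu> = x (k, t, \<mu>)" if "t \<le> d" "\<mu> \<in> monoms d" for k t \<mu>
    using that by (simp add: P_def coeff_sum lookup_sum lookup_single when_def finite_monoms)
  have "\<exists>k\<le>d. P k \<noteq> 0"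
  proof -
    obtain k t \<mu> where "k \<le> d" "t \<le> d" "\<mu> \<in> monoms d" "x (k, t, \<mu>) \<noteq> 0" using x0 by (auto simp: I_def)
    with cP[of t \<mu> k] show ?thesis by (intro exI[of _ k]) auto
  qed
  moreover have "homogeneous_coeffs d (P k)" for k
    unfolding P_def
    by (intro homogeneous_coeffs_sum homogeneous_coeffs_monom homogeneous_sum homogeneous_single) (simp add: monoms_def)
  moreover have "(\<Sum>k\<le>d. evp cst H svar (P k) * [:A ^ k * B ^ (d - k):]) = (\<Sum>i\<in>I. cst (x i) * v i)"
  proof -
    have "evp cst H svar (P k) = (\<Sum>t\<le>d. \<Sum>\<mu>\<in>monoms d. cst (x (k, t, \<mu>)) * (svar ^ t * (\<Prod>i\<in>UNIV. H i ^ lookup \<mu> i)))" for k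
      unfolding P_def rhomD(7)[OF rhom_evp[OF rhom_cst]] evp_monom[OF rhom_cst] rhomD(7)[OF rhom_ev[OF rhom_cst]]
        ev_single[OF rhom_cst] sum_distrib_left
      by (intro sum.cong refl) (simp only: ac_simps)
    then show ?thesis
      unfolding I_def v_def
      by (simp only: sum_distrib_right mult.assoc sum.cartesian_product) (simp only: case_prod_unfold prod.collapse mult.assoc)
  qed
  ultimately show ?thesis using rel by (intro exI[of _ d] exI[of _ d] exI[of _ P]) simp
qed

text \<open>Independence over the pulled back function field, with denominators cleared. The
  conclusion is P i = 0 and not merely P i (F) = 0, so for m > 0 it also contains the absence of
  forms vanishing on F.\<close>

definition indep_forms :: "('n::finite \<Rightarrow> 'n cpoly) \<Rightarrow> nat \<Rightarrow> (nat \<Rightarrow> 'n cpoly) \<Rightarrow> bool" where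
  "indep_forms F m A \<longleftrightarrow> (\<forall>d P. (\<forall>i<m. homogeneous d (P i)) \<and> (\<Sum>i<m. psubst (P i) F * A i) = 0 \<longrightarrow> (\<forall>i<m. P i = 0))"

text \<open>Divide a relation by the largest possible power of \<open>s\<close> and set \<open>s = 0\<close>.\<close>

lemma indep_forms_deform:
  fixes H :: "'n::{finite,linorder} \<Rightarrow> 'n cpoly poly"
  assumes F: "indep_forms (\<lambda>i. poly (H i) 0) m A"
    and R: "\<And>i. i < m \<Longrightarrow> homogeneous_coeffs d (R i)"
    and rel: "(\<Sum>i<m. evp cst H svar (R i) * [:A i:]) = 0"
    and i: "i < m"
  shows "R i = 0"
proof -
  have "\<forall>i<m. R i = 0" if "\<And>i t. i < m \<Longrightarrow> t \<ge> n \<Longrightarrow> coeff (R i) t = 0"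
    "\<And>i. i < m \<Longrightarrow> homogeneous_coeffs d (R i)" "(\<Sum>i<m. evp cst H svar (R i) * [:A i:]) = 0" for n R
    using that
  proof (induction n arbitrary: R)
    case 0
    then show ?case by (auto intro!: poly_eqI)
  next
    case (Suc n)
    define Z where "Z = (\<lambda>i. coeff (R i) 0)"
    have ev0: "poly (evp cst H svar (R i)) 0 = psubst (Z i) (\<lambda>i. poly (H i) 0)" for i
    proof -
      have "poly (evp cst H svar (R i)) 0 = evp pconst (\<lambda>i. poly (H i) 0) 0 (R i)"
        using evp_hom[OF rhom_poly[of 0] rhom_cst, of H svar "R i"] by simp
      also have "\<dots> = psubst (Z i) (\<lambda>i. poly (H i) 0)"
        by (cases "R i") (simp add: evp_pCons[OF rhom_pconst] Z_def psubst_eq_ev)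
      finally show ?thesis .
    qed
    from arg_cong[OF Suc.prems(3), of "\<lambda>p. poly p 0"]
    have "(\<Sum>i<m. psubst (Z i) (\<lambda>i. poly (H i) 0) * A i) = 0" by (simp add: poly_sum ev0 mult.commute)
    moreover have "homogeneous d (Z i)" if "i < m" for i
      using Suc.prems(2)[OF that] by (simp add: Z_def homogeneous_coeffs_def)
    ultimately have Z: "Z i = 0" if "i < m" for i
      using F that unfolding indep_forms_def by blast
    define R' where "R' = (\<lambda>i. poly_shift 1 (R i))"
    have R': "R i = pCons 0 (R' i)" if "i < m" for i
      using Z[OF that] unfolding Z_def R'_def
      by (intro poly_eqI) (auto simp: coeff_pCons coeff_poly_shift split: nat.split)
    have "(\<Sum>i<m. evp cst H svar (R i) * [:A i:]) = svar * (\<Sum>i<m. evp cst H svar (R' i) * [:A i:])"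
      unfolding sum_distrib_left
      by (intro sum.cong) (auto simp: R' evp_pCons[OF rhom_cst] rhomD[OF rhom_ev[OF rhom_cst]])
    then have "svar * (\<Sum>i<m. evp cst H svar (R' i) * [:A i:]) = 0" using Suc.prems(3) by simp
    then have "(\<Sum>i<m. evp cst H svar (R' i) * [:A i:]) = 0" by simp
    moreover have "coeff (R' i) t = 0" if "i < m" "t \<ge> n" for i t
      using Suc.prems(1)[OF that(1), of "Suc t"] that by (simp add: R'_def coeff_poly_shift)
    moreover have "homogeneous_coeffs d (R' i)" if "i < m" for i
      using Suc.prems(2)[OF that] by (simp add: R'_def homogeneous_coeffs_def coeff_poly_shift)
    ultimately have "\<forall>i<m. R' i = 0" by (intro Suc.IH) auto
    then show ?case using R' by simp
  qed
  note * = this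
  define n where "n = Suc (\<Sum>i<m. degree (R i))"
  have "coeff (R i) t = 0" if "i < m" "t \<ge> n" for i t
  proof -
    have "degree (R i) \<le> (\<Sum>i<m. degree (R i))" using that by (intro member_le_sum) auto
    then show ?thesis using that by (intro coeff_eq_0) (simp add: n_def)
  qed
  from *[OF this R rel] i show ?thesis by simp
qed

section \<open>Weights that separate points and monomials\<close>

lemma exponent_weights: "\<exists>e :: 'n::finite \<Rightarrow> nat. inj e"
  using finite_imp_inj_to_nat_seg[OF finite[of "UNIV :: 'n set"]] by blast

text \<open>Points of the moment curve: for w i = n ^ e i the pairing with v is the value at n of a
  nonzero polynomial, and some natural number is a root of none of these finitely many
  polynomials.\<close>

lemma separating_moment_vector:
  fixes V :: "('n::finite \<Rightarrow> 'w::field_char_0) set"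
  assumes V: "finite V" "(\<lambda>_. 0) \<notin> V"
  shows "\<exists>w :: 'n \<Rightarrow> nat. \<forall>v\<in>V. (\<Sum>i\<in>UNIV. v i * of_nat (w i)) \<noteq> 0"
proof -
  obtain e :: "'n \<Rightarrow> nat" where e: "inj e" using exponent_weights by blast
  define Q where "Q = (\<lambda>v :: 'n \<Rightarrow> 'w. \<Sum>i\<in>UNIV. monom (v i) (e i))"
  have "Q v \<noteq> 0" if "v \<in> V" for v
  proof -
    have "v \<noteq> (\<lambda>_. 0)" using that V by auto
    then obtain i where i: "v i \<noteq> 0" by (auto simp: fun_eq_iff)
    have "coeff (Q v) (e i) = (\<Sum>j\<in>UNIV. if i = j then v j else 0)"
      using e by (auto simp: Q_def coeff_sum inj_eq intro!: sum.cong)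
    then show ?thesis using i by auto
  qed
  then have "(\<Prod>v\<in>V. Q v) \<noteq> 0" using V by simp
  then have "finite {z. poly (\<Prod>v\<in>V. Q v) z = 0}" by (rule poly_roots_finite)
  then have "finite (of_nat -` {z. poly (\<Prod>v\<in>V. Q v) z = 0} :: nat set)"
    by (rule finite_vimageI) (simp add: inj_of_nat)
  then have "(of_nat -` {z. poly (\<Prod>v\<in>V. Q v) z = 0} :: nat set) \<noteq> UNIV"
    using infinite_UNIV_nat by metis
  then obtain n :: nat where n: "poly (\<Prod>v\<in>V. Q v) (of_nat n) \<noteq> 0" by auto
  show ?thesis
  proof (intro exI[of _ "\<lambda>i. n ^ e i"] ballI)
    fix v assume "v \<in> V"
    then have "poly (Q v) (of_nat n) \<noteq> 0" using n V by (simp add: poly_prod)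
    then show "(\<Sum>i\<in>UNIV. v i * of_nat (n ^ e i)) \<noteq> 0" by (simp add: Q_def poly_sum poly_monom)
  qed
qed

text \<open>Substituting x i = t ^ w i with weights that separate the monomials of p leaves a
  nonzero polynomial in t.\<close>

lemma peval_nonzero:
  fixes p :: "'n::finite cpoly"
  assumes "p \<noteq> 0"
  shows "\<exists>x. peval p x \<noteq> 0"
proof -
  define V where "V = (\<lambda>(m, m') i. of_nat (lookup m i) - of_nat (lookup m' i) :: rat) `
    {(m, m'). m \<in> keys p \<and> m' \<in> keys p \<and> m \<noteq> m'}"
  have "{(m, m'). m \<in> keys p \<and> m' \<in> keys p \<and> m \<noteq> m'} \<subseteq> keys p \<times> keys p" by auto
  then have "finite V" unfolding V_def by (intro finite_imageI) (rule finite_subset, auto)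
  moreover have "(\<lambda>_. 0) \<notin> V"
  proof
    assume "(\<lambda>_. 0) \<in> V"
    then show False by (auto simp: V_def fun_eq_iff poly_mapping_eq_iff)
  qed
  ultimately obtain w :: "'n \<Rightarrow> nat" where w: "\<And>v. v \<in> V \<Longrightarrow> (\<Sum>i\<in>UNIV. v i * of_nat (w i)) \<noteq> 0"
    using separating_moment_vector[of V] by meson
  define W where "W = (\<lambda>m :: 'n \<Rightarrow>\<^sub>0 nat. \<Sum>i\<in>UNIV. lookup m i * w i)"
  have inj: "inj_on W (keys p)"
  proof (rule inj_onI, rule ccontr)
    fix m m' assume m: "m \<in> keys p" "m' \<in> keys p" "W m = W m'" "m \<noteq> m'"
    then have "(\<lambda>i. of_nat (lookup m i) - of_nat (lookup m' i)) \<in> V" by (auto simp: V_def)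
    from w[OF this] have "of_nat (W m) - of_nat (W m') \<noteq> (0 :: rat)"
      by (simp add: W_def algebra_simps sum_subtractf)
    then show False using m by simp
  qed
  define Q where "Q = (\<Sum>m\<in>keys p. monom (lookup p m) (W m))"
  obtain m where m: "m \<in> keys p" using assms by (metis keys_eq_empty all_not_in_conv)
  have "coeff Q (W m) = (\<Sum>m'\<in>keys p. if m' = m then lookup p m' else 0)"
    using inj m by (auto simp: Q_def coeff_sum inj_on_eq_iff intro!: sum.cong)
  then have "coeff Q (W m) \<noteq> 0" using m by (simp add: in_keys_iff)
  then have "Q \<noteq> 0" by auto
  then obtain t where t: "poly Q t \<noteq> 0" using poly_all_0_iff_0 by blast
  have "peval p (\<lambda>i. t ^ w i) = poly Q t"
    by (simp add: peval_def Q_def poly_sum poly_monom W_def power_sum power_mult[symmetric] mult.commute)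
  then show ?thesis using t by metis
qed

section \<open>Solutions of the logarithmic gradient equations\<close>

text \<open>\<open>algebraic_relation\<close> is applied to forms that are constant in s, and one
  power of s occurring in a coefficient is read off.\<close>

lemma algebraic_relation_forms:
  fixes F :: "'n::finite \<Rightarrow> 'n cpoly" and A B :: "'n cpoly"
  assumes F: "\<And>i. homogeneous r (F i)" "r \<ge> 1"
    and AB: "homogeneous c A" "homogeneous c B"
  shows "\<exists>M d p. (\<forall>k\<le>M. homogeneous d (p k)) \<and> (\<exists>k\<le>M. p k \<noteq> 0) \<and>
    (\<Sum>k\<le>M. psubst (p k) F * (A ^ k * B ^ (M - k))) = 0"
proof -
  define H where "H = (\<lambda>i. [:F i:])"
  have H: "degree (H i) \<le> 1" "homogeneous_coeffs r (H i)" for i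
    using F by (auto simp: H_def homogeneous_coeffs_const)
  obtain M d P where *: "(\<forall>k\<le>M. homogeneous_coeffs d (P k)) \<and>
      (\<exists>k\<le>M. P k \<noteq> 0) \<and> (\<Sum>k\<le>M. evp cst H svar (P k) * [:A ^ k * B ^ (M - k):]) = 0"
    using algebraic_relation[of H, OF H F(2) AB]
    by (elim exE) (rule that)
  note P = conjunct1[OF *] conjunct1[OF conjunct2[OF *]] and rel = conjunct2[OF conjunct2[OF *]]
  have "coeff (evp cst H svar Q) t = psubst (coeff Q t) F" for Q t
  proof (induction Q arbitrary: t)
    case 0
    then show ?case by (simp add: evp_0 psubst_eq_ev rhomD[OF rhom_ev[OF rhom_pconst]])
  next
    case (pCons q Q)
    have "ev cst H q = [:psubst q F:]"
      using ev_hom[OF rhom_const_poly[OF rhom_id] rhom_pconst, of F q] by (simp add: psubst_eq_ev H_def)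
    then show ?case using pCons by (simp add: evp_pCons[OF rhom_cst] coeff_pCons split: nat.split)
  qed
  then have c: "coeff (evp cst H svar (P k) * [:A ^ k * B ^ (M - k):]) t = psubst (coeff (P k) t) F * (A ^ k * B ^ (M - k))" for k t
    by (simp add: mult.commute)
  obtain k0 t where "k0 \<le> M" "coeff (P k0) t \<noteq> 0" using P(2) by (metis leading_coeff_0_iff)
  moreover have "(\<Sum>k\<le>M. psubst (coeff (P k) t) F * (A ^ k * B ^ (M - k))) = 0"
    using arg_cong[OF rel, of "\<lambda>p. coeff p t"] by (simp only: coeff_sum c coeff_0)
  ultimately show ?thesis using P(1) unfolding homogeneous_coeffs_def
    by (intro exI[of _ M] exI[of _ d] exI[of _ "\<lambda>k. coeff (P k) t"]) auto
qed

lemma ev_cong_dvd: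
  assumes h: "rhom h" and x: "\<And>i. t dvd x' i - x i"
  shows "t dvd ev h x' p - ev h x p"
proof (induction p rule: cpoly_induct)
  case (single m c)
  have mult: "t dvd a' * b' - a * b" if "t dvd a' - a" "t dvd b' - b" for a a' b b' :: 'a
  proof -
    have "a' * b' - a * b = a' * (b' - b) + (a' - a) * b" by (simp add: algebra_simps)
    then show ?thesis using that by simp
  qed
  have pow: "t dvd x' i ^ n - x i ^ n" for i n
    by (induction n) (auto intro: mult x)
  have "t dvd (\<Prod>i\<in>S. x' i ^ lookup m i) - (\<Prod>i\<in>S. x i ^ lookup m i)" for S
    by (induction S rule: infinite_finite_induct) (auto intro: mult pow)
  then show ?case by (simp add: ev_single[OF h] flip: right_diff_distrib)
next
  case (add p q)
  then show ?case by (simp add: ev_add[OF h] add_diff_add)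
qed

locale log_family =
  fixes l :: nat and f :: "nat \<Rightarrow> 'n::{finite,linorder} cpoly" and e :: "nat \<Rightarrow> nat"
  assumes f_nonzero: "j < l \<Longrightarrow> f j \<noteq> 0" and f_homogeneous: "j < l \<Longrightarrow> homogeneous (e j) (f j)"
begin

definition fr :: "'n cpoly" where
  "fr = (\<Prod>j<l. f j)"

definition r :: nat where
  "r = (\<Sum>j<l. e j)"

text \<open>\<open>G a\<close> is \<open>fr\<close> times the toric logarithmic gradient of the formal product of the \<open>f j\<close> to the powers \<open>a j\<close>.\<close>

definition G :: "(nat \<Rightarrow> complex) \<Rightarrow> 'n \<Rightarrow> 'n cpoly" where
  "G a i = (\<Sum>j<l. pconst (a j) * (theta i (f j) * (\<Prod>m\<in>{..<l} - {j}. f m)))"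

lemma fr_nonzero: "fr \<noteq> 0"
  using f_nonzero by (simp add: fr_def)

lemma fr_homogeneous: "homogeneous r fr"
  unfolding fr_def r_def by (rule homogeneous_prod) (auto simp: f_homogeneous)

lemma fr_remove: "j < l \<Longrightarrow> fr = f j * (\<Prod>m\<in>{..<l} - {j}. f m)"
  unfolding fr_def by (rule prod.remove) auto

lemma G_homogeneous: "homogeneous r (G a i)"
  unfolding G_def
proof (rule homogeneous_sum)
  fix j assume "j \<in> {..<l}"
  then have "homogeneous (e j + (\<Sum>m\<in>{..<l} - {j}. e m)) (theta i (f j) * (\<Prod>m\<in>{..<l} - {j}. f m))"
    by (intro homogeneous_mult homogeneous_theta homogeneous_prod) (auto simp: f_homogeneous)
  moreover have "e j + (\<Sum>m\<in>{..<l} - {j}. e m) = r"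
    unfolding r_def using \<open>j \<in> {..<l}\<close> by (simp add: sum.remove[of "{..<l}" j])
  ultimately show "homogeneous r (pconst (a j) * (theta i (f j) * (\<Prod>m\<in>{..<l} - {j}. f m)))"
    using homogeneous_mult[OF homogeneous_pconst] by fastforce
qed

text \<open>By Euler's formula the coordinate sum sees the weights only through their total. Weights
  of one nonzero total therefore pull this sum back to the same multiple of \<open>fr\<close>, which
  later puts the gradient over \<open>fr\<close> inside the pulled back field.\<close>

lemma sum_G: "(\<Sum>i\<in>UNIV. G a i) = pconst (\<Sum>j<l. a j * of_nat (e j)) * fr"
proof -
  have "(\<Sum>i\<in>UNIV. G a i) = (\<Sum>j<l. pconst (a j) * ((\<Sum>i\<in>UNIV. theta i (f j)) * (\<Prod>m\<in>{..<l} - {j}. f m)))"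
    unfolding G_def by (subst sum.swap) (simp add: sum_distrib_left sum_distrib_right)
  also have "\<dots> = (\<Sum>j<l. pconst (a j * of_nat (e j)) * fr)"
  proof (intro sum.cong refl)
    fix j assume "j \<in> {..<l}"
    then have "(\<Sum>i\<in>UNIV. theta i (f j)) = of_nat (e j) * f j" by (simp add: euler_homogeneous f_homogeneous)
    then show "pconst (a j) * ((\<Sum>i\<in>UNIV. theta i (f j)) * (\<Prod>m\<in>{..<l} - {j}. f m)) = pconst (a j * of_nat (e j)) * fr"
      using \<open>j \<in> {..<l}\<close> by (simp add: fr_remove rhomD[OF rhom_pconst] pconst_of_nat algebra_simps)
  qed
  finally show ?thesis by (simp add: rhomD[OF rhom_pconst] sum_distrib_right)
qed

lemma ev_G:
  fixes x :: "'n \<Rightarrow> 'b::field"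
  assumes h: "rhom h" and x: "\<And>j. j < l \<Longrightarrow> ev h x (f j) \<noteq> 0"
  shows "ev h x (G a i) = ev h x fr * (\<Sum>j<l. h (a j) * (ev h x (theta i (f j)) / ev h x (f j)))"
proof -
  have "ev h x (theta i (f j) * (\<Prod>m\<in>{..<l} - {j}. f m)) = ev h x fr * (ev h x (theta i (f j)) / ev h x (f j))"
    if "j < l" for j
    using x[OF that] by (simp add: fr_remove[OF that] ev_mult[OF h])
  then show ?thesis
    by (simp add: G_def rhomD[OF rhom_ev[OF h]] ev_pconst[OF h] sum_distrib_left mult.left_commute)
qed

end

text \<open>u is a generic point over the complex numbers, which are embedded by h: no nonzero form
  vanishes at it. Statements about a general fibre become statements about the fibre over this one
  point.\<close>

locale generic_value = log_family l f e
  for l and f :: "nat \<Rightarrow> 'n::{finite,linorder} cpoly" and e +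
  fixes h :: "complex \<Rightarrow> 'w::{alg_closed_field,field_char_0}" and u :: "'n \<Rightarrow> 'w" and i0 :: 'n
  assumes h: "rhom h"
    and generic: "homogeneous d P \<Longrightarrow> ev h u P = 0 \<Longrightarrow> P = 0"
    and r_pos: "r \<ge> 1"
begin

text \<open>The equation \<open>G a / fr = u\<close> without denominators; \<open>x i0 = 1\<close> normalizes the projective point.\<close>

definition solution :: "(nat \<Rightarrow> complex) \<Rightarrow> ('n \<Rightarrow> 'w) \<Rightarrow> bool" where
  "solution a x \<longleftrightarrow> x i0 = 1 \<and> ev h x fr \<noteq> 0 \<and> (\<forall>i. ev h x (G a i) = u i * ev h x fr)"

lemma ev_psubst_G:
  assumes "solution a x" "homogeneous d P"
  shows "ev h x (psubst P (G a)) = ev h x fr ^ d * ev h u P"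
proof -
  have "ev h x (psubst P (G a)) = ev h (\<lambda>i. ev h x fr * u i) P"
    using assms(1) by (simp add: ev_psubst[OF h] solution_def mult.commute)
  then show ?thesis by (simp add: ev_scale[OF h assms(2)])
qed

text \<open>Vandermonde: a linear form L takes distinct values at the solutions, and the forms L^i
  x_i0^(m - i) take the values of the powers of L there. A relation becomes a polynomial of degree
  less than m with m roots, so its coefficients P i (u) vanish and P i = 0 by genericity.\<close>

lemma solutions_imp_indep_forms:
  assumes S: "finite S" "\<And>x. x \<in> S \<Longrightarrow> solution a x"
  shows "\<exists>A c. (\<forall>i<card S. homogeneous c (A i)) \<and> indep_forms (G a) (card S) A"
proof -
  define m where "m = card S"
  define V where "V = (\<lambda>(x, y) i. x i - y i :: 'w) ` {(x, y). x \<in> S \<and> y \<in> S \<and> x \<noteq> y}"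
  have "{(x, y). x \<in> S \<and> y \<in> S \<and> x \<noteq> y} \<subseteq> S \<times> S" by auto
  then have "finite V" unfolding V_def using S(1) by (intro finite_imageI) (rule finite_subset, auto)
  moreover have "(\<lambda>_. 0) \<notin> V" by (auto simp: V_def fun_eq_iff)
  ultimately obtain w :: "'n \<Rightarrow> nat" where w: "\<And>v. v \<in> V \<Longrightarrow> (\<Sum>i\<in>UNIV. v i * of_nat (w i)) \<noteq> 0"
    using separating_moment_vector[of V] by meson
  define L where "L = (\<Sum>i\<in>UNIV. pconst (of_nat (w i)) * pvar i :: 'n cpoly)"
  have evL: "ev h x L = (\<Sum>i\<in>UNIV. x i * of_nat (w i))" for x
    by (simp add: L_def rhomD[OF rhom_ev[OF h]] ev_pconst[OF h] ev_pvar[OF h] rhom_of_nat[OF h] mult.commute)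
  have inj: "inj_on (\<lambda>x. ev h x L) S"
  proof (rule inj_onI, rule ccontr)
    fix x y assume xy: "x \<in> S" "y \<in> S" "ev h x L = ev h y L" "x \<noteq> y"
    then have "(\<lambda>i. x i - y i) \<in> V" by (auto simp: V_def)
    from w[OF this] show False using xy by (simp add: evL algebra_simps sum_subtractf)
  qed
  define A where "A = (\<lambda>i. L ^ i * pvar i0 ^ (m - i))"
  have "homogeneous (0 + 1) L" unfolding L_def
    by (intro homogeneous_sum homogeneous_mult homogeneous_pconst homogeneous_pvar)
  then have A_hom: "homogeneous m (A i)" if "i < m" for i
    using homogeneous_mult[OF homogeneous_power[of 1 L i] homogeneous_power[OF homogeneous_pvar[of i0], of "m - i"]] that
    by (simp add: A_def)
  have "indep_forms (G a) m A"
    unfolding indep_forms_def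
  proof (intro allI impI, elim conjE)
    fix d P i assume P: "\<forall>i<m. homogeneous d (P i)" and rel: "(\<Sum>i<m. psubst (P i) (G a) * A i) = 0" and i: "i < m"
    define Q where "Q = (\<Sum>i<m. monom (ev h u (P i)) i)"
    have root: "poly Q (ev h x L) = 0" if "x \<in> S" for x
    proof -
      have sx: "solution a x" by (rule S(2)[OF that])
      have "0 = ev h x (\<Sum>i<m. psubst (P i) (G a) * A i)" by (simp add: rel rhomD[OF rhom_ev[OF h]])
      also have "\<dots> = (\<Sum>i<m. ev h x fr ^ d * ev h u (P i) * ev h x L ^ i)"
        unfolding rhomD(7)[OF rhom_ev[OF h]]
      proof (intro sum.cong refl)
        fix i assume "i \<in> {..<m}"
        then have "homogeneous d (P i)" using P by simp
        moreover have "x i0 = 1" using sx by (simp add: solution_def)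
        ultimately show "ev h x (psubst (P i) (G a) * A i) = ev h x fr ^ d * ev h u (P i) * ev h x L ^ i"
          by (simp add: rhomD[OF rhom_ev[OF h]] ev_psubst_G[OF sx] A_def ev_pvar[OF h])
      qed
      also have "\<dots> = ev h x fr ^ d * poly Q (ev h x L)"
        by (simp add: Q_def poly_sum poly_monom sum_distrib_left mult.assoc)
      finally show ?thesis using sx by (simp add: solution_def)
    qed
    have "Q = 0"
    proof (rule ccontr)
      assume "Q \<noteq> 0"
      have "m = card ((\<lambda>x. ev h x L) ` S)" using inj by (simp add: card_image m_def)
      also have "\<dots> \<le> card {z. poly Q z = 0}"
        using root by (intro card_mono poly_roots_finite[OF \<open>Q \<noteq> 0\<close>]) auto
      also have "\<dots> \<le> degree Q" by (rule card_poly_roots_bound[OF \<open>Q \<noteq> 0\<close>])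
      also have "\<dots> \<le> m - 1" unfolding Q_def
        by (rule degree_sum_le) (auto intro: order.trans[OF degree_monom_le])
      finally show False using i by simp
    qed
    have "coeff Q i = ev h u (P i)" using i by (simp add: Q_def coeff_sum)
    then have "ev h u (P i) = 0" using \<open>Q = 0\<close> by simp
    then show "P i = 0" using generic[of d "P i"] P i by blast
  qed
  then show ?thesis using A_hom unfolding m_def by blast
qed

lemma solution_imp_dominant:
  assumes "solution a x" "homogeneous d P" "psubst P (G a) = 0"
  shows "P = 0"
proof -
  have "ev h x fr ^ d * ev h u P = 0"
    using ev_psubst_G[OF assms(1,2)] assms(3) by (simp add: rhomD[OF rhom_ev[OF h]])
  then show ?thesis using assms(1) generic[OF assms(2)] by (simp add: solution_def)
qed

text \<open>Points over a generic point are generic: the quotient of Q by a power of the normalizing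
  variable is algebraic over the ratios of \<open>G a\<close>. After cancelling the lowest power of
  Q in the relation, only the lowest coefficient survives at a zero of Q, and it would vanish at
  u.\<close>

lemma solution_avoids_forms:
  assumes x: "solution a x" and Q: "homogeneous c Q" "Q \<noteq> 0"
  shows "ev h x Q \<noteq> 0"
proof
  assume Qx: "ev h x Q = 0"
  define B where "B = (pvar i0 ^ c :: 'n cpoly)"
  have B: "homogeneous c B" using homogeneous_power[OF homogeneous_pvar[of i0], of c] by (simp add: B_def)
  have Bx: "ev h x B = 1" using x by (simp add: B_def rhomD[OF rhom_ev[OF h]] ev_pvar[OF h] solution_def)
  obtain M d p where *: "(\<forall>k\<le>M. homogeneous d (p k)) \<and>
      (\<exists>k\<le>M. p k \<noteq> 0) \<and> (\<Sum>k\<le>M. psubst (p k) (G a) * (Q ^ k * B ^ (M - k))) = 0"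
    using algebraic_relation_forms[where F = "G a", OF G_homogeneous r_pos Q(1) B]
    by (elim exE) (rule that)
  note p = conjunct1[OF *] conjunct1[OF conjunct2[OF *]] and rel = conjunct2[OF conjunct2[OF *]]
  define k0 where "k0 = (LEAST k. p k \<noteq> 0)"
  obtain k1 where k1: "k1 \<le> M" "p k1 \<noteq> 0" using p(2) by blast
  have k0: "p k0 \<noteq> 0" "k0 \<le> M" "\<And>k. k < k0 \<Longrightarrow> p k = 0"
    unfolding k0_def using LeastI[of "\<lambda>k. p k \<noteq> 0" k1] Least_le[of "\<lambda>k. p k \<noteq> 0" k1] k1
    by (auto dest: not_less_Least)
  have ps0: "psubst 0 (G a) = 0" by (simp add: psubst_def)
  define T where "T = (\<Sum>k\<in>{k0..M}. psubst (p k) (G a) * (Q ^ (k - k0) * B ^ (M - k)))"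
  have "(\<Sum>k\<le>M. psubst (p k) (G a) * (Q ^ k * B ^ (M - k))) = (\<Sum>k\<in>{k0..M}. psubst (p k) (G a) * (Q ^ k * B ^ (M - k)))"
    by (rule sum.mono_neutral_right) (auto simp: k0(3) ps0)
  also have "\<dots> = Q ^ k0 * T"
    unfolding T_def sum_distrib_left
    by (intro sum.cong) (auto simp: algebra_simps simp flip: power_add)
  finally have "T = 0" using rel Q(2) by simp
  then have "0 = ev h x T" by (simp add: rhomD[OF rhom_ev[OF h]])
  also have "\<dots> = (\<Sum>k\<in>{k0..M}. if k = k0 then ev h x fr ^ d * ev h u (p k) else 0)"
    unfolding T_def rhomD(7)[OF rhom_ev[OF h]]
    by (intro sum.cong refl) (use p x in \<open>simp add: rhomD[OF rhom_ev[OF h]] ev_psubst_G Qx Bx\<close>)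
  also have "\<dots> = ev h x fr ^ d * ev h u (p k0)" using k0(2) by simp
  finally have "ev h u (p k0) = 0" using x by (simp add: solution_def)
  then show False using generic p(1) k0 by blast
qed

text \<open>
  The relation is a minimal polynomial of \<open>x\<^sub>j / x\<^sub>i\<^sub>0\<close> over the field generated by the ratios of \<open>G a\<close>; its
  derivative is a nonzero rational function, hence does not vanish at a solution.
\<close>

lemma separable_relation:
  assumes x: "solution a x"
  shows "\<exists>M d p. (\<forall>k\<le>M. homogeneous d (p k)) \<and>
    (\<Sum>k\<le>M. psubst (p k) (G a) * (pvar j ^ k * pvar i0 ^ (M - k))) = 0 \<and>
    (\<Sum>k\<le>M. ev h u (p k) * (of_nat k * x j ^ (k - 1))) \<noteq> 0"
proof -
  let ?R = "\<lambda>M d p. (\<forall>k\<le>M. homogeneous d (p k)) \<and> (\<exists>k\<le>M. p k \<noteq> 0) \<and>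
    (\<Sum>k\<le>M. psubst (p k) (G a) * (pvar j ^ k * pvar i0 ^ (M - k))) = 0"
  define M where "M = (LEAST M. \<exists>d p. ?R M d p)"
  have "\<exists>M d p. ?R M d p"
    by (rule algebraic_relation_forms[where F = "G a", OF G_homogeneous r_pos homogeneous_pvar homogeneous_pvar])
  then have "\<exists>d p. ?R M d p" unfolding M_def by (rule LeastI_ex)
  then obtain d p where *: "(\<forall>k\<le>M. homogeneous d (p k)) \<and>
      (\<exists>k\<le>M. p k \<noteq> 0) \<and> (\<Sum>k\<le>M. psubst (p k) (G a) * (pvar j ^ k * pvar i0 ^ (M - k))) = 0"
    by (elim exE) (rule that)
  note p = conjunct1[OF *] conjunct1[OF conjunct2[OF *]] and rel = conjunct2[OF conjunct2[OF *]]
  have min: "\<not> (\<exists>d p. ?R M' d p)" if "M' < M" for M'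
    using that unfolding M_def by (rule not_less_Least)
  have ps0: "psubst 0 (G a) = 0" by (simp add: psubst_def)
  \<comment> \<open>A relation with a constant term only would contradict dominance. So the formal
    derivative has a nonzero coefficient, and being shorter than the minimal relation it cannot be a
    relation.\<close>
  have "\<exists>k\<le>M. k \<ge> 1 \<and> p k \<noteq> 0"
  proof (rule ccontr)
    assume *: "\<not> ?thesis"
    then have z: "p k = 0" if "k \<le> M" "k \<noteq> 0" for k using that by auto
    then have p0: "p 0 \<noteq> 0" using p(2) by metis
    have "(\<Sum>k\<le>M. psubst (p k) (G a) * (pvar j ^ k * pvar i0 ^ (M - k))) =
        (\<Sum>k\<in>{0}. psubst (p k) (G a) * (pvar j ^ k * pvar i0 ^ (M - k)))"
      by (rule sum.mono_neutral_right) (auto simp: z ps0)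
    then have "psubst (p 0) (G a) = 0" using rel by (simp add: pvar_nonzero)
    then show False using solution_imp_dominant[OF x] p(1) p0 by blast
  qed
  then obtain k1 where k1: "k1 \<le> M" "k1 \<ge> 1" "p k1 \<noteq> 0" by blast
  define N where "N = M - 1"
  have N: "M = Suc N" using k1 by (simp add: N_def)
  define p' where "p' = (\<lambda>k. of_nat (Suc k) * p (Suc k))"
  define W where "W = (\<Sum>k\<le>N. psubst (p' k) (G a) * (pvar j ^ k * pvar i0 ^ (N - k)))"
  have p'_hom: "homogeneous d (p' k)" if "k \<le> N" for k
    using homogeneous_mult[OF homogeneous_pconst[of "of_nat (Suc k)"], of d "p (Suc k)"] p(1) that
    unfolding p'_def by (simp add: N pconst_of_nat del: of_nat_Suc)
  have "p' (k1 - 1) \<noteq> 0" using k1 by (simp add: p'_def del: of_nat_Suc)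
  then have "\<exists>k\<le>N. p' k \<noteq> 0" using k1 N by (intro exI[of _ "k1 - 1"]) auto
  then have "W \<noteq> 0" using min[of N] p'_hom N unfolding W_def by blast
  moreover have "homogeneous (d * r + N) W"
    unfolding W_def
  proof (rule homogeneous_sum)
    fix k assume "k \<in> {..N}"
    then have k: "k \<le> N" by simp
    have "homogeneous (d * r + (k * 1 + (N - k) * 1)) (psubst (p' k) (G a) * (pvar j ^ k * pvar i0 ^ (N - k)))"
      by (intro homogeneous_mult homogeneous_psubst[OF p'_hom[OF k] G_homogeneous] homogeneous_power homogeneous_pvar)
    then show "homogeneous (d * r + N) (psubst (p' k) (G a) * (pvar j ^ k * pvar i0 ^ (N - k)))" using k by simp
  qed
  ultimately have "ev h x W \<noteq> 0" using solution_avoids_forms[OF x] by blast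
  moreover have "ev h x W = ev h x fr ^ d * (\<Sum>k\<le>N. ev h u (p' k) * x j ^ k)"
    unfolding W_def rhomD(7)[OF rhom_ev[OF h]] sum_distrib_left
    by (intro sum.cong refl)
      (use x p'_hom in \<open>simp add: rhomD[OF rhom_ev[OF h]] ev_psubst_G ev_pvar[OF h] solution_def[of a x]\<close>)
  moreover have "(\<Sum>k\<le>M. ev h u (p k) * (of_nat k * x j ^ (k - 1))) = (\<Sum>k\<le>N. ev h u (p' k) * x j ^ k)"
    unfolding N sum.atMost_Suc_shift
    by (simp add: p'_def rhomD[OF rhom_ev[OF h]] rhom_of_nat[OF rhom_ev[OF h]] mult_ac del: of_nat_Suc)
  ultimately have "(\<Sum>k\<le>M. ev h u (p k) * (of_nat k * x j ^ (k - 1))) \<noteq> 0" by auto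
  then show ?thesis using p(1) rel by (intro exI[of _ M] exI[of _ d] exI[of _ p]) (simp only: simp_thms)
qed

section \<open>Formal arcs ending in a fibre\<close>

definition hc :: "complex \<Rightarrow> 'w fps" where
  "hc c = fps_const (h c)"

lemma rhom_hc: "rhom hc"
  using h by (simp add: hom_on_def hc_def)

lemma rhom_nth_0: "rhom (\<lambda>F :: 'w fps. F $ 0)"
  by (simp add: hom_on_def)

lemma ev_hc_nth_0: "ev hc x p $ 0 = ev h (\<lambda>i. x i $ 0) p"
  using ev_hom[OF rhom_nth_0 rhom_hc, of x p] by (simp add: hc_def)

text \<open>A point over power series for the weights (1 - X^k) a + X^k b, that is, for s = 1 - X^k,
  where k is the ramification index. The condition on the constant coefficient of \<open>fr\<close>
  keeps the limit off the zero set.\<close>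

definition arc :: "(nat \<Rightarrow> complex) \<Rightarrow> (nat \<Rightarrow> complex) \<Rightarrow> nat \<Rightarrow> ('n \<Rightarrow> 'w fps) \<Rightarrow> bool" where
  "arc a b k x \<longleftrightarrow> x i0 = 1 \<and> ev hc x fr $ 0 \<noteq> 0 \<and>
    (\<forall>i. ev hc x (G a i) + fps_X ^ k * (ev hc x (G b i) - ev hc x (G a i)) = fps_const (u i) * ev hc x fr)"

lemma arc_imp_solution:
  assumes "arc a b k x" "k \<ge> 1"
  shows "solution a (\<lambda>i. x i $ 0)"
proof -
  have "ev hc x (G a i) $ 0 = u i * ev hc x fr $ 0" for i
  proof -
    have "(ev hc x (G a i) + fps_X ^ k * (ev hc x (G b i) - ev hc x (G a i))) $ 0 = (fps_const (u i) * ev hc x fr) $ 0"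
      using assms(1) by (simp only: arc_def)
    then show ?thesis using assms(2) by (simp add: fps_X_power_mult_nth)
  qed
  then show ?thesis using assms(1) unfolding solution_def arc_def ev_hc_nth_0 by simp
qed

text \<open>Newton's argument: let M be the least order of a coordinate difference, attained at j.
  The factor X^k in the equations makes the gradients over \<open>fr\<close> agree modulo X^(M+1),
  and the separable relation for coordinate j over these gradients forces that coordinate to agree
  modulo X^(M+1) as well.\<close>

lemma arc_unique:
  assumes x: "arc a b k x" and y: "arc a b k y" and k: "k \<ge> 1"
    and eq: "\<And>i. x i $ 0 = y i $ 0"
  shows "x = y"
proof (rule ccontr)
  assume "x \<noteq> y"
  define D where "D = {i. x i \<noteq> y i}"
  have D: "finite D" "D \<noteq> {}" using \<open>x \<noteq> y\<close> by (auto simp: D_def fun_eq_iff)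
  define j where "j = arg_min_on (\<lambda>i. subdegree (y i - x i)) D"
  have j: "j \<in> D" and min: "\<And>i. i \<in> D \<Longrightarrow> subdegree (y j - x j) \<le> subdegree (y i - x i)"
    unfolding j_def by (rule arg_min_if_finite(1)[OF D], rule arg_min_least[OF D])
  define M where "M = subdegree (y j - x j)"
  have yj: "y j - x j \<noteq> 0" using j by (auto simp: D_def)
  let ?t = "fps_X :: 'w fps"
  have dv: "?t ^ M dvd y i - x i" for i
    using min[of i] by (cases "i \<in> D") (auto simp: fps_dvd_iff D_def M_def)
  have not_dv: "\<not> ?t ^ Suc M dvd y j - x j"
    using yj by (auto simp: fps_dvd_iff M_def)
  define U where "U = (\<lambda>z a i. ev hc z (G a i) * inverse (ev hc z fr))"
  have unit: "ev hc z fr * inverse (ev hc z fr) = 1" if "ev hc z fr $ 0 \<noteq> 0" for z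
    using that by (simp add: inverse_mult_eq_1')
  have G_U: "ev hc z (G a' i) = ev hc z fr * U z a' i" if "arc a b k z" for z a' i
  proof -
    have "ev hc z fr * U z a' i = ev hc z (G a' i) * (ev hc z fr * inverse (ev hc z fr))"
      by (simp only: U_def mult.left_commute)
    also have "ev hc z fr * inverse (ev hc z fr) = 1" using unit[of z] that by (simp add: arc_def)
    finally show ?thesis by simp
  qed
  have U_eq: "U z a i = fps_const (u i) - ?t ^ k * (U z b i - U z a i)" if z: "arc a b k z" for z i
  proof -
    have "(ev hc z (G a i) + ?t ^ k * (ev hc z (G b i) - ev hc z (G a i))) * inverse (ev hc z fr) =
        fps_const (u i) * (ev hc z fr * inverse (ev hc z fr))"
      using z by (simp add: arc_def mult.assoc)
    also have "ev hc z fr * inverse (ev hc z fr) = 1" using unit z by (simp add: arc_def)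
    finally show ?thesis by (simp add: U_def algebra_simps)
  qed
  have U_dv: "?t ^ M dvd U y a' i - U x a' i" for a' i
  proof -
    let ?p = "\<lambda>z. ev hc z (G a' i)" and ?q = "\<lambda>z. ev hc z fr"
    have q: "?q x * inverse (?q x) = 1" "?q y * inverse (?q y) = 1" using x y unit by (auto simp: arc_def)
    have "U y a' i - U x a' i = (?p y * (?q x * inverse (?q x)) * inverse (?q y)) - (?p x * (?q y * inverse (?q y)) * inverse (?q x))"
      by (simp add: q U_def)
    also have "\<dots> = inverse (?q x) * inverse (?q y) * ((?p y - ?p x) * ?q x - ?p x * (?q y - ?q x))"
      by (simp add: algebra_simps)
    finally show ?thesis
      using ev_cong_dvd[where x = x and x' = y, OF rhom_hc dv] by (simp add: dvd_diff)
  qed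
  have Ua_dv: "?t ^ Suc M dvd U y a i - U x a i" for i
  proof -
    have "U y a i - U x a i = ?t ^ k * ((U y a i - U x a i) - (U y b i - U x b i))"
      using U_eq[OF x, of i] U_eq[OF y, of i] by (simp add: algebra_simps)
    moreover have "?t ^ 1 * ?t ^ M dvd ?t ^ k * ((U y a i - U x a i) - (U y b i - U x b i))"
      by (intro mult_dvd_mono le_imp_power_dvd k dvd_diff[OF U_dv U_dv])
    ultimately show ?thesis by simp
  qed
  have sol: "solution a (\<lambda>i. x i $ 0)" by (rule arc_imp_solution[OF x k])
  obtain m d p where *: "(\<forall>k\<le>m. homogeneous d (p k)) \<and>
      ((\<Sum>k\<le>m. psubst (p k) (G a) * (pvar j ^ k * pvar i0 ^ (m - k))) = 0) \<and> (\<Sum>k\<le>m. ev h u (p k) * (of_nat k * (x j $ 0) ^ (k - 1))) \<noteq> 0"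
    using separable_relation[OF sol, of j]
    by (elim exE) (rule that)
  note p = conjunct1[OF *] and rel = conjunct1[OF conjunct2[OF *]] and sep = conjunct2[OF conjunct2[OF *]]
  have root: "(\<Sum>k\<le>m. ev hc (U z a) (p k) * z j ^ k) = 0" if z: "arc a b k z" for z
  proof -
    have "ev hc z (psubst (p k) (G a)) = ev hc z fr ^ d * ev hc (U z a) (p k)" if "k \<le> m" for k
      using p that by (simp add: ev_psubst[OF rhom_hc] G_U[OF z] ev_scale[OF rhom_hc])
    then have "ev hc z fr ^ d * (\<Sum>k\<le>m. ev hc (U z a) (p k) * z j ^ k) =
        ev hc z (\<Sum>k\<le>m. psubst (p k) (G a) * (pvar j ^ k * pvar i0 ^ (m - k)))"
      using z by (simp add: rhomD[OF rhom_ev[OF rhom_hc]] ev_pvar[OF rhom_hc] arc_def sum_distrib_left mult.assoc)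
    also have "\<dots> = 0" by (simp only: rel rhomD[OF rhom_ev[OF rhom_hc]])
    finally show ?thesis using z by (auto simp: arc_def)
  qed
  \<comment> \<open>W is the divided difference of the relation between x j and y j. Its constant
    term is the derivative from \<open>separable_relation\<close>, so W is a unit.\<close>
  define W where "W = (\<Sum>k\<le>m. ev hc (U x a) (p k) * (\<Sum>i<k. x j ^ (k - Suc i) * y j ^ i))"
  have "?t ^ Suc M dvd (y j - x j) * W"
  proof -
    have "(y j - x j) * W = (\<Sum>k\<le>m. ev hc (U x a) (p k) * (y j ^ k - x j ^ k))"
      unfolding W_def by (subst sum_distrib_left) (intro sum.cong refl, simp only: power_diff_sumr2 mult.left_commute)
    also have "\<dots> = (\<Sum>k\<le>m. ev hc (U y a) (p k) * y j ^ k) - (\<Sum>k\<le>m. ev hc (U x a) (p k) * x j ^ k)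
        - (\<Sum>k\<le>m. (ev hc (U y a) (p k) - ev hc (U x a) (p k)) * y j ^ k)"
      by (simp add: sum_subtractf algebra_simps)
    also have "\<dots> = - (\<Sum>k\<le>m. (ev hc (U y a) (p k) - ev hc (U x a) (p k)) * y j ^ k)"
      by (simp add: root x y)
    finally show ?thesis
      using ev_cong_dvd[where x = "U x a" and x' = "U y a", OF rhom_hc Ua_dv] by (simp only: dvd_minus_iff) (auto intro: dvd_sum dvd_mult2)
  qed
  moreover have "W $ 0 \<noteq> 0"
  proof -
    have "U x a i $ 0 = u i" for i
      using arg_cong[OF U_eq[OF x, of i], of "\<lambda>F. F $ 0"] k by (simp add: fps_X_power_mult_nth)
    then have "ev hc (U x a) (p k) $ 0 = ev h u (p k)" for k by (simp add: ev_hc_nth_0)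
    moreover have "(\<Sum>i<k. (x j $ 0) ^ (k - Suc i) * (x j $ 0) ^ i) = of_nat k * (x j $ 0) ^ (k - 1)" for k
    proof -
      have "(\<Sum>i<k. (x j $ 0) ^ (k - Suc i) * (x j $ 0) ^ i) = (\<Sum>i<k. (x j $ 0) ^ (k - 1))"
        by (intro sum.cong) (simp_all flip: power_add)
      then show ?thesis by simp
    qed
    ultimately have "W $ 0 = (\<Sum>k\<le>m. ev h u (p k) * (of_nat k * (x j $ 0) ^ (k - 1)))"
      unfolding W_def by (simp add: rhomD[OF rhom_nth_0] eq[symmetric])
    then show ?thesis using sep by simp
  qed
  then have "W * inverse W = 1" by (simp add: inverse_mult_eq_1')
  then have "y j - x j = (y j - x j) * W * inverse W" by (simp add: mult.assoc)
  ultimately show False using not_dv by (metis dvd_mult2)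
qed

end

section \<open>Deforming the weights\<close>

lemma hom_on_ev:
  assumes g: "hom_on K g" and K: "field_subset K" and \<kappa>: "\<And>c. \<kappa> c \<in> K" and x: "\<And>i. x i \<in> K"
  shows "ev \<kappa> x p \<in> K" "g (ev \<kappa> x p) = ev (\<lambda>c. g (\<kappa> c)) (\<lambda>i. g (x i)) p"
proof -
  have pow: "x i ^ n \<in> K" "g (x i ^ n) = g (x i) ^ n" for i n
    by (induction n) (auto simp: hom_on_mult[OF g K x field_subset_power[OF K x]] hom_on_1[OF g K]
        intro: field_subset_power[OF K x] field_subset_1[OF K] field_subset_mult[OF K x])
  have prod: "(\<Prod>i\<in>S. x i ^ e i) \<in> K \<and> g (\<Prod>i\<in>S. x i ^ e i) = (\<Prod>i\<in>S. g (x i) ^ e i)" for S e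
    by (induction S rule: infinite_finite_induct)
      (auto simp: hom_on_mult[OF g K] hom_on_1[OF g K] pow intro: field_subset_1[OF K] field_subset_mult[OF K])
  show "ev \<kappa> x p \<in> K"
    unfolding ev_def using prod by (intro field_subset_sum[OF K] field_subset_mult[OF K] \<kappa>) auto
  show "g (ev \<kappa> x p) = ev (\<lambda>c. g (\<kappa> c)) (\<lambda>i. g (x i)) p"
    unfolding ev_def using prod
    by (simp add: hom_on_sum[OF g K] hom_on_mult[OF g K] field_subset_mult[OF K] \<kappa>)
qed

section \<open>Fields of quotients of homogeneous elements\<close>

definition to_field :: "'a::idom \<Rightarrow> 'a fract" where
  "to_field p = Fract p 1"

lemma rhom_to_field: "rhom to_field"
  by (simp add: hom_on_def to_field_def One_fract_def)

lemma to_field_eq_iff: "to_field p = to_field q \<longleftrightarrow> p = q"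
  by (simp add: to_field_def eq_fract)

lemma to_field_eq_0_iff: "to_field p = 0 \<longleftrightarrow> p = 0"
  using to_field_eq_iff[of p 0] by (simp add: rhomD[OF rhom_to_field])

instance fract :: ("{idom,ring_char_0}") field_char_0
proof
  show "inj (of_nat :: nat \<Rightarrow> 'a fract)"
    by (rule injI) (simp add: of_nat_fract eq_fract)
qed

text \<open>Abstracts a ring with a notion of homogeneity and a map to a field that kills no nonzero
  homogeneous element; the quotients of degree 0 then form a field. The function field, the pullback
  fields and \<open>E\<close> are instances.\<close>

locale graded_hom =
  fixes T :: "nat \<Rightarrow> 'p::idom \<Rightarrow> bool" and \<phi> :: "'p \<Rightarrow> 'k::field"
  assumes \<phi>: "rhom \<phi>" and T_0: "T d 0" and T_1: "T 0 1"
    and T_add: "T d P \<Longrightarrow> T d Q \<Longrightarrow> T d (P + Q)" and T_uminus: "T d P \<Longrightarrow> T d (- P)"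
    and T_mult: "T d P \<Longrightarrow> T d' Q \<Longrightarrow> T (d + d') (P * Q)"
    and nonzero: "T d P \<Longrightarrow> P \<noteq> 0 \<Longrightarrow> \<phi> P \<noteq> 0"
begin

definition quotients :: "'k set" where
  "quotients = {\<phi> P / \<phi> Q | P Q d. T d P \<and> T d Q \<and> Q \<noteq> 0}"

lemma quotientsI: "T d P \<Longrightarrow> T d Q \<Longrightarrow> Q \<noteq> 0 \<Longrightarrow> \<phi> P / \<phi> Q \<in> quotients"
  by (auto simp: quotients_def)

lemma quotientsI0: "T 0 P \<Longrightarrow> \<phi> P \<in> quotients"
  using quotientsI[OF _ T_1] by (simp add: rhomD[OF \<phi>])

lemma quotientsE:
  assumes "z \<in> quotients"
  obtains P Q d where "T d P" "T d Q" "Q \<noteq> 0" "z = \<phi> P / \<phi> Q" "\<phi> Q \<noteq> 0"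
  using assms nonzero by (auto simp: quotients_def)

lemma T_prod: "finite S \<Longrightarrow> (\<And>i. i \<in> S \<Longrightarrow> T (d i) (g i)) \<Longrightarrow> T (\<Sum>i\<in>S. d i) (prod g S)"
  by (induction S rule: finite_induct) (auto intro: T_1 T_mult)

lemma field_subset_quotients: "field_subset quotients"
proof -
  have 01: "0 \<in> quotients" "1 \<in> quotients"
    using quotientsI0[OF T_0] quotientsI0[OF T_1] by (simp_all add: rhomD[OF \<phi>])
  have "z + w \<in> quotients \<and> z * w \<in> quotients" if zw: "z \<in> quotients" "w \<in> quotients" for z w
  proof -
    obtain P Q d where 1: "T d P" "T d Q" "Q \<noteq> 0" "z = \<phi> P / \<phi> Q" "\<phi> Q \<noteq> 0" using quotientsE[OF zw(1)] .
    obtain P' Q' d' where 2: "T d' P'" "T d' Q'" "Q' \<noteq> 0" "w = \<phi> P' / \<phi> Q'" "\<phi> Q' \<noteq> 0"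
      using quotientsE[OF zw(2)] .
    have "z + w = \<phi> (P * Q' + Q * P') / \<phi> (Q * Q')"
      using 1(5) 2(5) by (simp add: 1(4) 2(4) rhomD[OF \<phi>] field_simps)
    moreover have "z * w = \<phi> (P * P') / \<phi> (Q * Q')" by (simp add: 1(4) 2(4) rhomD[OF \<phi>])
    ultimately show ?thesis using 1 2 by (simp add: quotientsI[of "d + d'"] T_add T_mult)
  qed
  moreover have "- z \<in> quotients \<and> inverse z \<in> quotients" if z: "z \<in> quotients" for z
  proof -
    obtain P Q d where 1: "T d P" "T d Q" "Q \<noteq> 0" "z = \<phi> P / \<phi> Q" "\<phi> Q \<noteq> 0" using quotientsE[OF z] .
    have "- z \<in> quotients" using quotientsI[OF T_uminus[OF 1(1)] 1(2,3)] 1(4) by (simp add: rhomD[OF \<phi>])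
    moreover have "inverse z \<in> quotients"
      using quotientsI[OF 1(2,1)] 1(4) 01 by (cases "P = 0") (simp_all add: rhomD[OF \<phi>])
    ultimately show ?thesis by blast
  qed
  ultimately show ?thesis using 01 by (simp add: field_subset_def)
qed

lemma common_denominator:
  fixes m :: nat
  assumes "\<forall>i<m. g i \<in> quotients"
  obtains D R W where "\<And>i. i < m \<Longrightarrow> T D (R i)" "W \<noteq> 0" "\<And>i. i < m \<Longrightarrow> \<phi> (R i) = W * g i"
proof -
  have "\<forall>i\<in>{..<m}. \<exists>P Q d. T d P \<and> T d Q \<and> Q \<noteq> 0 \<and> g i = \<phi> P / \<phi> Q"
    using assms unfolding quotients_def by blast
  then obtain P Q d where PQ: "\<And>i. i < m \<Longrightarrow> T (d i) (P i)" "\<And>i. i < m \<Longrightarrow> T (d i) (Q i)"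
    "\<And>i. i < m \<Longrightarrow> Q i \<noteq> 0" "\<And>i. i < m \<Longrightarrow> g i = \<phi> (P i) / \<phi> (Q i)" by (metis lessThan_iff)
  define R where "R = (\<lambda>i. P i * (\<Prod>j\<in>{..<m} - {i}. Q j))"
  have "T (\<Sum>j<m. d j) (R i)" if "i < m" for i
  proof -
    have "T (d i + (\<Sum>j\<in>{..<m} - {i}. d j)) (R i)"
      unfolding R_def using PQ(1,2) that by (intro T_mult T_prod) auto
    then show ?thesis using that by (simp add: sum.remove[of "{..<m}" i])
  qed
  moreover have "\<phi> (\<Prod>j<m. Q j) \<noteq> 0"
    by (rule nonzero[of "\<Sum>j<m. d j"]) (use PQ(2,3) in \<open>auto intro: T_prod\<close>)
  moreover have "\<phi> (R i) = \<phi> (\<Prod>j<m. Q j) * g i" if "i < m" for i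
  proof -
    have "(\<Prod>j<m. Q j) = Q i * (\<Prod>j\<in>{..<m} - {i}. Q j)" using that by (intro prod.remove) auto
    then show ?thesis using PQ(4)[OF that] nonzero[OF PQ(2,3)] that by (simp add: R_def rhomD[OF \<phi>])
  qed
  ultimately show ?thesis by (rule that)
qed

end

locale graded_hom_pair = graded_hom T \<phi> + \<psi>: graded_hom T \<psi>
  for T :: "nat \<Rightarrow> 'p::idom \<Rightarrow> bool" and \<phi> :: "'p \<Rightarrow> 'k::field" and \<psi> :: "'p \<Rightarrow> 'l::field"
begin

definition transfer :: "'k \<Rightarrow> 'l" where
  "transfer z = (SOME y. \<exists>P Q d. T d P \<and> T d Q \<and> Q \<noteq> 0 \<and> z = \<phi> P / \<phi> Q \<and> y = \<psi> P / \<psi> Q)"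

text \<open>Cross multiplication produces a homogeneous element killed by one map. It is therefore
  zero, and the other map sees equal quotients too.\<close>

lemma transfer_eq:
  assumes P: "T d P" "T d Q" "Q \<noteq> 0"
  shows "transfer (\<phi> P / \<phi> Q) = \<psi> P / \<psi> Q"
  unfolding transfer_def
proof (rule some_equality)
  fix y assume "\<exists>P' Q' d'. T d' P' \<and> T d' Q' \<and> Q' \<noteq> 0 \<and> \<phi> P / \<phi> Q = \<phi> P' / \<phi> Q' \<and> y = \<psi> P' / \<psi> Q'"
  then obtain P' Q' d' where P': "T d' P'" "T d' Q'" "Q' \<noteq> 0" "\<phi> P / \<phi> Q = \<phi> P' / \<phi> Q'" "y = \<psi> P' / \<psi> Q'"
    by blast
  have nz: "\<phi> Q \<noteq> 0" "\<phi> Q' \<noteq> 0" "\<psi> Q \<noteq> 0" "\<psi> Q' \<noteq> 0"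
    using P P' nonzero \<psi>.nonzero by blast+
  have "\<phi> (P * Q' + - (Q * P')) = 0"
    using P'(4) nz by (simp add: rhomD[OF \<phi>] field_simps)
  moreover have "T (d + d') (P * Q' + - (Q * P'))"
    using P P' by (intro T_add T_uminus T_mult)
  ultimately have "P * Q' + - (Q * P') = 0" using nonzero by blast
  then have "P * Q' = Q * P'" by simp
  then have "\<psi> (P * Q') = \<psi> (Q * P')" by simp
  then show "y = \<psi> P / \<psi> Q" using nz by (simp add: P'(5) rhomD[OF \<psi>.\<phi>] field_simps)
qed (use P in blast)

lemma transfer_eq0: "T 0 P \<Longrightarrow> transfer (\<phi> P) = \<psi> P"
  using transfer_eq[OF _ T_1] by (simp add: rhomD[OF \<phi>] rhomD[OF \<psi>.\<phi>])

lemma hom_on_transfer: "hom_on quotients transfer"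
  unfolding hom_on_def
proof (intro conjI ballI)
  show "transfer 1 = 1" using transfer_eq0[OF T_1] by (simp add: rhomD[OF \<phi>] rhomD[OF \<psi>.\<phi>])
  fix z w assume zw: "z \<in> quotients" "w \<in> quotients"
  obtain P Q d where 1: "T d P" "T d Q" "Q \<noteq> 0" "z = \<phi> P / \<phi> Q" "\<phi> Q \<noteq> 0" using quotientsE[OF zw(1)] .
  obtain P' Q' d' where 2: "T d' P'" "T d' Q'" "Q' \<noteq> 0" "w = \<phi> P' / \<phi> Q'" "\<phi> Q' \<noteq> 0"
    using quotientsE[OF zw(2)] .
  have nz: "\<psi> Q \<noteq> 0" "\<psi> Q' \<noteq> 0" using 1 2 \<psi>.nonzero by blast+
  have tr: "transfer z = \<psi> P / \<psi> Q" "transfer w = \<psi> P' / \<psi> Q'" using 1 2 transfer_eq by auto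
  have QQ: "T (d + d') (Q * Q')" "Q * Q' \<noteq> 0" using 1 2 by (simp_all add: T_mult)
  have "z + w = \<phi> (P * Q' + Q * P') / \<phi> (Q * Q')"
    using 1(5) 2(5) by (simp add: 1(4) 2(4) rhomD[OF \<phi>] field_simps)
  then have "transfer (z + w) = \<psi> (P * Q' + Q * P') / \<psi> (Q * Q')"
    using 1 2 QQ transfer_eq[of "d + d'"] by (simp add: T_add T_mult)
  then show "transfer (z + w) = transfer z + transfer w"
    using nz by (simp add: tr rhomD[OF \<psi>.\<phi>] field_simps)
  have "z * w = \<phi> (P * P') / \<phi> (Q * Q')" by (simp add: 1(4) 2(4) rhomD[OF \<phi>])
  then have "transfer (z * w) = \<psi> (P * P') / \<psi> (Q * Q')"
    using 1 2 QQ transfer_eq[of "d + d'"] by (simp add: T_mult)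
  then show "transfer (z * w) = transfer z * transfer w" by (simp add: tr rhomD[OF \<psi>.\<phi>])
qed

end

text \<open>The logarithmic derivative has at most a simple pole, with residue the order of g, and
  the factor \<open>fls_X ^ k\<close> removes the pole of the \<beta>-term. For g = 0 both sides are
  0.\<close>

lemma fls_residue_dlog:
  fixes g :: "'w::field_char_0 fls"
  assumes "k \<ge> 1"
  shows "((fls_const \<alpha> + fls_X ^ k * fls_const \<beta>) * (fls_deriv g / g)) $$ -1 = \<alpha> * of_int (fls_subdegree g)"
proof (cases "g = 0")
  case False
  define q where "q = fls_deriv g / g"
  have res: "q $$ -1 = of_int (fls_subdegree g)"
    using fls_residue_deriv_times_inverse_eq_subdegree(1)[of g] by (simp add: q_def divide_inverse)
  have low: "q $$ n = 0" if "n < -1" for n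
  proof -
    have "fls_subdegree (fls_deriv g) \<ge> fls_subdegree g - 1" if "fls_deriv g \<noteq> 0"
      using that by (intro fls_subdegree_geI) auto
    then have "q = 0 \<or> fls_subdegree q \<ge> -1"
      using False by (cases "fls_deriv g = 0") (auto simp: q_def fls_divide_subdegree)
    then show ?thesis using that by auto
  qed
  have "fls_X ^ k * fls_const \<beta> * q = fls_shift (- int k) (fls_const \<beta> * q)"
    by (subst mult.assoc) (rule fls_X_power_times_conv_shift(1))
  then have "(fls_X ^ k * fls_const \<beta> * q) $$ -1 = (fls_const \<beta> * q) $$ (-1 - int k)" by simp
  then have "(fls_X ^ k * fls_const \<beta> * q) $$ -1 = 0" using assms by (simp add: low)
  then show ?thesis by (simp add: q_def[symmetric] distrib_right res)
qed simp

text \<open>The member s = 0 has the weights b and the member s = 1 the weights a. Euler's formula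
  dictates \<open>sum_u\<close>: the coordinates of a logarithmic gradient add up to the total
  weight.\<close>

locale deformation = generic_value l f e h u i0
  for l and f :: "nat \<Rightarrow> 'n::{finite,linorder} cpoly" and e
    and h :: "complex \<Rightarrow> 'w::{alg_closed_field,field_char_0}" and u i0 +
  fixes a b :: "nat \<Rightarrow> complex" and \<kappa> :: complex
  assumes a_pos: "j < l \<Longrightarrow> Re (a j) > 0"
    and weight_a: "(\<Sum>j<l. a j * of_nat (e j)) = \<kappa>" and weight_b: "(\<Sum>j<l. b j * of_nat (e j)) = \<kappa>"
    and \<kappa>: "\<kappa> \<noteq> 0" and sum_u: "(\<Sum>i\<in>UNIV. u i) = h \<kappa>"
    and b_dominant: "homogeneous d P \<Longrightarrow> psubst P (G b) = 0 \<Longrightarrow> P = 0"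
begin

definition H :: "'n \<Rightarrow> 'n cpoly poly" where
  "H i = [:G b i, G a i - G b i:]"

definition N :: "'n cpoly poly \<Rightarrow> 'n cpoly poly" where
  "N P = evp cst H svar P"

lemma rhom_N: "rhom N"
  unfolding N_def by (rule rhom_evp[OF rhom_cst])

lemma H_homogeneous: "homogeneous_coeffs r (H i)"
  by (simp add: H_def homogeneous_coeffs_pCons homogeneous_coeffs_0 homogeneous_diff G_homogeneous)

lemma N_nonzero:
  assumes "homogeneous_coeffs d P" "P \<noteq> 0"
  shows "N P \<noteq> 0"
proof
  assume "N P = 0"
  moreover have "indep_forms (\<lambda>i. poly (H i) 0) 1 (\<lambda>_. 1)"
    using b_dominant by (auto simp: indep_forms_def H_def)
  ultimately have "P = 0"
    using indep_forms_deform[of H 1 "\<lambda>_. 1" d "\<lambda>_. P" 0] assms(1) by (simp add: N_def)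
  with assms(2) show False by simp
qed

definition hF :: "complex \<Rightarrow> 'w fls" where
  "hF c = fls_const (h c)"

text \<open>Counterpart of \<open>N\<close> on the side of the series: the gradient over
  \<open>fr\<close> is replaced by u, and s by 1 - X, which centres the series at s = 1.\<close>

definition V :: "'n cpoly poly \<Rightarrow> 'w fls" where
  "V P = evp hF (\<lambda>i. fls_const (u i)) (1 - fls_X) P"

lemma rhom_fls_const: "rhom (fls_const :: 'w \<Rightarrow> 'w fls)"
  by (simp add: hom_on_def fls_plus_const fls_const_mult_const)

lemma rhom_hF: "rhom hF"
  unfolding hF_def by (rule rhom_comp[OF rhom_fls_const h])

lemma rhom_V: "rhom V"
  unfolding V_def by (rule rhom_evp[OF rhom_hF])

text \<open>The leading coefficient in s does not vanish at the generic point u, and s = 1 - X is an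
  invertible change of the parameter.\<close>

lemma V_nonzero:
  assumes "homogeneous_coeffs d P" "P \<noteq> 0"
  shows "V P \<noteq> 0"
proof -
  define q where "q = map_poly (ev h u) P"
  have "coeff q (degree P) \<noteq> 0"
    using generic[of d "lead_coeff P"] assms
    by (auto simp: q_def coeff_map_poly rhomD[OF rhom_ev[OF h]] homogeneous_coeffs_def)
  then have "q \<noteq> 0" by auto
  then have "q \<circ>\<^sub>p [:1, -1:] \<noteq> 0" using pcompose_eq_0[of q "[:1, -1:]"] by auto
  moreover have "V P = fps_to_fls (fps_of_poly (q \<circ>\<^sub>p [:1, -1:]))"
    unfolding q_def
  proof (induction P)
    case 0
    show ?case by (simp add: rhomD[OF rhom_V])
  next
    case (pCons p P)
    have "ev hF (\<lambda>i. fls_const (u i)) p = fls_const (ev h u p)"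
      using ev_hom[OF rhom_fls_const h, of u p] by (simp add: hF_def[abs_def])
    moreover have "fps_of_poly [:1, -1:] = (1 - fps_X :: 'w fps)"
      by (simp add: fps_eq_iff coeff_pCons fps_X_def split: nat.split)
    then have "fps_to_fls (fps_of_poly [:1, -1:]) = (1 - fls_X :: 'w fls)"
      by (simp only: fps_to_fls_minus fps_one_to_fls fps_X_to_fls)
    ultimately show ?case using pCons
      by (simp add: V_def evp_pCons[OF rhom_hF] map_poly_pCons rhomD[OF rhom_ev[OF h]] pcompose_pCons
          fps_of_poly_add fps_of_poly_mult fps_of_poly_const fls_times_fps_to_fls del: fps_of_poly_pCons mult_pCons_left)
  qed
  ultimately show ?thesis by (metis fps_of_poly_0 fps_of_poly_eq_iff fps_to_fls_eq_0_iff)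
qed

interpretation quot: graded_hom_pair homogeneous_coeffs "\<lambda>P. to_field (N P)" V
proof unfold_locales
  show "homogeneous_coeffs 0 (1 :: 'n cpoly poly)"
    by (simp add: one_pCons homogeneous_coeffs_const homogeneous_1)
qed (auto simp: rhom_comp[OF rhom_to_field rhom_N] rhom_V homogeneous_coeffs_0 homogeneous_coeffs_add
    homogeneous_coeffs_uminus homogeneous_coeffs_mult to_field_eq_0_iff N_nonzero V_nonzero)

text \<open>
  \<open>E\<close> is generated by \<open>s\<close> and the ratios of the logarithmic gradient for the weights \<open>b + s (a - b)\<close>;
  \<open>\<iota>\<close> sends this gradient to \<open>u\<close> and \<open>1 - s\<close> to the variable of the series.
\<close>

abbreviation "E \<equiv> quot.quotients"

abbreviation "\<iota> \<equiv> quot.transfer"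

definition tc :: "'n cpoly \<Rightarrow> 'n cpoly poly fract" where
  "tc p = to_field [:p:]"

lemma rhom_tc: "rhom tc"
  unfolding tc_def by (rule rhom_comp[OF rhom_to_field]) (rule rhom_const_poly[OF rhom_id, THEN _]; simp add: hom_on_def one_pCons)

lemma tc_eq_0_iff: "tc p = 0 \<longleftrightarrow> p = 0"
  by (simp add: tc_def to_field_eq_0_iff)

definition y :: "'n \<Rightarrow> 'n cpoly poly fract" where
  "y i = tc (pvar i) / tc (pvar i0)"

lemma rhom_tc_pconst: "rhom (\<lambda>c. tc (pconst c))"
  by (rule rhom_comp[OF rhom_tc rhom_pconst])

lemma ev_y:
  assumes "homogeneous d p"
  shows "ev (\<lambda>c. tc (pconst c)) y p = tc p / tc (pvar i0) ^ d"
proof -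
  have "ev (\<lambda>c. tc (pconst c)) (\<lambda>i. tc (pvar i)) p = tc p"
    using ev_hom[OF rhom_tc rhom_pconst, of pvar p] by (simp add: ev_pvar_id)
  moreover have "y = (\<lambda>i. inverse (tc (pvar i0)) * tc (pvar i))"
    by (simp add: y_def fun_eq_iff divide_inverse mult.commute)
  ultimately show ?thesis
    using ev_scale[OF rhom_tc_pconst assms, of "inverse (tc (pvar i0))" "\<lambda>i. tc (pvar i)"]
    by (simp add: divide_inverse power_inverse mult.commute)
qed

text \<open>The coefficients of the algebraic relation for x_j / x_i0 have one common degree;
  dividing by a nonzero one places them in \<open>E\<close>.\<close>

lemma y_algebraic: "algebraic_over E (y j)"
proof -
  have "degree (H i) \<le> 1" for i by (simp add: H_def)
  from algebraic_relation[where H = H, OF this H_homogeneous r_pos homogeneous_pvar[of j] homogeneous_pvar[of i0]]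
  obtain M d P where *: "(\<forall>k\<le>M. homogeneous_coeffs d (P k)) \<and> (\<exists>k\<le>M. P k \<noteq> 0) \<and>
    (\<Sum>k\<le>M. evp cst H svar (P k) * [:pvar j ^ k * pvar i0 ^ (M - k):]) = 0" by (elim exE) (rule that)
  then obtain k1 where P: "\<And>k. k \<le> M \<Longrightarrow> homogeneous_coeffs d (P k)" and k1: "k1 \<le> M" "P k1 \<noteq> 0" by blast
  have rel: "(\<Sum>k\<le>M. N (P k) * [:pvar j ^ k * pvar i0 ^ (M - k):]) = 0" using * by (simp add: N_def)
  define p where "p = (\<Sum>k\<le>M. monom (to_field (N (P k)) / to_field (N (P k1))) k)"
  have cp: "coeff p k = (if k \<le> M then to_field (N (P k)) / to_field (N (P k1)) else 0)" for k
    by (simp add: p_def coeff_sum)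
  have nz: "to_field (N (P k1)) \<noteq> 0" using N_nonzero[OF P[OF k1(1)] k1(2)] by (simp add: to_field_eq_0_iff)
  have x0: "tc (pvar i0) \<noteq> 0" by (simp add: tc_eq_0_iff pvar_nonzero)
  have "poly_over E p"
    unfolding poly_over_def cp
    using quot.quotientsI[OF P P[OF k1(1)] k1(2)] field_subset_0[OF quot.field_subset_quotients] by auto
  moreover have "p \<noteq> 0" using cp[of k1] k1 nz by auto
  moreover have "poly p (y j) = 0"
  proof -
    have "0 = to_field (\<Sum>k\<le>M. N (P k) * [:pvar j ^ k * pvar i0 ^ (M - k):])"
      by (simp only: rel rhomD[OF rhom_to_field])
    also have "\<dots> = (\<Sum>k\<le>M. to_field (N (P k)) * (tc (pvar j) ^ k * tc (pvar i0) ^ (M - k)))"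
      by (simp only: rhomD[OF rhom_to_field] rhomD[OF rhom_tc] flip: tc_def)
    also have "\<dots> = (\<Sum>k\<le>M. tc (pvar i0) ^ M * to_field (N (P k1)) * (to_field (N (P k)) / to_field (N (P k1)) * y j ^ k))"
    proof (intro sum.cong refl)
      fix k assume "k \<in> {..M}"
      then have "tc (pvar i0) ^ M = tc (pvar i0) ^ (M - k) * tc (pvar i0 :: 'n cpoly) ^ k" by (simp flip: power_add)
      then show "to_field (N (P k)) * (tc (pvar j) ^ k * tc (pvar i0) ^ (M - k)) =
          tc (pvar i0) ^ M * to_field (N (P k1)) * (to_field (N (P k)) / to_field (N (P k1)) * y j ^ k)"
        using nz x0 by (simp add: y_def power_divide)
    qed
    also have "\<dots> = tc (pvar i0) ^ M * to_field (N (P k1)) * poly p (y j)"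
      by (simp add: p_def poly_sum poly_monom sum_distrib_left)
    finally show ?thesis using nz x0 by simp
  qed
  ultimately show ?thesis unfolding algebraic_over_def by blast
qed

lemma N_const: "N [:p:] = ev cst H p"
  by (simp add: N_def evp_const[OF rhom_cst])

lemma V_const: "V [:p:] = ev hF (\<lambda>i. fls_const (u i)) p"
  by (simp add: V_def evp_const[OF rhom_hF])

lemma sum_H: "(\<Sum>i\<in>UNIV. H i) = [:pconst \<kappa> * fr:]"
proof -
  have "(\<Sum>i\<in>S. H i) = [:\<Sum>i\<in>S. G b i, (\<Sum>i\<in>S. G a i) - (\<Sum>i\<in>S. G b i):]" for S
    by (induction S rule: infinite_finite_induct) (simp_all add: H_def)
  then show ?thesis by (simp add: sum_G weight_a weight_b)
qed

text \<open>The linear form q, which is the coordinate sum over \<kappa>, is pulled back to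
  \<open>fr\<close> for every s and takes the value 1 at u. So the gradient over \<open>fr\<close>
  is a quotient of pullbacks of linear forms.\<close>

lemma H_quotient:
  "to_field (H i) / tc fr \<in> E" "\<iota> (to_field (H i) / tc fr) = fls_const (u i)"
proof -
  define q where "q = pconst (1 / \<kappa>) * (\<Sum>i\<in>UNIV. pvar i :: 'n cpoly)"
  have q: "homogeneous 1 q"
    using homogeneous_mult[OF homogeneous_pconst homogeneous_sum[of UNIV 1, OF homogeneous_pvar]] by (simp add: q_def)
  have Nq: "N [:q:] = [:fr:]"
    using \<kappa> by (simp add: N_const q_def rhomD[OF rhom_ev[OF rhom_cst]] ev_pconst[OF rhom_cst] ev_pvar[OF rhom_cst] sum_H
        mult.assoc[symmetric] rhomD(4)[OF rhom_pconst, symmetric] rhomD(2)[OF rhom_pconst])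
  have Np: "N [:pvar i:] = H i" by (simp add: N_const ev_pvar[OF rhom_cst])
  have "q \<noteq> 0" using Nq fr_nonzero rhomD(1)[OF rhom_N] by auto
  then have q0: "homogeneous_coeffs 1 [:pvar i:]" "homogeneous_coeffs 1 [:q:]" "[:q:] \<noteq> 0"
    using q homogeneous_pvar by (auto intro: homogeneous_coeffs_const)
  have "V [:q:] = fls_const (h (1 / \<kappa>) * (\<Sum>i\<in>UNIV. u i))"
    by (simp add: V_const q_def rhomD[OF rhom_ev[OF rhom_hF]] ev_pconst[OF rhom_hF] ev_pvar[OF rhom_hF] hF_def
        rhomD(7)[OF rhom_fls_const, symmetric] fls_const_mult_const)
  also have "h (1 / \<kappa>) * (\<Sum>i\<in>UNIV. u i) = 1"
    using \<kappa> by (simp add: sum_u rhomD(4)[OF h, symmetric] rhomD(2)[OF h])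
  finally have "V [:q:] = 1" by simp
  then show "to_field (H i) / tc fr \<in> E" "\<iota> (to_field (H i) / tc fr) = fls_const (u i)"
    using quot.quotientsI[OF q0] quot.transfer_eq[OF q0] by (simp_all add: Nq Np tc_def V_const[of "pvar i"] ev_pvar[OF rhom_hF])
qed

lemma rhom_fps_to_fls: "rhom (fps_to_fls :: 'w fps \<Rightarrow> 'w fls)"
  by (simp add: hom_on_def fls_times_fps_to_fls)

lemma rhom_of_int: "h (of_int n) = of_int n"
  by (cases n) (simp_all add: rhom_of_nat[OF h] rhomD[OF h] del: of_nat_Suc)

lemma generic_linear:
  assumes "(\<Sum>i\<in>UNIV. u i * h (c i)) = 0"
  shows "c i = 0"
proof -
  define P where "P = (\<Sum>i\<in>UNIV. pconst (c i) * pvar i :: 'n cpoly)"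
  have "homogeneous (0 + 1) P"
    unfolding P_def by (intro homogeneous_sum homogeneous_mult homogeneous_pconst homogeneous_pvar)
  moreover have "ev h u P = 0"
    using assms by (simp add: P_def rhomD[OF rhom_ev[OF h]] ev_pconst[OF h] ev_pvar[OF h] mult.commute)
  ultimately have "P = 0" by (rule generic)
  moreover have "ev (\<lambda>c. c) (\<lambda>j. if j = i then 1 else 0) P = c i"
    by (simp add: P_def rhomD[OF rhom_ev[OF rhom_id]] ev_pconst[OF rhom_id] ev_pvar[OF rhom_id]
        if_distrib[of "\<lambda>z. _ * z"] cong: if_cong)
  ultimately show ?thesis by (simp add: rhomD[OF rhom_ev[OF rhom_id]])
qed

text \<open>
  No escape to the boundary: the residue of the logarithmic derivative along the series \<open>\<phi> (y i)\<close>
  shows that all orders are zero. This is where the positivity of \<open>a\<close> is used.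
\<close>

lemma embedding_arc:
  assumes K: "field_subset K" "E \<subseteq> K" "\<And>i. y i \<in> K" and k: "k > 0"
    and \<phi>: "hom_on K \<phi>" "\<And>z. z \<in> E \<Longrightarrow> \<phi> z = fls_compose_power (\<iota> z) k"
  shows "\<exists>x. arc a b k x \<and> (\<forall>i. \<phi> (y i) = fps_to_fls (x i))"
proof -
  define X' where "X' = (\<lambda>i. \<phi> (y i))"
  define T where "T = (fls_X ^ k :: 'w fls)"
  have x0: "tc (pvar i0) \<noteq> 0" by (simp add: tc_eq_0_iff pvar_nonzero)
  have y0: "y i0 = 1" using x0 by (simp add: y_def)
  have X0: "X' i0 = 1" by (simp add: X'_def y0 hom_on_1[OF \<phi>(1) K(1)])
  have c: "tc (pconst c) \<in> E" "\<phi> (tc (pconst c)) = hF c" for c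
  proof -
    have hc: "homogeneous_coeffs 0 [:pconst c:]" by (rule homogeneous_coeffs_const[OF homogeneous_pconst])
    have N: "to_field (N [:pconst c:]) = tc (pconst c)" by (simp add: N_const ev_pconst[OF rhom_cst] tc_def)
    show "tc (pconst c) \<in> E" using quot.quotientsI0[OF hc] by (simp add: N)
    then show "\<phi> (tc (pconst c)) = hF c"
      using quot.transfer_eq0[OF hc] k by (simp add: N \<phi>(2) V_const ev_pconst[OF rhom_hF] hF_def)
  qed
  have s: "to_field svar \<in> E" "\<phi> (to_field svar) = 1 - T"
  proof -
    have hs: "homogeneous_coeffs 0 (svar :: 'n cpoly poly)"
      by (simp add: homogeneous_coeffs_pCons homogeneous_0 homogeneous_1 homogeneous_coeffs_0)
    have N: "N svar = svar"
      by (simp add: N_def evp_pCons[OF rhom_cst] evp_0 rhomD[OF rhom_ev[OF rhom_cst]])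
    have V: "V svar = 1 - fls_X"
      by (simp add: V_def evp_pCons[OF rhom_hF] evp_0 rhomD[OF rhom_ev[OF rhom_hF]])
    show "to_field svar \<in> E" using quot.quotientsI0[OF hs] by (simp add: N)
    then show "\<phi> (to_field svar) = 1 - T"
      using quot.transfer_eq0[OF hs] k by (simp add: N \<phi>(2) V T_def fls_X_power_conv_shift_1)
  qed
  have evX: "ev hF X' p = \<phi> (ev (\<lambda>c. tc (pconst c)) y p)" "ev (\<lambda>c. tc (pconst c)) y p \<in> K" for p
  proof -
    have cK: "tc (pconst c) \<in> K" for c using c(1) K(2) by blast
    show "ev hF X' p = \<phi> (ev (\<lambda>c. tc (pconst c)) y p)" "ev (\<lambda>c. tc (pconst c)) y p \<in> K"
      using hom_on_ev[where \<kappa> = "\<lambda>c. tc (pconst c)" and x = y, OF \<phi>(1) K(1) cK K(3), of p]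
      by (simp_all add: c(2) X'_def)
  qed
  have X_nz: "ev hF X' p \<noteq> 0" if "homogeneous d p" "p \<noteq> 0" for d p
    unfolding evX(1)
    by (rule hom_on_nonzero[OF \<phi>(1) K(1) evX(2)]) (use that x0 in \<open>simp add: ev_y tc_eq_0_iff\<close>)
  have Xi_nz: "X' i \<noteq> 0" for i
    using X_nz[OF homogeneous_pvar pvar_nonzero] by (simp add: ev_pvar[OF rhom_hF])
  have fX: "ev hF X' (f j) \<noteq> 0" if "j < l" for j using X_nz[OF f_homogeneous[OF that] f_nonzero[OF that]] .
  have frX: "ev hF X' fr \<noteq> 0" using X_nz[OF fr_homogeneous fr_nonzero] .
  \<comment> \<open>The identity between H i and z times \<open>fr\<close> is mapped to the series,
    where s becomes 1 - T.\<close>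
  have eqn: "ev hF X' (G a i) + T * (ev hF X' (G b i) - ev hF X' (G a i)) = fls_const (u i) * ev hF X' fr" for i
  proof -
    let ?e = "ev (\<lambda>c. tc (pconst c)) y"
    define z where "z = to_field (H i) / tc fr"
    have zE: "z \<in> E" "\<phi> z = fls_const (u i)"
      using H_quotient[of i] \<phi>(2)[of z] k by (simp_all add: z_def)
    have K': "z \<in> K" "to_field svar \<in> K" using zE s K(2) by auto
    have Hs: "to_field (H i) = tc (G b i) + to_field svar * (tc (G a i) - tc (G b i))"
    proof -
      have "H i = [:G b i:] + svar * ([:G a i:] - [:G b i:])" by (simp add: H_def)
      then show ?thesis by (simp only: rhomD[OF rhom_to_field] tc_def)
    qed
    have "z * ?e fr = to_field (H i) / tc (pvar i0) ^ r"
      using fr_nonzero x0 by (simp add: z_def ev_y[OF fr_homogeneous] tc_eq_0_iff)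
    also have "\<dots> = ?e (G b i) + to_field svar * (?e (G a i) + - ?e (G b i))"
      by (simp add: Hs ev_y[OF G_homogeneous] add_divide_distrib diff_divide_distrib[symmetric])
    finally have "\<phi> (z * ?e fr) = \<phi> (?e (G b i) + to_field svar * (?e (G a i) + - ?e (G b i)))" by simp
    then have "fls_const (u i) * ev hF X' fr = ev hF X' (G b i) + (1 - T) * (ev hF X' (G a i) - ev hF X' (G b i))"
      using K' evX(2) by (simp add: hom_on_mult[OF \<phi>(1) K(1)] hom_on_add[OF \<phi>(1) K(1)] hom_on_uminus[OF \<phi>(1) K(1)]
          field_subset_mult[OF K(1)] field_subset_add[OF K(1)] field_subset_uminus[OF K(1)] field_subset_diff[OF K(1)]
          zE s(2) evX(1)[symmetric] del: add_uminus_conv_diff)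
    then show ?thesis by (simp add: algebra_simps)
  qed
  define cj where "cj = (\<lambda>j. fls_const (h (a j)) + T * fls_const (h (b j) - h (a j)))"
  define Q where "Q = (\<lambda>i j. ev hF X' (theta i (f j)) / ev hF X' (f j))"
  have u_eq: "fls_const (u i) = (\<Sum>j<l. cj j * Q i j)" for i
  proof -
    have GX: "ev hF X' (G a' i) = ev hF X' fr * (\<Sum>j<l. hF (a' j) * Q i j)" for a'
      unfolding Q_def by (rule ev_G[OF rhom_hF fX])
    have "ev hF X' fr * fls_const (u i) = ev hF X' fr * (\<Sum>j<l. cj j * Q i j)"
      unfolding mult.commute[of "ev hF X' fr" "fls_const (u i)"] eqn[symmetric] GX cj_def hF_def
      by (simp add: sum_distrib_left sum_subtractf sum.distrib rhomD(6)[OF rhom_fls_const] algebra_simps)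
    then show ?thesis using frX by simp
  qed
  define \<nu> where "\<nu> = (\<lambda>i. fls_subdegree (X' i))"
  define \<mu> where "\<mu> = (\<lambda>j. fls_subdegree (ev hF X' (f j)))"
  \<comment> \<open>The gradient equations are contracted with the logarithmic derivatives of the
    coordinates; by the chain rule the logarithmic derivatives of the f j appear on the
    right.\<close>
  have "(\<Sum>i\<in>UNIV. fls_const (u i) * (fls_deriv (X' i) / X' i)) = (\<Sum>j<l. cj j * (fls_deriv (ev hF X' (f j)) / ev hF X' (f j)))"
  proof -
    have "fls_deriv (ev hF X' (f j)) / ev hF X' (f j) = (\<Sum>i\<in>UNIV. Q i j * (fls_deriv (X' i) / X' i))" for j
    proof -
      have "fls_deriv (ev hF X' (f j)) = (\<Sum>i\<in>UNIV. ev hF X' (theta i (f j)) * (fls_deriv (X' i) / X' i))"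
        by (rule ev_theta_chain[OF rhom_hF _ Xi_nz]) (simp add: hF_def)
      then show ?thesis by (simp add: Q_def sum_divide_distrib mult.commute)
    qed
    then show ?thesis
      by (simp only: u_eq sum_distrib_left sum_distrib_right mult.assoc) (rule sum.swap)
  qed
  then have "(\<Sum>i\<in>UNIV. fls_const (u i) * (fls_deriv (X' i) / X' i)) $$ -1 =
      (\<Sum>j<l. cj j * (fls_deriv (ev hF X' (f j)) / ev hF X' (f j))) $$ -1" by simp
  moreover have "(fls_const (u i) * (fls_deriv (X' i) / X' i)) $$ -1 = u i * of_int (\<nu> i)" for i
    using fls_residue_dlog[of k "u i" 0 "X' i"] k by (simp add: \<nu>_def)
  moreover have "(cj j * (fls_deriv (ev hF X' (f j)) / ev hF X' (f j))) $$ -1 = h (a j) * of_int (\<mu> j)" for j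
    using fls_residue_dlog[of k "h (a j)" _ "ev hF X' (f j)"] k by (simp add: \<mu>_def cj_def T_def)
  ultimately have res: "(\<Sum>i\<in>UNIV. u i * of_int (\<nu> i)) = (\<Sum>j<l. h (a j) * of_int (\<mu> j))"
    by (simp add: fls_nth_sum)
  define w where "w = (\<Sum>j<l. a j * of_int (\<mu> j))"
  have hw: "h w = (\<Sum>j<l. h (a j) * of_int (\<mu> j))" by (simp add: w_def rhomD[OF h] rhom_of_int)
  \<comment> \<open>Subtracting w / \<kappa> makes the relation homogeneous, because the u i add up
    to \<kappa>. Genericity then makes all orders equal, and the normalized coordinate has order
    0.\<close>
  have "(\<Sum>i\<in>UNIV. u i * h (of_int (\<nu> i) - w / \<kappa>)) = h w - (\<Sum>i\<in>UNIV. u i) * h (w / \<kappa>)"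
    by (simp add: rhomD[OF h] rhom_of_int right_diff_distrib sum_subtractf res hw sum_distrib_right)
  also have "\<dots> = 0" using \<kappa> by (simp add: sum_u rhomD(4)[OF h, symmetric])
  finally have lin: "of_int (\<nu> i) - w / \<kappa> = (0::complex)" for i by (rule generic_linear)
  have "\<nu> i0 = 0" by (simp add: \<nu>_def X0)
  then have w0: "w = 0" using lin[of i0] \<kappa> by simp
  then have \<nu>0: "\<nu> i = 0" for i using lin[of i] by simp
  define x where "x = (\<lambda>i. fls_regpart (X' i))"
  have xX: "X' i = fps_to_fls (x i)" for i
    using \<nu>0[of i] by (simp add: x_def \<nu>_def)
  have evx: "ev hF X' p = fps_to_fls (ev hc x p)" for p
    using ev_hom[OF rhom_fps_to_fls rhom_hc, of x p] by (simp add: xX[symmetric] hc_def hF_def[abs_def])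
  have \<mu>_nonneg: "\<mu> j \<ge> 0" for j by (simp add: \<mu>_def evx fls_subdegree_fls_to_fps)
  \<comment> \<open>The weights are complex, so the sum of nonnegative terms is formed from the real
    parts.\<close>
  have "(\<Sum>j<l. Re (a j) * of_int (\<mu> j)) = Re w" by (simp add: w_def)
  then have "(\<Sum>j<l. Re (a j) * of_int (\<mu> j)) = 0" by (simp add: w0)
  moreover have "Re (a j) * of_int (\<mu> j) \<ge> 0" if "j \<in> {..<l}" for j
    using a_pos[of j] \<mu>_nonneg[of j] that by simp
  ultimately have *: "\<forall>j\<in>{..<l}. Re (a j) * of_int (\<mu> j) = 0"
    using sum_nonneg_eq_0_iff[of "{..<l}" "\<lambda>j. Re (a j) * of_int (\<mu> j)"] by simp
  then have \<mu>0: "\<mu> j = 0" if "j < l" for j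
  proof -
    have "Re (a j) * of_int (\<mu> j) = 0" using * that by simp
    with a_pos[OF that] show ?thesis by simp
  qed
  have f0: "ev hc x (f j) $ 0 \<noteq> 0" if "j < l" for j
  proof -
    have "ev hc x (f j) \<noteq> 0" using fX[OF that] by (auto simp: evx)
    moreover have "subdegree (ev hc x (f j)) = 0"
      using \<mu>0[OF that] by (simp add: \<mu>_def evx fls_subdegree_fls_to_fps)
    ultimately show ?thesis using nth_subdegree_nonzero by metis
  qed
  have "arc a b k x"
    unfolding arc_def
  proof (intro conjI allI)
    show "x i0 = 1" by (simp add: x_def X0)
    have "ev hc x fr $ 0 = (\<Prod>j<l. ev hc x (f j) $ 0)"
      unfolding fr_def rhom_prod[OF rhom_ev[OF rhom_hc]] by (rule rhom_prod[OF rhom_nth_0])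
    then show "ev hc x fr $ 0 \<noteq> 0" using f0 by simp
    fix i
    have "fps_to_fls (ev hc x (G a i) + fps_X ^ k * (ev hc x (G b i) - ev hc x (G a i))) = fps_to_fls (fps_const (u i) * ev hc x fr)"
      using eqn[of i] by (simp add: evx T_def rhomD[OF rhom_fps_to_fls] del: fps_to_fls_eq_iff)
    then show "ev hc x (G a i) + fps_X ^ k * (ev hc x (G b i) - ev hc x (G a i)) = fps_const (u i) * ev hc x fr"
      by (simp only: fps_to_fls_eq_iff)
  qed
  then show ?thesis using xX by (auto simp: X'_def)
qed

text \<open>Three counts are chained: m is at most the size of a spanning set of K over
  \<open>E\<close>, this is at most the number of embeddings, and distinct embeddings have distinct
  limits in the fibre of a. Any m of these limits give forms that are independent for a.\<close>

lemma indep_forms_transfer: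
  assumes A: "\<And>i. i < m \<Longrightarrow> homogeneous c (A i)" and indep: "indep_forms (G b) m A"
  shows "\<exists>A' c'. (\<forall>i<m. homogeneous c' (A' i)) \<and> indep_forms (G a) m A'"
proof -
  obtain xs where xs: "set xs = (UNIV :: 'n set)" using finite_list[OF finite] by blast
  have alg: "\<forall>z\<in>set (map y xs). algebraic_over E z" using y_algebraic by auto
  obtain K k \<Phi> B where KK: "field_subset K \<and> E \<subseteq> K \<and> set (map y xs) \<subseteq> K \<and> k > 0 \<and> finite \<Phi> \<and>
    (\<forall>\<phi>\<in>\<Phi>. hom_on K \<phi> \<and> (\<forall>z\<in>E. \<phi> z = fls_compose_power (\<iota> z) k)) \<and>
    inj_on (\<lambda>\<phi>. map \<phi> (map y xs)) \<Phi> \<and> finite B \<and> card B \<le> card \<Phi> \<and> K \<subseteq> lin_span E B"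
    using embeddings_into_puiseux[where ys = "map y xs", OF quot.field_subset_quotients quot.hom_on_transfer alg] by (elim exE) (rule that)
  then have K: "field_subset K" "E \<subseteq> K" and yK: "y i \<in> K" and k: "k > 0" and \<Phi>: "finite \<Phi>"
    and \<phi>: "\<And>\<phi>. \<phi> \<in> \<Phi> \<Longrightarrow> hom_on K \<phi>" "\<And>\<phi> z. \<phi> \<in> \<Phi> \<Longrightarrow> z \<in> E \<Longrightarrow> \<phi> z = fls_compose_power (\<iota> z) k"
    and inj: "inj_on (\<lambda>\<phi>. map \<phi> (map y xs)) \<Phi>"
    and B: "finite B" "card B \<le> card \<Phi>" "K \<subseteq> lin_span E B" for i
    using xs by auto
  have "\<forall>\<phi>\<in>\<Phi>. \<exists>x. arc a b k x \<and> (\<forall>i. \<phi> (y i) = fps_to_fls (x i))"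
  proof
    fix \<phi> assume "\<phi> \<in> \<Phi>"
    then show "\<exists>x. arc a b k x \<and> (\<forall>i. \<phi> (y i) = fps_to_fls (x i))"
      using \<phi> by (intro embedding_arc[OF K yK k]) auto
  qed
  then obtain x where x: "\<And>\<phi>. \<phi> \<in> \<Phi> \<Longrightarrow> arc a b k (x \<phi>)" "\<And>\<phi> i. \<phi> \<in> \<Phi> \<Longrightarrow> \<phi> (y i) = fps_to_fls (x \<phi> i)"
    by metis
  define S where "S = (\<lambda>\<phi> i. x \<phi> i $ 0) ` \<Phi>"
  \<comment> \<open>Equal limits give equal arcs by \<open>arc_unique\<close>, and the embeddings
    are separated by their values on y.\<close>
  have "inj_on (\<lambda>\<phi> i. x \<phi> i $ 0) \<Phi>"
  proof (rule inj_onI)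
    fix \<phi> \<psi> assume *: "\<phi> \<in> \<Phi>" "\<psi> \<in> \<Phi>" "(\<lambda>i. x \<phi> i $ 0) = (\<lambda>i. x \<psi> i $ 0)"
    have "x \<phi> = x \<psi>"
      by (rule arc_unique[OF x(1)[OF *(1)] x(1)[OF *(2)]]) (use k *(3) in \<open>auto simp: fun_eq_iff\<close>)
    then have "\<phi> (y i) = \<psi> (y i)" for i using x(2)[OF *(1), of i] x(2)[OF *(2), of i] by simp
    then have "map \<phi> (map y xs) = map \<psi> (map y xs)" by simp
    then show "\<phi> = \<psi>" using inj * by (auto dest: inj_onD)
  qed
  then have card_S: "card S = card \<Phi>" "finite S" using \<Phi> by (simp_all add: S_def card_image)
  have sol: "solution a z" if "z \<in> S" for z
    using that arc_imp_solution[OF x(1)] k by (auto simp: S_def)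
  \<comment> \<open>Otherwise the dehomogenized forms would be dependent over \<open>E\<close>.
    Clearing denominators would give a relation for generic s, which
    \<open>indep_forms_deform\<close> excludes.\<close>
  have "m \<le> card \<Phi>"
  proof (rule ccontr)
    assume "\<not> m \<le> card \<Phi>"
    then have mB: "card B < card {..<m}" using B by simp
    define z where "z = (\<lambda>i. ev (\<lambda>c. tc (pconst c)) y (A i))"
    have x0: "tc (pvar i0) \<noteq> 0" by (simp add: tc_eq_0_iff pvar_nonzero)
    have zA: "z i = tc (A i) / tc (pvar i0) ^ c" if "i < m" for i
      unfolding z_def using A[OF that] by (rule ev_y)
    have cK: "tc (pconst c) \<in> K" for c
    proof -
      have "to_field (N [:pconst c:]) \<in> E" by (intro quot.quotientsI0 homogeneous_coeffs_const homogeneous_pconst)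
      then show ?thesis using K(2) by (auto simp: N_const ev_pconst[OF rhom_cst] tc_def)
    qed
    have id: "hom_on K (\<lambda>z. z)" by (simp add: hom_on_def)
    have "z i \<in> K" for i
      unfolding z_def using hom_on_ev(1)[where \<kappa> = "\<lambda>c. tc (pconst c)" and x = y, OF id K(1) cK yK] .
    then have "z i \<in> lin_span E B" if "i \<in> {..<m}" for i using B(3) by blast
    from lin_span_dependent[OF quot.field_subset_quotients B(1) _ mB, of z, OF _ this]
    obtain g where g: "\<forall>i\<in>{..<m}. g i \<in> E" "\<exists>i\<in>{..<m}. g i \<noteq> 0" "(\<Sum>i<m. g i * z i) = 0" by auto
    have "\<forall>i<m. g i \<in> E" using g(1) by simp
    then obtain D R W where R_hom: "\<And>i. i < m \<Longrightarrow> homogeneous_coeffs D (R i)" and W: "W \<noteq> 0"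
      and gR: "\<And>i. i < m \<Longrightarrow> to_field (N (R i)) = W * g i" by (rule quot.common_denominator) blast
    have "to_field (\<Sum>i<m. N (R i) * [:A i:]) = (\<Sum>i<m. W * g i * (tc (pvar i0) ^ c * z i))"
      unfolding rhomD(7)[OF rhom_to_field] rhomD(4)[OF rhom_to_field] tc_def[symmetric]
      by (intro sum.cong refl) (use x0 in \<open>simp add: gR zA\<close>)
    also have "\<dots> = W * tc (pvar i0) ^ c * (\<Sum>i<m. g i * z i)" by (simp add: sum_distrib_left mult_ac)
    finally have "(\<Sum>i<m. N (R i) * [:A i:]) = 0" using g(3) by (simp add: to_field_eq_0_iff)
    moreover have "indep_forms (\<lambda>i. poly (H i) 0) m A" using indep by (simp add: H_def)
    ultimately have R0: "R i = 0" if "i < m" for i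
      using indep_forms_deform[of H m A D R i] R_hom that by (simp add: N_def)
    obtain i where i: "i < m" "g i \<noteq> 0" using g(2) by auto
    have "W * g i = 0" using gR[OF i(1)] R0[OF i(1)] by (simp add: rhomD[OF rhom_N] rhomD[OF rhom_to_field])
    then show False using W i by simp
  qed
  then obtain S' where S': "S' \<subseteq> S" "card S' = m" "finite S'"
    using obtain_subset_with_card_n[of m S] card_S by metis
  then show ?thesis using solutions_imp_indep_forms[of S' a] sol by auto
qed

end

section \<open>The degree of the toric polar map\<close>

text \<open>Lets dimensions of M over two unrelated subfields be compared without relating their
  bases: this set determines a finite dimension.\<close>

definition indep_sizes :: "'a::field set \<Rightarrow> 'a set \<Rightarrow> nat set" where
  "indep_sizes K M = {m. \<exists>v. (\<forall>i<m. v i \<in> M) \<and>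
    (\<forall>c. (\<forall>i<m. c i \<in> K) \<and> (\<Sum>i<m. c i * v i) = 0 \<longrightarrow> (\<forall>i<m. c i = 0))}"

context
  fixes ty :: "'a::field itself"
begin

interpretation R: field "ring_of_type_algebra :: 'a ring"
  by (rule field_from_type_algebra)

lemma ring_of_type_algebra_simps:
  "carrier (ring_of_type_algebra :: 'a ring) = UNIV"
  "x \<otimes>\<^bsub>ring_of_type_algebra\<^esub> (y :: 'a) = x * y"
  "x \<oplus>\<^bsub>ring_of_type_algebra\<^esub> (y :: 'a) = x + y"
  "\<one>\<^bsub>ring_of_type_algebra\<^esub> = (1 :: 'a)"
  "\<zero>\<^bsub>ring_of_type_algebra\<^esub> = (0 :: 'a)"
  by (simp_all add: ring_of_type_algebra_def)

lemma subfield_ring_of_type_algebra: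
  assumes K: "field_subset (K :: 'a set)"
  shows "subfield K ring_of_type_algebra"
proof (rule R.subfieldI')
  show "subring K ring_of_type_algebra"
  proof (rule R.subringI)
    fix x assume "x \<in> K"
    moreover have "\<ominus>\<^bsub>ring_of_type_algebra\<^esub> x = - x"
      by (rule R.minus_equality) (simp_all add: ring_of_type_algebra_simps)
    ultimately show "\<ominus>\<^bsub>ring_of_type_algebra\<^esub> x \<in> K" using field_subset_uminus[OF K] by simp
  qed (simp_all add: ring_of_type_algebra_simps field_subset_1[OF K] field_subset_add[OF K] field_subset_mult[OF K])
next
  fix k assume k: "k \<in> K - {\<zero>\<^bsub>ring_of_type_algebra\<^esub>}"
  then have "inv\<^bsub>ring_of_type_algebra\<^esub> k = inverse k"
    by (intro R.comm_inv_char) (simp_all add: ring_of_type_algebra_simps)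
  then show "inv\<^bsub>ring_of_type_algebra\<^esub> k \<in> K" using field_subset_inverse[OF K] k by simp
qed

text \<open>\<open>combine\<close> stops at the end of the shorter list, hence the coefficient 0
  past the end of \<open>Ks\<close>.\<close>

lemma combine_ring_of_type_algebra:
  "R.combine Ks Us = (\<Sum>i<length Us. (if i < length Ks then Ks ! i else 0) * Us ! i)"
proof (induction Ks Us rule: R.combine.induct)
  case (1 k Ks u Us)
  show ?case
    by (simp add: 1 ring_of_type_algebra_simps sum.lessThan_Suc_shift del: sum.lessThan_Suc cong: if_cong)
qed (simp_all add: ring_of_type_algebra_simps)

lemma independent_ring_of_type_algebra:
  assumes K: "field_subset K"
  shows "R.independent K Us \<longleftrightarrow> (\<forall>c. (\<forall>i<length Us. c i \<in> K) \<and> (\<Sum>i<length Us. c i * Us ! i) = 0 \<longrightarrow> (\<forall>i<length Us. c i = 0))"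
proof (intro iffI allI impI, elim conjE)
  fix c i assume ind: "R.independent K Us" and c: "\<forall>i<length Us. c i \<in> K"
    and sum: "(\<Sum>i<length Us. c i * Us ! i) = 0" and i: "i < length Us"
  define Ks where "Ks = map c [0..<length Us]"
  have "set Ks \<subseteq> K" using c by (auto simp: Ks_def)
  moreover have "R.combine Ks Us = \<zero>\<^bsub>ring_of_type_algebra\<^esub>"
    using sum by (simp add: combine_ring_of_type_algebra Ks_def ring_of_type_algebra_simps)
  ultimately have "set (take (length Us) Ks) \<subseteq> {\<zero>\<^bsub>ring_of_type_algebra\<^esub>}"
    by (rule R.independent_imp_trivial_combine[OF subfield_ring_of_type_algebra[OF K] ind])
  then show "c i = 0" using i by (auto simp: Ks_def ring_of_type_algebra_simps image_subset_iff)
next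
  assume *: "\<forall>c. (\<forall>i<length Us. c i \<in> K) \<and> (\<Sum>i<length Us. c i * Us ! i) = 0 \<longrightarrow> (\<forall>i<length Us. c i = 0)"
  show "R.independent K Us"
  proof (rule R.trivial_combine_imp_independent[OF subfield_ring_of_type_algebra[OF K]])
    show "set Us \<subseteq> carrier ring_of_type_algebra" by (simp add: ring_of_type_algebra_simps)
    fix Ks assume Ks: "set Ks \<subseteq> K" and "R.combine Ks Us = \<zero>\<^bsub>ring_of_type_algebra\<^esub>"
    then have "(\<Sum>i<length Us. (if i < length Ks then Ks ! i else 0) * Us ! i) = 0"
      by (simp only: combine_ring_of_type_algebra ring_of_type_algebra_simps)
    moreover have "\<forall>i<length Us. (if i < length Ks then Ks ! i else 0) \<in> K"
      using Ks field_subset_0[OF K] by (auto simp: subset_iff)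
    ultimately have "\<forall>i<length Us. (if i < length Ks then Ks ! i else 0) = 0"
      using *[rule_format, of "\<lambda>i. if i < length Ks then Ks ! i else 0"] by blast
    then have "Ks ! i = 0" if "i < length Ks" "i < length Us" for i using that by force
    then show "set (take (length Us) Ks) \<subseteq> {\<zero>\<^bsub>ring_of_type_algebra\<^esub>}"
      by (auto simp: ring_of_type_algebra_simps in_set_conv_nth)
  qed
qed

lemma indep_sizes_iff:
  assumes K: "field_subset K"
  shows "m \<in> indep_sizes K M \<longleftrightarrow> (\<exists>Us. length Us = m \<and> set Us \<subseteq> M \<and> R.independent K Us)"
proof
  assume "m \<in> indep_sizes K M"
  then obtain v where "\<forall>i<m. v i \<in> M"
    "\<forall>c. (\<forall>i<m. c i \<in> K) \<and> (\<Sum>i<m. c i * v i) = 0 \<longrightarrow> (\<forall>i<m. c i = 0)" by (auto simp: indep_sizes_def)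
  then show "\<exists>Us. length Us = m \<and> set Us \<subseteq> M \<and> R.independent K Us"
    by (intro exI[of _ "map v [0..<m]"]) (auto simp: independent_ring_of_type_algebra[OF K])
next
  assume "\<exists>Us. length Us = m \<and> set Us \<subseteq> M \<and> R.independent K Us"
  then obtain Us where "length Us = m" "set Us \<subseteq> M" "R.independent K Us" by blast
  then show "m \<in> indep_sizes K M"
    unfolding indep_sizes_def by (intro CollectI exI[of _ "\<lambda>i. Us ! i"]) (auto simp: independent_ring_of_type_algebra[OF K])
qed

text \<open>A base over K shows that n is a size and n + 1 is not. So there is an independent family
  of n elements over K', and an element of M outside its span would extend it to n + 1.\<close>

lemma dimension_transfer:
  assumes K: "field_subset K" and K': "field_subset K'"
    and M: "0 \<in> M" "\<And>x y. x \<in> M \<Longrightarrow> y \<in> M \<Longrightarrow> x + y \<in> M" "\<And>k x. k \<in> K' \<Longrightarrow> x \<in> M \<Longrightarrow> k * x \<in> M"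
    and sizes: "indep_sizes K M = indep_sizes K' M" and dim: "R.dimension n K M"
  shows "R.dimension n K' M"
proof -
  have carr: "set Us \<subseteq> carrier ring_of_type_algebra" for Us :: "'a list" by (simp add: ring_of_type_algebra_simps)
  note sK = subfield_ring_of_type_algebra[OF K] and sK' = subfield_ring_of_type_algebra[OF K']
  obtain Vs where Vs: "R.independent K Vs" "length Vs = n" "R.Span K Vs = M"
    using R.exists_base[OF sK dim] by blast
  then have "set Vs \<subseteq> M" using R.Span_base_incl[OF sK carr] by blast
  then have "n \<in> indep_sizes K' M" using Vs indep_sizes_iff[OF K] sizes by blast
  then obtain Us where Us: "length Us = n" "set Us \<subseteq> M" "R.independent K' Us"
    using indep_sizes_iff[OF K'] by blast
  have "R.Span K' Us \<subseteq> M"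
  proof
    fix z assume "z \<in> R.Span K' Us"
    then obtain Ks where Ks: "set Ks \<subseteq> K'" "z = R.combine Ks Us"
      using R.Span_eq_combine_set[OF sK' carr] by blast
    have sum_M: "(\<Sum>i\<in>S. g i) \<in> M" if "\<And>i. i \<in> S \<Longrightarrow> g i \<in> M" for S and g :: "nat \<Rightarrow> 'a"
      using that by (induction S rule: infinite_finite_induct) (auto intro: M)
    then show "z \<in> M"
      unfolding Ks(2) combine_ring_of_type_algebra
      using Ks(1) Us(2) field_subset_0[OF K'] by (intro sum_M M(3)) (auto simp: subset_iff)
  qed
  moreover have "M \<subseteq> R.Span K' Us"
  proof (rule subsetI, rule ccontr)
    fix v assume v: "v \<in> M" "v \<notin> R.Span K' Us"
    then have "R.independent K' (v # Us)" using Us(3) by (intro R.li_Cons) (simp_all add: ring_of_type_algebra_simps)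
    then have "Suc n \<in> indep_sizes K M"
      unfolding sizes using v Us indep_sizes_iff[OF K'] by (metis insert_subset length_Cons list.simps(15))
    then obtain Ws where "length Ws = Suc n" "set Ws \<subseteq> M" "R.independent K Ws" using indep_sizes_iff[OF K] by blast
    then show False using R.independent_length_le_dimension[OF sK dim] by fastforce
  qed
  ultimately show ?thesis using R.dimension_independent[OF Us(3)] Us(1) by simp
qed

text \<open>\<open>dim\<close> is defined from the predicate \<open>dimension\<close>, so agreement
  of the predicates for every n suffices. This also covers the case without a finite
  dimension.\<close>

lemma ring_dim_cong:
  fixes K K' M :: "'a set"
  assumes K: "field_subset K" and K': "field_subset K'"
    and M: "0 \<in> M" "\<And>x y. x \<in> M \<Longrightarrow> y \<in> M \<Longrightarrow> x + y \<in> M"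
      "\<And>k x. k \<in> K \<Longrightarrow> x \<in> M \<Longrightarrow> k * x \<in> M" "\<And>k x. k \<in> K' \<Longrightarrow> x \<in> M \<Longrightarrow> k * x \<in> M"
    and sizes: "indep_sizes K M = indep_sizes K' M"
  shows "ring.dim ring_of_type_algebra K M = ring.dim ring_of_type_algebra K' M"
proof -
  have "R.dimension n K M \<longleftrightarrow> R.dimension n K' M" for n
    using dimension_transfer[OF K K' M(1,2,4) sizes] dimension_transfer[OF K' K M(1,2,3) sizes[symmetric]] by blast
  then show ?thesis unfolding R.dim_def by simp
qed

end

section \<open>Dominance and pullback for proportional tuples\<close>

text \<open>The algebraic form of dominance. It does not mention points and therefore passes easily
  between proportional tuples.\<close>

definition nondegenerate :: "('n::finite \<Rightarrow> 'n cpoly) \<Rightarrow> bool" where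
  "nondegenerate F \<longleftrightarrow> (\<forall>d P. homogeneous d P \<and> psubst P F = 0 \<longrightarrow> P = 0)"

lemma psubst_0: "psubst 0 F = 0"
  by (simp add: psubst_def)

lemma psubst_proportional:
  assumes pq: "\<And>i. p * F i = q * F' i" and P: "homogeneous d P"
  shows "p ^ d * psubst P F = q ^ d * psubst P F'"
  using ev_scale[OF rhom_pconst P, of p F] ev_scale[OF rhom_pconst P, of q F'] by (simp add: psubst_eq_ev pq)

text \<open>Proportional tuples define the same rational map: p^d P(F) = q^d P(F') for forms P of
  degree d, and the factors depend only on d, so they cancel in quotients.\<close>

lemma
  fixes F F' :: "'n::{finite,linorder} \<Rightarrow> 'n cpoly"
  assumes pq: "\<And>i. p * F i = q * F' i" "p \<noteq> 0" "q \<noteq> 0"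
  shows nondegenerate_proportional: "nondegenerate F \<longleftrightarrow> nondegenerate F'"
    and pullback_field_proportional: "pullback_field F = pullback_field F'"
proof -
  have z: "psubst P F = 0 \<longleftrightarrow> psubst P F' = 0" if "homogeneous d P" for d P
  proof -
    have "p ^ d * psubst P F = 0 \<longleftrightarrow> q ^ d * psubst P F' = 0" using psubst_proportional[OF pq(1) that] by simp
    then show ?thesis using pq(2,3) by simp
  qed
  then show "nondegenerate F \<longleftrightarrow> nondegenerate F'" unfolding nondegenerate_def by blast
  have "Fract (psubst P F) (psubst Q F) = Fract (psubst P F') (psubst Q F')"
    if PQ: "homogeneous d P" "homogeneous d Q" "psubst Q F \<noteq> 0" for d P Q
  proof -
    have "p ^ d * q ^ d * (psubst P F * psubst Q F') = (p ^ d * psubst P F) * (q ^ d * psubst Q F')"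
      by (simp only: mult_ac)
    also have "\<dots> = (q ^ d * psubst P F') * (p ^ d * psubst Q F)"
      by (simp only: psubst_proportional[OF pq(1) PQ(1)] psubst_proportional[OF pq(1) PQ(2)])
    also have "\<dots> = p ^ d * q ^ d * (psubst P F' * psubst Q F)" by (simp only: mult_ac)
    finally have "psubst P F * psubst Q F' = psubst P F' * psubst Q F" using pq(2,3) by simp
    then show ?thesis using PQ z[OF PQ(2)] by (simp add: eq_fract)
  qed
  then show "pullback_field F = pullback_field F'"
    unfolding pullback_field_def using z by (intro Collect_cong iff_exI) metis
qed

text \<open>The points that \<open>rat_map_image\<close> leaves out, where all coordinates of the
  map vanish, need care. A form of positive degree vanishes at the zero vector anyway. For a
  constant form the image must be nonempty, and by Euler's formula the map is defined wherever f
  does not vanish.\<close>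

lemma dominant_iff_nondegenerate:
  fixes f :: "'n::{finite,linorder} cpoly"
  assumes f: "f \<noteq> 0" "homogeneous k f" "k \<ge> 1"
  shows "dominant (toric_polar_map f) \<longleftrightarrow> nondegenerate (toric_polar_map f)"
proof -
  let ?F = "toric_polar_map f"
  have pe: "peval (psubst G ?F) x = peval G (\<lambda>i. peval (?F i) x)" for G x
    unfolding peval_eq_ev by (rule ev_psubst[OF rhom_id])
  have peval_zero: "peval p (\<lambda>_. 0) = 0" if "homogeneous d p" "d \<ge> 1" for d and p :: "'n cpoly"
    using ev_scale[OF rhom_id that(1), of 0 "\<lambda>_. 0"] that(2) by (simp add: peval_eq_ev power_0_left)
  have F_hom: "homogeneous k (?F i)" for i
    unfolding toric_polar_map_eq by (rule homogeneous_theta[OF f(2)])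
  obtain x0 where x0: "peval f x0 \<noteq> 0" using peval_nonzero[OF f(1)] by blast
  have F_sum: "(\<Sum>i\<in>UNIV. peval (?F i) x0) = of_nat k * peval f x0"
    using arg_cong[OF euler_homogeneous[OF f(2)], of "\<lambda>p. peval p x0"]
    by (simp add: toric_polar_map_eq peval_eq_ev rhomD[OF rhom_ev[OF rhom_id]] rhom_of_nat[OF rhom_ev[OF rhom_id]])
  have "(\<forall>y\<in>rat_map_image ?F. peval G y = 0) \<longleftrightarrow> psubst G ?F = 0" if G: "homogeneous d G" for d G
  proof
    assume *: "psubst G ?F = 0"
    show "\<forall>y\<in>rat_map_image ?F. peval G y = 0"
      using pe[of G] by (auto simp: rat_map_image_def * peval_eq_ev[of 0] rhomD[OF rhom_ev[OF rhom_id]])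
  next
    assume *: "\<forall>y\<in>rat_map_image ?F. peval G y = 0"
    have zero: "peval G (\<lambda>i. peval (?F i) x) = 0" if "(\<lambda>i. peval (?F i) x) \<noteq> (\<lambda>_. 0)" for x
    proof -
      have "x \<noteq> (\<lambda>_. 0)" using that peval_zero[OF F_hom f(3)] by auto
      then have "(\<lambda>i. peval (?F i) x) \<in> rat_map_image ?F" using that by (auto simp: rat_map_image_def)
      then show ?thesis using * by blast
    qed
    show "psubst G ?F = 0"
    proof (rule ccontr)
      assume "psubst G ?F \<noteq> 0"
      then obtain x where x: "peval G (\<lambda>i. peval (?F i) x) \<noteq> 0" using peval_nonzero pe by metis
      then have x_zero: "(\<lambda>i. peval (?F i) x) = (\<lambda>_. 0)" using zero by blast
      then have "d = 0" using x peval_zero[OF G] by (cases d) auto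
      then have const: "peval G y = peval G (\<lambda>_. 0)" for y
        using ev_scale[OF rhom_id G, of 0 y] by (simp add: peval_eq_ev)
      have "(\<lambda>i. peval (?F i) x0) \<noteq> (\<lambda>_. 0)"
      proof
        assume "(\<lambda>i. peval (?F i) x0) = (\<lambda>_. 0)"
        then have "peval (?F i) x0 = 0" for i by (rule fun_cong)
        then show False using F_sum x0 f(3) by simp
      qed
      then have "peval G (\<lambda>i. peval (?F i) x0) = 0" by (rule zero)
      then show False using x const by metis
    qed
  qed
  then show ?thesis unfolding dominant_def nondegenerate_def by metis
qed

lemma graded_hom_psubst:
  fixes F :: "'n::{finite,linorder} \<Rightarrow> 'n cpoly"
  assumes "nondegenerate F"
  shows "graded_hom homogeneous (\<lambda>P. to_field (psubst P F))"
proof unfold_locales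
  show "rhom (\<lambda>P. to_field (psubst P F))"
    unfolding psubst_eq_ev by (rule rhom_comp[OF rhom_to_field rhom_ev[OF rhom_pconst]])
qed (use assms in \<open>auto simp: nondegenerate_def to_field_eq_0_iff homogeneous_0 homogeneous_1
    homogeneous_add homogeneous_uminus homogeneous_mult\<close>)

lemma pullback_field_eq:
  assumes "nondegenerate F"
  shows "pullback_field F = graded_hom.quotients homogeneous (\<lambda>P. to_field (psubst P F))"
proof -
  have "psubst Q F \<noteq> 0 \<longleftrightarrow> Q \<noteq> 0" if "homogeneous d Q" for d Q
    using assms that by (auto simp: nondegenerate_def psubst_0)
  then show ?thesis
    unfolding pullback_field_def graded_hom.quotients_def[OF graded_hom_psubst[OF assms]]
    by (intro Collect_cong iff_exI) (auto simp: to_field_def)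
qed

interpretation proj: graded_hom "homogeneous :: nat \<Rightarrow> 'n::{finite,linorder} cpoly \<Rightarrow> bool" to_field
  by unfold_locales (auto simp: rhom_to_field to_field_eq_0_iff homogeneous_0 homogeneous_1
    homogeneous_add homogeneous_uminus homogeneous_mult)

lemma proj_function_field_eq: "proj_function_field = proj.quotients"
  unfolding proj_function_field_def proj.quotients_def by (auto simp: to_field_def)

lemma pullback_field_subset:
  assumes F: "nondegenerate F" "\<And>i. homogeneous r (F i)"
  shows "pullback_field F \<subseteq> proj_function_field"
proof
  interpret pull: graded_hom homogeneous "\<lambda>P. to_field (psubst P F)" by (rule graded_hom_psubst[OF F(1)])
  fix z assume "z \<in> pullback_field F"
  then have "z \<in> pull.quotients" by (simp add: pullback_field_eq[OF F(1)])
  then obtain P Q d where 1: "homogeneous d P" "homogeneous d Q" "z = to_field (psubst P F) / to_field (psubst Q F)"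
    "to_field (psubst Q F) \<noteq> 0" by (rule pull.quotientsE)
  then show "z \<in> proj_function_field"
    using proj.quotientsI[OF homogeneous_psubst[OF 1(1) F(2)] homogeneous_psubst[OF 1(2) F(2)]]
    by (simp add: proj_function_field_eq to_field_eq_0_iff)
qed

text \<open>Denominators are cleared in both directions; powers of one variable serve as
  denominators that turn forms into elements of the function fields.\<close>

lemma indep_sizes_iff_indep_forms:
  fixes F :: "'n::{finite,linorder} \<Rightarrow> 'n cpoly"
  assumes F: "nondegenerate F"
  shows "m \<in> indep_sizes (pullback_field F) proj_function_field \<longleftrightarrow>
    (\<exists>A c. (\<forall>i<m. homogeneous c (A i)) \<and> indep_forms F m A)"
proof -
  interpret pull: graded_hom homogeneous "\<lambda>P. to_field (psubst P F)" by (rule graded_hom_psubst[OF F])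
  define xp where "xp = (\<lambda>d. pvar undefined ^ d :: 'n cpoly)"
  have pvar_pow: "homogeneous d (xp d)" "xp d \<noteq> 0" for d
    using homogeneous_power[OF homogeneous_pvar[of undefined], of d] by (simp_all add: xp_def pvar_nonzero)
  show ?thesis
    unfolding pullback_field_eq[OF F] proj_function_field_eq
  proof
    assume "m \<in> indep_sizes pull.quotients proj.quotients"
    then obtain v where v: "\<forall>i<m. v i \<in> proj.quotients"
      and ind: "\<And>c. \<lbrakk>\<forall>i<m. c i \<in> pull.quotients; (\<Sum>i<m. c i * v i) = 0\<rbrakk> \<Longrightarrow> \<forall>i<m. c i = 0"
      unfolding indep_sizes_def by blast
    obtain D A W where A: "\<And>i. i < m \<Longrightarrow> homogeneous D (A i)" and W: "W \<noteq> 0"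
      and vA: "\<And>i. i < m \<Longrightarrow> to_field (A i) = W * v i" using proj.common_denominator[OF v] by blast
    have "indep_forms F m A"
      unfolding indep_forms_def
    proof (intro allI impI, elim conjE)
      fix d P i assume P: "\<forall>i<m. homogeneous d (P i)" and rel: "(\<Sum>i<m. psubst (P i) F * A i) = 0" and i: "i < m"
      define c where "c = (\<lambda>i. to_field (psubst (P i) F) / to_field (psubst (xp d) F))"
      have xp0: "to_field (psubst (xp d) F) \<noteq> 0" using pull.nonzero[OF pvar_pow] .
      have cK: "\<forall>i<m. c i \<in> pull.quotients" using pull.quotientsI[OF _ pvar_pow] P by (simp add: c_def)
      have "to_field (\<Sum>i<m. psubst (P i) F * A i) = (\<Sum>i<m. W * to_field (psubst (xp d) F) * (c i * v i))"
        unfolding rhomD(7)[OF rhom_to_field]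
        by (intro sum.cong refl) (use xp0 in \<open>simp add: rhomD(4)[OF rhom_to_field] vA c_def\<close>)
      then have "W * to_field (psubst (xp d) F) * (\<Sum>i<m. c i * v i) = 0"
        by (simp add: rel rhomD[OF rhom_to_field] sum_distrib_left)
      then have "c i = 0" using ind[OF cK] i xp0 W by simp
      then have "to_field (psubst (P i) F) = 0" using xp0 by (simp add: c_def)
      then show "P i = 0" using pull.nonzero P i by blast
    qed
    then show "\<exists>A c. (\<forall>i<m. homogeneous c (A i)) \<and> indep_forms F m A" using A by blast
  next
    assume "\<exists>A c. (\<forall>i<m. homogeneous c (A i)) \<and> indep_forms F m A"
    then obtain A c where A: "\<forall>i<m. homogeneous c (A i)" and ind: "indep_forms F m A" by blast
    have xp0: "to_field (xp c) \<noteq> 0" using proj.nonzero[OF pvar_pow] .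
    define v where "v = (\<lambda>i. to_field (A i) / to_field (xp c))"
    have "g i = 0" if g: "\<forall>i<m. g i \<in> pull.quotients" "(\<Sum>i<m. g i * v i) = 0" and i: "i < m" for g i
    proof -
      obtain D R W where R: "\<And>i. i < m \<Longrightarrow> homogeneous D (R i)" and W: "W \<noteq> 0"
        and gR: "\<And>i. i < m \<Longrightarrow> to_field (psubst (R i) F) = W * g i" using pull.common_denominator[OF g(1)] by blast
      have "to_field (\<Sum>i<m. psubst (R i) F * A i) = (\<Sum>i<m. W * to_field (xp c) * (g i * v i))"
        unfolding rhomD(7)[OF rhom_to_field]
        by (intro sum.cong refl) (use xp0 in \<open>simp add: rhomD(4)[OF rhom_to_field] gR v_def\<close>)
      also have "\<dots> = 0" using g(2) by (simp flip: sum_distrib_left)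
      finally have "(\<Sum>i<m. psubst (R i) F * A i) = 0" by (simp add: to_field_eq_0_iff)
      then have "R i = 0" using ind i R unfolding indep_forms_def by blast
      then show ?thesis using gR[OF i] W by (simp add: psubst_0 rhomD[OF rhom_to_field])
    qed
    moreover have "\<forall>i<m. v i \<in> proj.quotients"
      using A proj.quotientsI[OF _ pvar_pow] by (simp add: v_def)
    ultimately show "m \<in> indep_sizes pull.quotients proj.quotients"
      unfolding indep_sizes_def by blast
  qed
qed

lemma rhom_to_ac: "rhom to_ac"
  by (simp add: hom_on_def)

section \<open>Changing the weights\<close>

context log_family
begin

lemma indep_forms_change_weights:
  assumes r: "r \<ge> 1" and a: "\<And>j. j < l \<Longrightarrow> Re (a j) > 0"
    and \<kappa>: "(\<Sum>j<l. a j * of_nat (e j)) = \<kappa>" "(\<Sum>j<l. b j * of_nat (e j)) = \<kappa>" "\<kappa> \<noteq> 0"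
    and b: "nondegenerate (G b)" and A: "\<forall>i<m. homogeneous c (A i)" "indep_forms (G b) m A"
  shows "\<exists>A' c'. (\<forall>i<m. homogeneous c' (A' i)) \<and> indep_forms (G a) m A'"
proof -
  define h where "h = (\<lambda>c. to_ac (to_field (pconst c :: 'n cpoly)))"
  \<comment> \<open>Scaling the coordinates by w gives them the sum \<kappa> dictated by Euler's
    formula. A form at the scaled point is a power of w times the form itself, so genericity is
    preserved.\<close>
  define w where "w = to_field (pconst \<kappa>) / to_field (\<Sum>i\<in>UNIV. pvar i :: 'n cpoly)"
  define u where "u = (\<lambda>i :: 'n. to_ac (w * to_field (pvar i)))"
  have h: "rhom h"
    unfolding h_def by (rule rhom_comp[OF rhom_to_ac rhom_comp[OF rhom_to_field rhom_pconst]])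
  have pconst0: "pconst \<kappa> \<noteq> 0" using \<kappa>(3) by (simp add: pconst_eq_0_iff)
  have sum0: "(\<Sum>i\<in>UNIV. pvar i :: 'n cpoly) \<noteq> 0"
  proof
    assume "(\<Sum>i\<in>UNIV. pvar i :: 'n cpoly) = 0"
    then have "ev (\<lambda>c. c) (\<lambda>_. 1) (\<Sum>i\<in>UNIV. pvar i :: 'n cpoly) = 0" by (simp add: rhomD[OF rhom_ev[OF rhom_id]])
    then show False by (simp add: rhomD[OF rhom_ev[OF rhom_id]] ev_pvar[OF rhom_id])
  qed
  have w: "w \<noteq> 0" using pconst0 sum0 by (simp add: w_def to_field_eq_0_iff)
  have generic: "P = 0" if P: "homogeneous d P" "ev h u P = 0" for d P
  proof -
    have tp: "rhom (\<lambda>c. to_field (pconst c :: 'n cpoly))" by (rule rhom_comp[OF rhom_to_field rhom_pconst])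
    have "ev h u P = to_ac (ev (\<lambda>c. to_field (pconst c)) (\<lambda>i. w * to_field (pvar i)) P)"
      using ev_hom[OF rhom_to_ac tp, of "\<lambda>i. w * to_field (pvar i)" P] by (simp add: h_def[abs_def] u_def[abs_def])
    also have "ev (\<lambda>c. to_field (pconst c)) (\<lambda>i. w * to_field (pvar i)) P = w ^ d * to_field P"
      using ev_scale[OF tp P(1), of w "\<lambda>i. to_field (pvar i)"] ev_hom[OF rhom_to_field rhom_pconst, of pvar P]
      by (simp add: ev_pvar_id)
    finally show ?thesis using P(2) w by (simp add: to_field_eq_0_iff)
  qed
  have sum_u: "(\<Sum>i\<in>UNIV. u i) = h \<kappa>"
  proof -
    have "(\<Sum>i\<in>UNIV. u i) = to_ac (w * to_field (\<Sum>i\<in>UNIV. pvar i :: 'n cpoly))"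
      by (simp add: u_def to_ac_sum rhomD(7)[OF rhom_to_field] sum_distrib_left)
    then show ?thesis using sum0 by (simp add: w_def h_def to_field_eq_0_iff)
  qed
  interpret deformation l f e h u undefined a b \<kappa>
    using h generic r a \<kappa> sum_u b by unfold_locales (auto simp: nondegenerate_def)
  show ?thesis using indep_forms_transfer[of m c A] A by blast
qed

text \<open>The case m = 1: independence of a single form already contains nondegeneracy.\<close>

lemma nondegenerate_change_weights:
  assumes r: "r \<ge> 1" and a: "\<And>j. j < l \<Longrightarrow> Re (a j) > 0"
    and \<kappa>: "(\<Sum>j<l. a j * of_nat (e j)) = \<kappa>" "(\<Sum>j<l. b j * of_nat (e j)) = \<kappa>" "\<kappa> \<noteq> 0"
    and b: "nondegenerate (G b)"
  shows "nondegenerate (G a)"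
proof -
  have "indep_forms (G b) 1 (\<lambda>_. 1)" using b by (auto simp: indep_forms_def nondegenerate_def)
  from indep_forms_change_weights[OF r a \<kappa> b _ this] homogeneous_1
  obtain A' where "indep_forms (G a) 1 A'" by blast
  then have A': "\<And>d P. \<lbrakk>homogeneous d P; psubst P (G a) * A' 0 = 0\<rbrakk> \<Longrightarrow> P = 0"
    unfolding indep_forms_def by force
  show ?thesis unfolding nondegenerate_def using A' by auto
qed

text \<open>Product rule, multiplied by \<open>fr\<close> to avoid division. It makes the toric
  polar map of the product proportional to the logarithmic gradient whose weights are the
  multiplicities.\<close>

lemma theta_prod_powers:
  "theta i (\<Prod>j<l. f j ^ n j) * fr = (\<Prod>j<l. f j ^ n j) * G (\<lambda>j. of_nat (n j)) i"
proof -
  have "theta i (\<Prod>j\<in>S. f j ^ n j) * (\<Prod>j\<in>S. f j) =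
      (\<Prod>j\<in>S. f j ^ n j) * (\<Sum>j\<in>S. of_nat (n j) * (theta i (f j) * (\<Prod>m\<in>S - {j}. f m)))" if "finite S" for S
    using that
  proof (induction S rule: finite_induct)
    case (insert k S)
    have "(\<Prod>m\<in>insert k S - {j}. f m) = f k * (\<Prod>m\<in>S - {j}. f m)" if "j \<in> S" for j
    proof -
      have "insert k S - {j} = insert k (S - {j})" using that insert by auto
      then show ?thesis using insert by simp
    qed
    then have sum: "(\<Sum>j\<in>S. of_nat (n j) * (theta i (f j) * (\<Prod>m\<in>insert k S - {j}. f m))) =
        f k * (\<Sum>j\<in>S. of_nat (n j) * (theta i (f j) * (\<Prod>m\<in>S - {j}. f m)))"
      by (simp add: sum_distrib_left mult_ac)
    have ins: "insert k S - {k} = S" using insert by auto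
    have "theta i (\<Prod>j\<in>insert k S. f j ^ n j) * (\<Prod>j\<in>insert k S. f j) =
        (theta i (f k ^ n k) * f k) * (\<Prod>j\<in>S. f j ^ n j) * (\<Prod>j\<in>S. f j) +
        f k ^ n k * f k * (theta i (\<Prod>j\<in>S. f j ^ n j) * (\<Prod>j\<in>S. f j))"
      using insert by (simp add: theta_mult algebra_simps)
    then show ?case
      unfolding theta_power insert.IH using insert(1,2)
      by (simp add: sum ins algebra_simps)
  qed (simp add: theta_1)
  then show ?thesis by (simp add: fr_def G_def pconst_of_nat)
qed

lemma rat_map_degree_toric_polar_map:
  assumes n: "\<And>j. j < l \<Longrightarrow> n j \<ge> 1" and r: "r \<ge> 1"
  shows "rat_map_degree (toric_polar_map (\<Prod>j<l. f j ^ n j)) =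
    (if nondegenerate (G (\<lambda>j. of_nat (n j)))
     then ring.dim ring_of_type_algebra (pullback_field (G (\<lambda>j. of_nat (n j)))) proj_function_field else 0)"
proof -
  define F where "F = (\<Prod>j<l. f j ^ n j)"
  have F0: "F \<noteq> 0" using f_nonzero by (simp add: F_def)
  have F_hom: "homogeneous (\<Sum>j<l. n j * e j) F"
    unfolding F_def by (intro homogeneous_prod homogeneous_power) (auto simp: f_homogeneous)
  have "r \<le> (\<Sum>j<l. n j * e j)" unfolding r_def
  proof (rule sum_mono)
    fix j assume "j \<in> {..<l}"
    then show "e j \<le> n j * e j" using n[of j] by simp
  qed
  then have deg: "(\<Sum>j<l. n j * e j) \<ge> 1" using r by linarith
  have prp: "fr * toric_polar_map F i = F * G (\<lambda>j. of_nat (n j)) i" for i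
    unfolding toric_polar_map_eq F_def by (subst mult.commute) (rule theta_prod_powers)
  show ?thesis
    unfolding rat_map_degree_def F_def[symmetric] dominant_iff_nondegenerate[OF F0 F_hom deg]
      nondegenerate_proportional[OF prp fr_nonzero F0] pullback_field_proportional[OF prp fr_nonzero F0] ..
qed

end

theorem corollary2p2:
  fixes f :: "'n::{finite,linorder} cpoly"
    and k l :: nat
    and fs :: "nat \<Rightarrow> 'n cpoly"
    and ns :: "nat \<Rightarrow> nat"
  assumes "f \<noteq> 0"
    and "homogeneous k f"
    and "k \<ge> 1"
    and "irreducible_factorization f l fs ns"
  shows "rat_map_degree (toric_polar_map f) = rat_map_degree (toric_polar_map (\<Prod>j<l. fs j))"
proof -
  have f: "f = (\<Prod>j<l. fs j ^ ns j)" and ns: "\<And>j. j < l \<Longrightarrow> ns j \<ge> 1" and fs0: "\<And>j. j < l \<Longrightarrow> fs j \<noteq> 0"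
    using assms(4) by (auto simp: irreducible_factorization_def)
  have "\<forall>j\<in>{..<l}. \<exists>e. homogeneous e (fs j)"
    using homogeneous_factor_prod[of k fs ns l] assms(1,2) ns by (simp add: f)
  then obtain e where e: "\<And>j. j < l \<Longrightarrow> homogeneous (e j) (fs j)" by (metis lessThan_iff)
  interpret log_family l fs e
    using fs0 e by unfold_locales
  have "homogeneous (\<Sum>j<l. ns j * e j) f"
    unfolding f by (intro homogeneous_prod homogeneous_power) (auto simp: e)
  moreover obtain m where "m \<in> keys f" using assms(1) by (metis keys_eq_empty all_not_in_conv)
  ultimately have k: "k = (\<Sum>j<l. ns j * e j)" using assms(2) by (auto simp: homogeneous_iff)
  have r: "r \<ge> 1"
  proof (rule ccontr)
    assume "\<not> r \<ge> 1"
    then have "r = 0" by linarith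
    then have "(\<Sum>j<l. e j) = 0" by (simp add: r_def)
    then have "\<forall>j<l. e j = 0" by simp
    then show False using k assms(3) by simp
  qed
  define a :: "nat \<Rightarrow> complex" where "a = (\<lambda>j. of_nat (ns j))"
  \<comment> \<open>The reduced polynomial has weights 1 with total r; scaled by t they reach the
    total k of the multiplicities.\<close>
  define t :: real where "t = real k / real r"
  define b :: "nat \<Rightarrow> complex" where "b = (\<lambda>j. of_real t)"
  have t: "t > 0" using assms(3) r by (simp add: t_def)
  have a_pos: "Re (a j) > 0" if "j < l" for j using ns[OF that] by (simp add: a_def)
  have b_pos: "Re (b j) > 0" for j using t by (simp add: b_def)
  have wa: "(\<Sum>j<l. a j * of_nat (e j)) = of_nat k" by (simp add: a_def k)
  have wb: "(\<Sum>j<l. b j * of_nat (e j)) = of_nat k"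
  proof -
    have "(\<Sum>j<l. b j * of_nat (e j)) = of_real (t * real r)"
      by (simp add: b_def r_def sum_distrib_left)
    then show ?thesis using r by (simp add: t_def)
  qed
  have k0: "(of_nat k :: complex) \<noteq> 0" using assms(3) by simp
  \<comment> \<open>The constant weights t give t times the gradient for the weights 1, hence the
    same rational map.\<close>
  have G_b: "pconst (of_real t) * G (\<lambda>j. of_nat 1) i = 1 * G b i" for i
    by (simp add: G_def b_def sum_distrib_left rhomD(2)[OF rhom_pconst])
  have t0: "pconst (of_real t) \<noteq> (0 :: 'n cpoly)"
    using t by (simp add: pconst_eq_0_iff)
  \<comment> \<open>Both weight vectors are positive, so the deformation runs in either
    direction.\<close>
  have nd: "nondegenerate (G a) \<longleftrightarrow> nondegenerate (G b)"
    using nondegenerate_change_weights[OF r a_pos wa wb k0] nondegenerate_change_weights[OF r b_pos wb wa k0] by blast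
  have dims: "ring.dim ring_of_type_algebra (pullback_field (G a)) proj_function_field =
      ring.dim ring_of_type_algebra (pullback_field (G b)) proj_function_field" if na: "nondegenerate (G a)"
  proof (rule ring_dim_cong)
    have nb: "nondegenerate (G b)" using na nd by simp
    show "field_subset (pullback_field (G a))" "field_subset (pullback_field (G b))"
      using na nb by (simp_all add: pullback_field_eq graded_hom.field_subset_quotients[OF graded_hom_psubst])
    note M = proj.field_subset_quotients[folded proj_function_field_eq]
    show "0 \<in> (proj_function_field :: 'n cpoly fract set)" by (rule field_subset_0[OF M])
    show "x + y \<in> proj_function_field" if "x \<in> proj_function_field" "y \<in> proj_function_field" for x y :: "'n cpoly fract"
      using field_subset_add[OF M that] .
    show "z * x \<in> proj_function_field" if "z \<in> pullback_field (G a)" "x \<in> proj_function_field" for z x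
      using that pullback_field_subset[OF na G_homogeneous] field_subset_mult[OF M] by blast
    show "z * x \<in> proj_function_field" if "z \<in> pullback_field (G b)" "x \<in> proj_function_field" for z x
      using that pullback_field_subset[OF nb G_homogeneous] field_subset_mult[OF M] by blast
    show "indep_sizes (pullback_field (G a)) proj_function_field = indep_sizes (pullback_field (G b)) proj_function_field"
    proof (rule Set.set_eqI)
      fix m
      have "\<exists>A' c'. (\<forall>i<m. homogeneous c' (A' i)) \<and> indep_forms (G a) m A'"
        if "\<forall>i<m. homogeneous c (A i)" "indep_forms (G b) m A" for c A
        by (rule indep_forms_change_weights[OF r _ wa wb k0 nb that]) (rule a_pos)
      moreover have "\<exists>A' c'. (\<forall>i<m. homogeneous c' (A' i)) \<and> indep_forms (G b) m A'"
        if "\<forall>i<m. homogeneous c (A i)" "indep_forms (G a) m A" for c A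
        by (rule indep_forms_change_weights[OF r _ wb wa k0 na that]) (rule b_pos)
      ultimately show "m \<in> indep_sizes (pullback_field (G a)) proj_function_field \<longleftrightarrow>
          m \<in> indep_sizes (pullback_field (G b)) proj_function_field"
        unfolding indep_sizes_iff_indep_forms[OF na] indep_sizes_iff_indep_forms[OF nb] by blast
    qed
  qed
  have "rat_map_degree (toric_polar_map f) = (if nondegenerate (G a)
     then ring.dim ring_of_type_algebra (pullback_field (G a)) proj_function_field else 0)"
    unfolding f a_def by (rule rat_map_degree_toric_polar_map[OF ns r])
  also have "\<dots> = (if nondegenerate (G b)
     then ring.dim ring_of_type_algebra (pullback_field (G b)) proj_function_field else 0)"
    using nd dims by simp
  also have "\<dots> = rat_map_degree (toric_polar_map (\<Prod>j<l. fs j ^ 1))"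
    unfolding rat_map_degree_toric_polar_map[of "\<lambda>_. 1", OF order_refl r]
      nondegenerate_proportional[OF G_b t0 one_neq_zero] pullback_field_proportional[OF G_b t0 one_neq_zero] ..
  finally show ?thesis by simp
qed

end
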